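(* Suppose $D$ is a smooth hypersurface of degree $k$ in $\mathbb{P}^n$ that is Brody hyperbolic. For $d\geq n+3$ and a generic small deformation $S$ of $dD$ in $|\mathcal{O}_{\mathbb{P}^n}(dk)|$, let $W$ be the degree $dk$ cyclic cover of $\mathbb{P}^n$ branched along $S$. Then $W$ is a Brody hyperbolic hypersurface in $\mathbb{P}^{n+1}$ of degree $dk$.
   Context: We work over $\mathbb{C}$; $n,k,d$ are positive integers. A complex analytic space is called Brody hyperbolic if there are no non-constant holomorphic maps from $\mathbb{C}$ to it. Generic small deformation: let $s_1,\dots,s_N$ be a basis of $H^0(\mathbb{P}^n,\mathcal{O}(k))$ and let $s_D$ be a homogeneous polynomial of degree $k$ with $D=(s_D=0)$. A divisor $S\in|\mathcal{O}_{\mathbb{P}^n}(dk)|$ is a generic small deformation of $dD$ if $S$ is the zero locus of $$s_D^d+\sum_{i=1}^d F_i(s_1,\dots,s_N)\,s_D^{d-i}\,t^i$$ for generic choices of homogeneous polynomials $F_i$ of degree $i$ in $N$ variables ($1\le i\le d$) and for some $t\in\mathbb{C}\setminus\{0\}$ with $|t|\leq\epsilon$, where $\epsilon=\epsilon(\{F_i\})>0$ depends on the choice of $\{F_i\}$. Thus a property holds for a generic small deformation if, for all $(F_1,\dots,F_d)$ in some non-empty Zariski open subset of the parameter space, there is $\epsilon(\{F_i\})>0$ such that it holds for all $t$ with $0<|t|\le\epsilon$. Cyclic cover: if $S=(G(z_0,\dots,z_n)=0)$ with $G$ homogeneous of degree $dk$, the degree $dk$ cyclic cover of $\mathbb{P}^n$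 branched along $S$ is $(z_{n+1}^{dk}=G(z_0,\dots,z_n))\subset\mathbb{P}^{n+1}$, mapping to $\mathbb{P}^n$ by the linear projection $[z_0,\dots,z_{n+1}]\mapsto[z_0,\dots,z_n]$. *)

theory Defs
  imports "HOL-Analysis.Analysis" "HOL-Library.Poly_Mapping"
begin

section \<open>Polynomials in several variables\<close>

text \<open>Complex polynomials in variables indexed by \<open>'v\<close>: finitely supported coefficient functions
  on monomials, a monomial being a finitely supported exponent function. The library's
  convolution product makes this a commutative ring.\<close>

type_synonym 'v mpoly = "('v \<Rightarrow>\<^sub>0 nat) \<Rightarrow>\<^sub>0 complex"

definition mp_const :: "complex \<Rightarrow> 'v mpoly" where
  "mp_const c = Poly_Mapping.single 0 c"

definition mp_var :: "'v \<Rightarrow> 'v mpoly" where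
  "mp_var i = Poly_Mapping.single (Poly_Mapping.single i 1) 1"

definition mp_scale :: "complex \<Rightarrow> 'v mpoly \<Rightarrow> 'v mpoly" where
  "mp_scale c p = mp_const c * p"

definition mp_eval :: "('v \<Rightarrow> complex) \<Rightarrow> 'v mpoly \<Rightarrow> complex" where
  "mp_eval x p = (\<Sum>m\<in>Poly_Mapping.keys p.
     Poly_Mapping.lookup p m * (\<Prod>i\<in>Poly_Mapping.keys m. x i ^ Poly_Mapping.lookup m i))"

definition mp_subst :: "('w \<Rightarrow> 'v mpoly) \<Rightarrow> 'w mpoly \<Rightarrow> 'v mpoly" where
  "mp_subst s p = (\<Sum>m\<in>Poly_Mapping.keys p.
     mp_const (Poly_Mapping.lookup p m) *
     (\<Prod>i\<in>Poly_Mapping.keys m. s i ^ Poly_Mapping.lookup m i))"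

text \<open>The space of homogeneous polynomials of degree \<open>k\<close> in the variables \<open>V\<close> (including \<open>0\<close>).
  For \<open>V = {..n}\<close> this is \<open>H\<^sup>0(P\<^sup>n, O(k))\<close>.\<close>

definition homog :: "'v set \<Rightarrow> nat \<Rightarrow> 'v mpoly set" where
  "homog V k = {p. \<forall>m\<in>Poly_Mapping.keys p. Poly_Mapping.keys m \<subseteq> V \<and>
     (\<Sum>i\<in>Poly_Mapping.keys m. Poly_Mapping.lookup m i) = k}"

lemma mp_const_add: "mp_const (a + b) = mp_const a + mp_const b"
  by (simp add: mp_const_def single_add)

lemma mp_const_mult: "mp_const (a * b) = mp_const a * mp_const b"
  by (simp add: mp_const_def mult_single)

lemma mp_const_one: "mp_const 1 = 1"
  by (simp add: mp_const_def)

global_interpretation mp: vector_space "mp_scale :: complex \<Rightarrow> 'v mpoly \<Rightarrow> 'v mpoly"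
  by unfold_locales
    (simp_all add: mp_scale_def mp_const_add mp_const_mult mp_const_one algebra_simps)

definition is_basis_of :: "'v mpoly set \<Rightarrow> nat \<Rightarrow> (nat \<Rightarrow> 'v mpoly) \<Rightarrow> bool" where
  "is_basis_of E N s \<longleftrightarrow>
     inj_on s {1..N} \<and> \<not> mp.dependent (s ` {1..N}) \<and> mp.span (s ` {1..N}) = E"


section \<open>Projective space and holomorphic maps from the complex line\<close>

text \<open>A vector of \<open>C\<^sup>n\<^sup>+\<^sup>1\<close> is a function on \<open>nat\<close> that vanishes beyond \<open>n\<close>; a point of
  projective \<open>n\<close>-space is the set of all nonzero multiples of a nonzero vector.\<close>

definition nonzero_vecs :: "nat \<Rightarrow> (nat \<Rightarrow> complex) set" where
  "nonzero_vecs n = {x. (\<forall>i>n. x i = 0) \<and> (\<exists>i. x i \<noteq> 0)}"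

definition proj_class :: "(nat \<Rightarrow> complex) \<Rightarrow> (nat \<Rightarrow> complex) set" where
  "proj_class x = {y. \<exists>c. c \<noteq> 0 \<and> y = (\<lambda>i. c * x i)}"

definition proj_space :: "nat \<Rightarrow> (nat \<Rightarrow> complex) set set" where
  "proj_space n = proj_class ` nonzero_vecs n"

definition chart_dom :: "nat \<Rightarrow> nat \<Rightarrow> (nat \<Rightarrow> complex) set set" where
  "chart_dom n i = {p \<in> proj_space n. \<forall>x\<in>p. x i \<noteq> 0}"

definition affine_coord :: "nat \<Rightarrow> (nat \<Rightarrow> complex) set \<Rightarrow> nat \<Rightarrow> complex" where
  "affine_coord i p j = (let x = (SOME x. x \<in> p) in x j / x i)"

lemma affine_coord_proj_class: "affine_coord i (proj_class x) j = x j / x i"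
proof -
  have "x \<in> proj_class x"
    unfolding proj_class_def by (rule CollectI, rule exI[of _ 1]) simp
  then have "(SOME y. y \<in> proj_class x) \<in> proj_class x"
    by (rule someI[where P = "\<lambda>y. y \<in> proj_class x"])
  then show ?thesis
    by (auto simp: affine_coord_def Let_def proj_class_def)
qed

definition holo_curve :: "nat \<Rightarrow> (complex \<Rightarrow> (nat \<Rightarrow> complex) set) \<Rightarrow> bool" where
  "holo_curve n f \<longleftrightarrow>
     (\<forall>z. \<exists>i\<le>n. \<exists>U. open U \<and> z \<in> U \<and> f ` U \<subseteq> chart_dom n i \<and>
        (\<forall>j\<le>n. (\<lambda>w. affine_coord i (f w) j) holomorphic_on U))"

text \<open>Brody hyperbolicity of a closed analytic subspace with underlying set \<open>X\<close>. The possible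
  non-reducedness of the subspace is irrelevant: a holomorphic map from the (reduced) complex
  line to it is a holomorphic map to projective space with image in \<open>X\<close>.\<close>

definition brody_hyperbolic :: "nat \<Rightarrow> (nat \<Rightarrow> complex) set set \<Rightarrow> bool" where
  "brody_hyperbolic n X \<longleftrightarrow>
     (\<forall>f. holo_curve n f \<and> (\<forall>z. f z \<in> X) \<longrightarrow> (\<exists>p. \<forall>z. f z = p))"


section \<open>Hypersurfaces\<close>

text \<open>A hypersurface (effective divisor) of degree \<open>k\<close> is given by its equation.\<close>

definition hypersurface :: "nat \<Rightarrow> nat \<Rightarrow> nat mpoly \<Rightarrow> bool" where
  "hypersurface n k G \<longleftrightarrow> G \<in> homog {..n} k \<and> G \<noteq> 0"

definition zero_locus :: "nat \<Rightarrow> nat mpoly \<Rightarrow> (nat \<Rightarrow> complex) set set" where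
  "zero_locus n G = {p \<in> proj_space n. \<forall>x\<in>p. mp_eval x G = 0}"

text \<open>The Jacobian criterion; \<open>deriv\<close> computes the partial derivative of \<open>G\<close> at \<open>x\<close> in the
  direction of the \<open>i\<close>-th variable.\<close>

definition smooth_hypersurface :: "nat \<Rightarrow> nat \<Rightarrow> nat mpoly \<Rightarrow> bool" where
  "smooth_hypersurface n k G \<longleftrightarrow> hypersurface n k G \<and>
     (\<forall>x\<in>nonzero_vecs n. mp_eval x G = 0 \<longrightarrow>
        (\<exists>i\<le>n. deriv (\<lambda>w. mp_eval (x(i := w)) G) (x i) \<noteq> 0))"

text \<open>The equation \<open>z\<^sub>n\<^sub>+\<^sub>1\<^sup>e = G(z\<^sub>0,\<dots>,z\<^sub>n)\<close> of the cyclic cover of degree \<open>e\<close> branched along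
  \<open>(G = 0)\<close>, in projective \<open>(n+1)\<close>-space.\<close>

definition cyclic_cover :: "nat \<Rightarrow> nat \<Rightarrow> nat mpoly \<Rightarrow> nat mpoly" where
  "cyclic_cover n e G = mp_var (n + 1) ^ e - G"


section \<open>Generic small deformations\<close>

text \<open>The parameter space of tuples \<open>(F\<^sub>1,\<dots>,F\<^sub>d)\<close>, with \<open>F\<^sub>i\<close> homogeneous of degree \<open>i\<close> in the
  variables \<open>1,\<dots>,N\<close>; entries outside \<open>1,\<dots>,d\<close> are normalised to \<open>0\<close>.\<close>

definition deform_params :: "nat \<Rightarrow> nat \<Rightarrow> (nat \<Rightarrow> nat mpoly) set" where
  "deform_params N d =
     {F. (\<forall>i\<in>{1..d}. F i \<in> homog {1..N} i) \<and> (\<forall>i. i \<notin> {1..d} \<longrightarrow> F i = 0)}"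

text \<open>The linear coordinates on the parameter space are the coefficients of the \<open>F\<^sub>i\<close>; a Zariski
  open set is the complement of the common zeros of a set \<open>Q\<close> of polynomials in them.\<close>

definition param_coords :: "(nat \<Rightarrow> nat mpoly) \<Rightarrow> nat \<times> (nat \<Rightarrow>\<^sub>0 nat) \<Rightarrow> complex" where
  "param_coords F = (\<lambda>(i, m). Poly_Mapping.lookup (F i) m)"

definition zariski_open :: "nat \<Rightarrow> nat \<Rightarrow> (nat \<Rightarrow> nat mpoly) set \<Rightarrow> bool" where
  "zariski_open N d U \<longleftrightarrow> (\<exists>Q :: (nat \<times> (nat \<Rightarrow>\<^sub>0 nat)) mpoly set.
     U = {F \<in> deform_params N d. \<exists>q\<in>Q. mp_eval (param_coords F) q \<noteq> 0})"

definition deformation ::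
  "nat \<Rightarrow> nat mpoly \<Rightarrow> (nat \<Rightarrow> nat mpoly) \<Rightarrow> (nat \<Rightarrow> nat mpoly) \<Rightarrow> complex \<Rightarrow> nat mpoly" where
  "deformation d sD s F t =
     sD ^ d + (\<Sum>i=1..d. mp_subst s (F i) * sD ^ (d - i) * mp_const (t ^ i))"

definition generic_small_deformation ::
  "nat \<Rightarrow> nat mpoly \<Rightarrow> nat \<Rightarrow> (nat \<Rightarrow> nat mpoly) \<Rightarrow> (nat mpoly \<Rightarrow> bool) \<Rightarrow> bool" where
  "generic_small_deformation d sD N s P \<longleftrightarrow>
     (\<exists>U. zariski_open N d U \<and> U \<noteq> {} \<and>
        (\<forall>F\<in>U. \<exists>\<epsilon>>0. \<forall>t. t \<noteq> 0 \<and> norm t \<le> \<epsilon> \<longrightarrow> P (deformation d sD s F t)))"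

end

theory Submission
  imports Defs "HOL-Complex_Analysis.Complex_Analysis"
    "HOL-Computational_Algebra.Computational_Algebra" "HOL-Computational_Algebra.Field_as_Ring"
begin

text \<open>Put \<open>u = s\<^sub>D / t\<close> and \<open>v = z\<^sub>n\<^sub>+\<^sub>1 / t\<^sup>1\<^sup>/\<^sup>k\<close>. The cover becomes \<open>v\<^sup>d\<^sup>k = u\<^sup>d + \<Sum> F\<^sub>i(s) u\<^sup>d\<^sup>-\<^sup>i\<close>, where
  \<open>u\<close> is bounded in terms of the other coordinates because it solves a monic equation. If the covers
  carried nonconstant entire curves for a sequence \<open>t \<rightarrow> 0\<close>, Brody's reparametrisation would give a
  nonconstant limit curve with \<open>s\<^sub>D = t u = 0\<close>. Its image in \<open>D\<close> is constant by hyperbolicity, say the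
  class of \<open>x\<close>, so it is an entire curve of bounded spherical derivative in \<open>V\<^sup>d\<^sup>k = p(u)\<close>, where
  \<open>p(u) = u\<^sup>d + \<Sum> F\<^sub>i(s(x)) u\<^sup>d\<^sup>-\<^sup>i\<close>. When \<open>p\<close> has enough distinct roots, with \<open>R\<close> the product of the
  corresponding linear factors, the differentials \<open>V du / R(u)\<close> and \<open>u V du / R(u)\<close> are regular, so they
  pull back to bounded entire functions; these are constant by Liouville's theorem, hence so is their
  quotient \<open>u\<close>. A dimension count shows that for generic \<open>F\<close> every \<open>x\<close> in \<open>D\<close> gives enough roots.\<close>

section \<open>Evaluation of polynomials\<close>

text \<open>The number of roots comes from the behaviour at infinity, where \<open>u\<close> grows
  at most like the power \<open>k\<close> of \<open>V\<close>, and its derivative like the power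
  \<open>k + 1\<close>. With \<open>r\<close> distinct roots, \<open>V du / R(u)\<close> has growth
  exponent at most \<open>k + 2 - k * r\<close> in \<open>V\<close>, and the factor \<open>u\<close>
  adds \<open>k\<close>. So both functions are bounded once \<open>2 * k + 2 \<le> k * r\<close>:
  three roots for \<open>k \<ge> 2\<close>, four for \<open>k = 1\<close>. Having at most two roots
  imposes \<open>d - 2\<close> conditions on a monic polynomial of degree \<open>d\<close>, while
  the base point moves in dimension \<open>n\<close>; hence a generic choice avoids it when
  \<open>d > n + 2\<close>, which is the bound on \<open>d\<close>.

  Two obstacles shape the analysis. The function \<open>u\<close> has weight \<open>k\<close> while
  the coordinates have weight 1, so all limits are taken with a common local factor that is only
  known up to its choice. And the limit curve lies on the cone over \<open>D\<close>, whose
  projection to \<open>D\<close> is undefined at the vertex. Spherical derivatives are replaced by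
  the condition that one fixed coordinate is, up to a factor 2, the largest on balls of fixed
  radius. This survives locally uniform limits and gives derivative bounds back through Cauchy's
  estimate.\<close>

abbreviation keys where "keys \<equiv> Poly_Mapping.keys"
abbreviation lookup where "lookup \<equiv> Poly_Mapping.lookup"
abbreviation single where "single \<equiv> Poly_Mapping.single"

definition mon_eval :: "('v \<Rightarrow> complex) \<Rightarrow> ('v \<Rightarrow>\<^sub>0 nat) \<Rightarrow> complex" where
  "mon_eval x m = (\<Prod>i\<in>keys m. x i ^ lookup m i)"

lemma mon_eval_superset:
  assumes "finite K" "keys m \<subseteq> K"
  shows "mon_eval x m = (\<Prod>i\<in>K. x i ^ lookup m i)"
  unfolding mon_eval_def
  by (rule prod.mono_neutral_left) (use assms in \<open>auto simp: in_keys_iff\<close>)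

lemma mon_eval_add: "mon_eval x (a + b) = mon_eval x a * mon_eval x b"
proof -
  let ?K = "keys a \<union> keys b"
  have "mon_eval x (a + b) = (\<Prod>i\<in>?K. x i ^ lookup (a + b) i)"
    by (rule mon_eval_superset) (auto dest: Poly_Mapping.keys_add[THEN subsetD])
  also have "\<dots> = mon_eval x a * mon_eval x b"
    by (simp add: mon_eval_superset[of ?K a] mon_eval_superset[of ?K b] lookup_add power_add
        prod.distrib)
  finally show ?thesis .
qed

lemma mon_eval_zero [simp]: "mon_eval x 0 = 1"
  by (simp add: mon_eval_def)

lemma mon_eval_single [simp]: "mon_eval x (single i e) = x i ^ e"
  by (cases "e = 0") (simp_all add: mon_eval_def)

lemma mp_eval_superset:
  assumes "finite K" "keys p \<subseteq> K"
  shows "mp_eval x p = (\<Sum>m\<in>K. lookup p m * mon_eval x m)"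
  unfolding mp_eval_def mon_eval_def[symmetric]
  by (rule sum.mono_neutral_left) (use assms in \<open>auto simp: in_keys_iff\<close>)

lemma mp_eval_mon_eval:
  "mp_eval x p = (\<Sum>m\<in>keys p. lookup p m * mon_eval x m)"
  by (simp add: mp_eval_superset)

lemma mp_eval_zero [simp]: "mp_eval x 0 = 0"
  by (simp add: mp_eval_def)

lemma mp_eval_single [simp]: "mp_eval x (single m c) = c * mon_eval x m"
  by (cases "c = 0") (simp_all add: mp_eval_mon_eval)

lemma mp_eval_add [simp]: "mp_eval x (p + q) = mp_eval x p + mp_eval x q"
proof -
  let ?K = "keys p \<union> keys q"
  have "mp_eval x (p + q) = (\<Sum>m\<in>?K. lookup (p + q) m * mon_eval x m)"
    by (rule mp_eval_superset) (auto dest: Poly_Mapping.keys_add[THEN subsetD])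
  then show ?thesis
    by (simp add: mp_eval_superset[of ?K p] mp_eval_superset[of ?K q] lookup_add
        algebra_simps sum.distrib)
qed

lemma mp_eval_sum [simp]: "mp_eval x (\<Sum>i\<in>A. p i) = (\<Sum>i\<in>A. mp_eval x (p i))"
  by (induction A rule: infinite_finite_induct) auto

lemma mpoly_sum_monomials:
  "p = (\<Sum>m\<in>keys p. single m (lookup p m))"
proof (rule poly_mapping_eqI)
  fix m
  show "lookup p m =
     lookup (\<Sum>m\<in>keys p. single m (lookup p m)) m"
    by (simp add: lookup_sum lookup_single when_def in_keys_iff)
qed

lemma mp_eval_mult [simp]: "mp_eval x (p * q) = mp_eval x p * mp_eval x q"
proof -
  have "mp_eval x (p * q) = mp_eval x
     ((\<Sum>a\<in>keys p. single a (lookup p a)) *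
      (\<Sum>b\<in>keys q. single b (lookup q b)))"
    by (simp flip: mpoly_sum_monomials)
  also have "\<dots> = mp_eval x p * mp_eval x q"
    by (simp add: sum_product mult_single mp_eval_mon_eval[of x p] mp_eval_mon_eval[of x q]
        mon_eval_add algebra_simps)
  finally show ?thesis .
qed

lemma mp_eval_one [simp]: "mp_eval x 1 = 1"
  using mp_eval_single[of x 0 1] by simp

lemma mp_eval_power [simp]: "mp_eval x (p ^ e) = mp_eval x p ^ e"
  by (induction e) auto

lemma mp_eval_prod [simp]: "mp_eval x (\<Prod>i\<in>A. p i) = (\<Prod>i\<in>A. mp_eval x (p i))"
  by (induction A rule: infinite_finite_induct) auto

lemma mp_eval_const [simp]: "mp_eval x (mp_const c) = c"
  by (simp add: mp_const_def)

lemma mp_eval_var [simp]: "mp_eval x (mp_var i) = x i"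
  by (simp add: mp_var_def)

lemma mp_eval_uminus [simp]: "mp_eval x (- p) = - mp_eval x p"
  using mp_eval_add[of x p "- p"] by (simp del: mp_eval_add add: eq_neg_iff_add_eq_0 add.commute)

lemma mp_eval_diff [simp]: "mp_eval x (p - q) = mp_eval x p - mp_eval x q"
  using mp_eval_add[of x p "- q"] by (simp del: mp_eval_add)

lemma mp_eval_scale [simp]: "mp_eval x (mp_scale c p) = c * mp_eval x p"
  by (simp add: mp_scale_def)

lemma mp_eval_subst: "mp_eval x (mp_subst s p) = mp_eval (\<lambda>i. mp_eval x (s i)) p"
  by (simp add: mp_subst_def mp_eval_mon_eval[of _ p] mon_eval_def)

definition mp_supported :: "'v set \<Rightarrow> 'v mpoly \<Rightarrow> bool" where
  "mp_supported V p \<longleftrightarrow> (\<forall>m\<in>keys p. keys m \<subseteq> V)"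

lemma mp_eval_cong:
  assumes "mp_supported V p" "\<And>i. i \<in> V \<Longrightarrow> x i = y i"
  shows "mp_eval x p = mp_eval y p"
  unfolding mp_eval_def
  by (intro sum.cong prod.cong arg_cong2[where f = "(*)"] refl) (use assms in \<open>auto simp: mp_supported_def subset_iff\<close>)

lemma mp_supported_single:
  "keys m \<subseteq> V \<Longrightarrow> mp_supported V (single m c)"
  by (auto simp: mp_supported_def)

lemma mp_supported_const [simp]: "mp_supported V (mp_const c)"
  by (auto simp: mp_supported_def mp_const_def)

lemma mp_supported_var: "i \<in> V \<Longrightarrow> mp_supported V (mp_var i)"
  by (auto simp: mp_supported_def mp_var_def)

lemma mp_supported_add: "mp_supported V p \<Longrightarrow> mp_supported V q \<Longrightarrow> mp_supported V (p + q)"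
  using Poly_Mapping.keys_add[of p q] by (auto simp: mp_supported_def)

lemma mp_supported_mult:
  assumes "mp_supported V p" "mp_supported V q"
  shows "mp_supported V (p * q)"
  unfolding mp_supported_def
proof
  fix m assume "m \<in> keys (p * q)"
  then obtain a b where "m = a + b" "a \<in> keys p" "b \<in> keys q"
    using keys_mult[of p q] by blast
  then show "keys m \<subseteq> V"
    using assms Poly_Mapping.keys_add[of a b] unfolding mp_supported_def by blast
qed

lemma homog_supported: "p \<in> homog V e \<Longrightarrow> mp_supported V p"
  by (auto simp: homog_def mp_supported_def)

section \<open>Scaling and homogeneous polynomials\<close>

lemma mon_eval_scale:
  "mon_eval (\<lambda>i. c * x i) m =
     c ^ (\<Sum>i\<in>keys m. lookup m i) * mon_eval x m"
  by (simp add: mon_eval_def power_mult_distrib prod.distrib power_sum)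

lemma mp_eval_homog:
  assumes "p \<in> homog V e"
  shows "mp_eval (\<lambda>i. c * x i) p = c ^ e * mp_eval x p"
  unfolding mp_eval_mon_eval mon_eval_scale sum_distrib_left
  by (rule sum.cong) (use assms in \<open>auto simp: homog_def\<close>)

lemma homog_mult:
  assumes "p \<in> homog V a" "q \<in> homog V b"
  shows "p * q \<in> homog V (a + b)"
proof -
  have deg_add: "(\<Sum>i\<in>keys (m + m'). lookup (m + m') i) =
      (\<Sum>i\<in>keys m. lookup m i) +
      (\<Sum>i\<in>keys m'. lookup m' i)" for m m' :: "'a \<Rightarrow>\<^sub>0 nat"
    by (rule setsum_keys_plus_distrib) auto
  show ?thesis
    unfolding homog_def
  proof (clarify, intro conjI)
    fix m assume "m \<in> keys (p * q)"
    then obtain u v where m: "m = u + v" and uv: "u \<in> keys p" "v \<in> keys q"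
      using keys_mult[of p q] by blast
    show "keys m \<subseteq> V"
      using assms uv Poly_Mapping.keys_add[of u v] unfolding homog_def m by blast
    show "(\<Sum>i\<in>keys m. lookup m i) = a + b"
      using assms uv unfolding m deg_add by (simp add: homog_def)
  qed
qed

lemma homog_zero [simp]: "0 \<in> homog V a"
  by (simp add: homog_def)

lemma homog_one [simp]: "1 \<in> homog V 0"
  by (simp add: homog_def)

lemma homog_const: "mp_const c \<in> homog V 0"
  by (simp add: homog_def mp_const_def)

lemma homog_var: "i \<in> V \<Longrightarrow> mp_var i \<in> homog V 1"
  by (simp add: homog_def mp_var_def)

lemma homog_add: "p \<in> homog V a \<Longrightarrow> q \<in> homog V a \<Longrightarrow> p + q \<in> homog V a"
  using Poly_Mapping.keys_add[of p q] by (auto simp: homog_def)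

lemma homog_uminus: "p \<in> homog V a \<Longrightarrow> - p \<in> homog V a"
  by (auto simp: homog_def in_keys_iff)

lemma homog_sum: "(\<And>i. i \<in> A \<Longrightarrow> p i \<in> homog V a) \<Longrightarrow> (\<Sum>i\<in>A. p i) \<in> homog V a"
  by (induction A rule: infinite_finite_induct) (auto intro: homog_add)

lemma homog_power: "p \<in> homog V a \<Longrightarrow> p ^ e \<in> homog V (e * a)"
  by (induction e) (auto intro: homog_mult)

lemma homog_prod:
  "(\<And>i. i \<in> A \<Longrightarrow> p i \<in> homog V (e i)) \<Longrightarrow> (\<Prod>i\<in>A. p i) \<in> homog V (\<Sum>i\<in>A. e i)"
  by (induction A rule: infinite_finite_induct) (auto intro: homog_mult)

lemma homog_mono: "V \<subseteq> W \<Longrightarrow> homog V a \<subseteq> homog W a"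
  by (auto simp: homog_def)

lemma homog_subst:
  assumes "p \<in> homog W e" "\<And>i. i \<in> W \<Longrightarrow> s i \<in> homog V k"
  shows "mp_subst s p \<in> homog V (e * k)"
  unfolding mp_subst_def
proof (rule homog_sum)
  fix m assume m: "m \<in> keys p"
  have "(\<Prod>i\<in>keys m. s i ^ lookup m i)
      \<in> homog V (\<Sum>i\<in>keys m. lookup m i * k)"
    by (rule homog_prod, rule homog_power) (use assms(1) m in \<open>auto intro!: assms(2) simp: homog_def[of W]\<close>)
  also have "(\<Sum>i\<in>keys m. lookup m i * k) = e * k"
    using assms(1) m by (simp add: homog_def flip: sum_distrib_right)
  finally show "mp_const (lookup p m) *
      (\<Prod>i\<in>keys m. s i ^ lookup m i) \<in> homog V (e * k)"
    using homog_mult[OF homog_const] by fastforce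
qed

lemma mon_eval_upd:
  "mon_eval (x(i := c * x i)) m = c ^ lookup m i * mon_eval x m"
proof -
  let ?K = "insert i (keys m)"
  have "mon_eval (x(i := c * x i)) m = (\<Prod>j\<in>?K. (x(i := c * x i)) j ^ lookup m j)"
    by (rule mon_eval_superset) auto
  also have "\<dots> = (\<Prod>j\<in>?K. (if j = i then c ^ lookup m i else 1) * x j ^ lookup m j)"
    by (rule prod.cong) (auto simp: power_mult_distrib)
  also have "\<dots> = c ^ lookup m i * mon_eval x m"
    unfolding prod.distrib by (subst prod.delta) (simp_all add: mon_eval_superset[of ?K m] subset_insertI)
  finally show ?thesis .
qed

text \<open>Rescaling one variable and subtracting a multiple removes a monomial without changing the
  vanishing of the polynomial function, so a vanishing function has no monomials.\<close>

lemma mp_nonvanishing: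
  "q \<noteq> 0 \<Longrightarrow> \<exists>x. mp_eval x q \<noteq> 0"
proof (induction "card (keys q)" arbitrary: q rule: less_induct)
  case less
  show ?case
  proof (rule ccontr)
    assume "\<not> (\<exists>x. mp_eval x q \<noteq> 0)"
    then have vanish: "mp_eval x q = 0" for x
      by auto
    obtain m where m: "m \<in> keys q"
      using less.prems by (metis all_not_in_conv keys_eq_empty)
    show False
    proof (cases "keys q = {m}")
      case True
      \<comment> \<open>A single monomial does not vanish at the point with all coordinates
        1.\<close>
      then show False
        using vanish[of "\<lambda>_. 1"] m[unfolded in_keys_iff]
        by (simp add: mp_eval_mon_eval mon_eval_def)
    next
      case False
      then obtain m' where m': "m' \<in> keys q" "m' \<noteq> m"
        using m by blast
      then obtain i where i: "lookup m i \<noteq> lookup m' i"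
        by (metis poly_mapping_eqI)
      define w :: "('a \<Rightarrow>\<^sub>0 nat) \<Rightarrow> complex"
        where "w m' = 2 ^ lookup m' i - 2 ^ lookup m i" for m'
      define q' where "q' = (\<Sum>a\<in>keys q. single a (w a * lookup q a))"
      have lookup_q': "lookup q' a = w a * lookup q a" for a
        by (simp add: q'_def lookup_sum lookup_single when_def in_keys_iff)
      have "w m' \<noteq> 0"
        using i by (auto simp: w_def norm_power dest: arg_cong[where f = norm])
      then have "q' \<noteq> 0"
        using m' lookup_q'[of m'] by (auto simp: in_keys_iff)
      moreover have "keys q' \<subset> keys q"
        using m lookup_q' by (auto simp: in_keys_iff w_def)
      then have "card (keys q') < card (keys q)"
        by (simp add: psubset_card_mono)
      ultimately obtain x where "mp_eval x q' \<noteq> 0"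
        using less.hyps by blast
      moreover have "mp_eval x q' = mp_eval (x(i := 2 * x i)) q - 2 ^ lookup m i * mp_eval x q"
        unfolding q'_def w_def mp_eval_mon_eval[of _ q] mon_eval_upd
        by (simp add: sum_distrib_left sum_subtractf algebra_simps)
      ultimately show False
        using vanish by simp
    qed
  qed
qed

section \<open>Restriction to lines and the absence of zero divisors\<close>

lemma mp_eval_line:
  "\<exists>p. \<forall>t. poly p t = mp_eval (\<lambda>i. a i + t * b i) q"
proof
  let ?p = "\<Sum>m\<in>keys q. smult (lookup q m)
     (\<Prod>i\<in>keys m. [:a i, b i:] ^ lookup m i)"
  show "\<forall>t. poly ?p t = mp_eval (\<lambda>i. a i + t * b i) q"
    by (simp add: poly_sum poly_prod mp_eval_def algebra_simps)
qed

text \<open>On the line through a point where \<open>p\<close> is nonzero and a point where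
  \<open>q\<close> is nonzero, both restrict to nonzero polynomials in one variable, whose product
  is nonzero.\<close>

lemma mp_mult_nonzero:
  fixes p q :: "'v mpoly"
  assumes "p \<noteq> 0" "q \<noteq> 0"
  shows "p * q \<noteq> 0"
proof -
  obtain x y where x: "mp_eval x p \<noteq> 0" and y: "mp_eval y q \<noteq> 0"
    using assms mp_nonvanishing by meson
  obtain f where f: "\<And>t. poly f t = mp_eval (\<lambda>i. x i + t * (y i - x i)) p"
    using mp_eval_line[of x "\<lambda>i. y i - x i" p] by blast
  obtain g where g: "\<And>t. poly g t = mp_eval (\<lambda>i. x i + t * (y i - x i)) q"
    using mp_eval_line[of x "\<lambda>i. y i - x i" q] by blast
  have "f \<noteq> 0" "g \<noteq> 0"
    using f[of 0] g[of 1] x y by auto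
  then have "f * g \<noteq> 0"
    by simp
  then obtain t where "poly (f * g) t \<noteq> 0"
    using poly_all_0_iff_0 by blast
  then have "mp_eval (\<lambda>i. x i + t * (y i - x i)) (p * q) \<noteq> 0"
    by (simp add: f g)
  then show ?thesis
    by (metis mp_eval_zero)
qed

lemma mp_prod_nonzero:
  fixes p :: "'a \<Rightarrow> 'v mpoly"
  shows "(\<And>i. i \<in> A \<Longrightarrow> p i \<noteq> 0) \<Longrightarrow> (\<Prod>i\<in>A. p i) \<noteq> 0"
  by (induction A rule: infinite_finite_induct) (simp_all add: mp_mult_nonzero)

section \<open>Algebraic dependence by counting monomials\<close>

lemma mp_supported_diff: "mp_supported V p \<Longrightarrow> mp_supported V q \<Longrightarrow> mp_supported V (p - q)"
  using keys_diff[of p q] by (auto simp: mp_supported_def)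

text \<open>Bounding each exponent separately, instead of the total degree, makes the number of
  monomials an exact power, which keeps the counting argument short.\<close>

definition monoms :: "'v set \<Rightarrow> nat \<Rightarrow> ('v \<Rightarrow>\<^sub>0 nat) set" where
  "monoms V E = {m. keys m \<subseteq> V \<and> (\<forall>i. lookup m i \<le> E)}"

lemma
  assumes "finite V"
  shows finite_monoms: "finite (monoms V E)" and card_monoms: "card (monoms V E) = (E + 1) ^ card V"
proof -
  have "bij_betw (\<lambda>m. restrict (lookup m) V) (monoms V E) (V \<rightarrow>\<^sub>E {..E})"
    unfolding bij_betw_def
  proof
    show "inj_on (\<lambda>m. restrict (lookup m) V) (monoms V E)"
    proof (rule inj_onI, rule poly_mapping_eqI)
      fix m m' i
      assume m: "m \<in> monoms V E" "m' \<in> monoms V E"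
        and eq: "restrict (lookup m) V = restrict (lookup m') V"
      show "lookup m i = lookup m' i"
      proof (cases "i \<in> V")
        case True
        then show ?thesis using fun_cong[OF eq, of i] by simp
      next
        case False
        then have "i \<notin> keys m" "i \<notin> keys m'"
          using m by (auto simp: monoms_def)
        then show ?thesis by (simp add: in_keys_iff)
      qed
    qed
    show "(\<lambda>m. restrict (lookup m) V) ` monoms V E = (V \<rightarrow>\<^sub>E {..E})"
    proof
      show "(\<lambda>m. restrict (lookup m) V) ` monoms V E \<subseteq> (V \<rightarrow>\<^sub>E {..E})"
        by (auto simp: monoms_def)
      show "(V \<rightarrow>\<^sub>E {..E}) \<subseteq> (\<lambda>m. restrict (lookup m) V) ` monoms V E"
      proof
        fix g assume g: "g \<in> V \<rightarrow>\<^sub>E {..E}"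
        define m where "m = (\<Sum>i\<in>V. single i (g i))"
        have lm: "lookup m i = (if i \<in> V then g i else 0)" for i
          using assms by (simp add: m_def lookup_sum lookup_single when_def)
        then have "m \<in> monoms V E"
          using g by (auto simp: monoms_def in_keys_iff split: if_splits)
        moreover have "restrict (lookup m) V = g"
          using g by (auto simp: lm PiE_def extensional_def restrict_def)
        ultimately show "g \<in> (\<lambda>m. restrict (lookup m) V) ` monoms V E"
          by blast
      qed
    qed
  qed
  from bij_betw_finite[OF this] bij_betw_same_card[OF this]
  show "finite (monoms V E)" "card (monoms V E) = (E + 1) ^ card V"
    using assms by (simp_all add: finite_PiE card_PiE)
qed

lemma ex_monoms_bound:
  assumes "mp_supported V p"
  shows "\<exists>E. keys p \<subseteq> monoms V E"
proof -
  have "finite (\<Union>m\<in>keys p. Poly_Mapping.range m)" by auto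
  then obtain E where E: "\<forall>e\<in>(\<Union>m\<in>keys p. Poly_Mapping.range m). e \<le> E"
    unfolding finite_nat_set_iff_bounded_le by (elim exE)
  have "lookup m i \<le> E" if "m \<in> keys p" for m i
    using E that in_keys_lookup_in_range[of i m] by (cases "lookup m i = 0") (auto simp: in_keys_iff)
  then show ?thesis
    using assms by (intro exI[of _ E]) (auto simp: monoms_def mp_supported_def)
qed

lemma monoms_mono: "E \<le> E' \<Longrightarrow> monoms V E \<subseteq> monoms V E'"
  unfolding monoms_def using le_trans by blast

lemma keys_mult_monoms:
  assumes "keys (p :: 'v mpoly) \<subseteq> monoms V D" "keys q \<subseteq> monoms V E"
  shows "keys (p * q) \<subseteq> monoms V (D + E)"
proof
  fix m assume "m \<in> keys (p * q)"
  then obtain a b where m: "m = a + b" and "a \<in> keys p" "b \<in> keys q"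
    using keys_mult[of p q] by blast
  then have "a \<in> monoms V D" "b \<in> monoms V E"
    using assms by auto
  then show "m \<in> monoms V (D + E)"
    unfolding monoms_def m using Poly_Mapping.keys_add[of a b] by (auto simp: lookup_add intro!: add_mono)
qed

lemma keys_power_monoms:
  assumes "keys (p :: 'v mpoly) \<subseteq> monoms V D"
  shows "keys (p ^ e) \<subseteq> monoms V (e * D)"
proof (induction e)
  case 0
  then show ?case by (simp add: monoms_def)
next
  case (Suc e)
  then show ?case using keys_mult_monoms[OF assms Suc] by simp
qed

lemma keys_prod_monoms:
  assumes "\<And>i. i \<in> A \<Longrightarrow> keys (p i :: 'v mpoly) \<subseteq> monoms V (D i)"
  shows "keys (\<Prod>i\<in>A. p i) \<subseteq> monoms V (\<Sum>i\<in>A. D i)"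
  using assms
proof (induction A rule: infinite_finite_induct)
  case (insert x F)
  then show ?case using keys_mult_monoms[of "p x" V "D x" "\<Prod>i\<in>F. p i" "\<Sum>i\<in>F. D i"] by simp
qed (simp_all add: monoms_def)

lemma monoms_span:
  assumes "keys p \<subseteq> monoms V E"
  shows "p \<in> mp.span ((\<lambda>m. single m 1) ` monoms V E)"
proof -
  have "p = (\<Sum>m\<in>keys p. mp_scale (lookup p m) (single m 1))"
    by (simp add: mp_scale_def mp_const_def mult_single flip: mpoly_sum_monomials)
  also have "\<dots> \<in> mp.span ((\<lambda>m. single m 1) ` monoms V E)"
    by (intro mp.span_sum mp.span_scale mp.span_base) (use assms in auto)
  finally show ?thesis .
qed

text \<open>Counting: the monomials of degree at most \<open>E\<close> in each of the \<open>card I\<close> polynomials outnumber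
  the monomials that occur in them once \<open>E\<close> is large.\<close>

lemma algebraic_dependence:
  fixes f :: "'i \<Rightarrow> 'v mpoly"
  assumes fin: "finite I" "finite V" and card: "card V < card I"
    and sup: "\<And>i. i \<in> I \<Longrightarrow> mp_supported V (f i)"
  shows "\<exists>q. q \<noteq> 0 \<and> mp_supported I q \<and> (\<forall>x. mp_eval (\<lambda>i. mp_eval x (f i)) q = 0)"
proof -
  have "\<forall>i\<in>I. \<exists>D. keys (f i) \<subseteq> monoms V D"
    using ex_monoms_bound sup by blast
  then obtain D' where D': "\<And>i. i \<in> I \<Longrightarrow> keys (f i) \<subseteq> monoms V (D' i)"
    by metis
  define D where "D = (\<Sum>i\<in>I. D' i)"
  have D: "keys (f i) \<subseteq> monoms V D" if "i \<in> I" for i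
    using D'[OF that] monoms_mono[of "D' i" D V] member_le_sum[of i I D'] that fin
    by (auto simp: D_def)
  \<comment> \<open>Chosen so that the \<open>card V\<close>-th power of
    \<open>card I * D + 1\<close> is \<open>E\<close> itself, hence smaller than the one additional
    factor \<open>E + 1\<close> that \<open>card I > card V\<close> provides.\<close>
  define E where "E = (card I * D + 1) ^ card V"
  define E' where "E' = card I * (E * D)"
  define g where "g e = (\<Prod>i\<in>I. f i ^ lookup e i)" for e
  have eval_g: "mp_eval x (g e) = mon_eval (\<lambda>i. mp_eval x (f i)) e" if "e \<in> monoms I E" for x e
    using that fin by (simp add: g_def mon_eval_superset[of I] monoms_def)
  have g_span: "g e \<in> mp.span ((\<lambda>m. single m 1) ` monoms V E')" if e: "e \<in> monoms I E" for e
  proof -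
    have "keys (g e) \<subseteq> monoms V (\<Sum>i\<in>I. lookup e i * D)"
      unfolding g_def by (intro keys_prod_monoms keys_power_monoms D)
    also have "(\<Sum>i\<in>I. lookup e i * D) \<le> (\<Sum>i\<in>I. E * D)"
      by (intro sum_mono mult_right_mono) (use e in \<open>auto simp: monoms_def\<close>)
    then have "monoms V (\<Sum>i\<in>I. lookup e i * D) \<subseteq> monoms V E'"
      by (intro monoms_mono) (simp add: E'_def)
    finally show ?thesis by (rule monoms_span)
  qed
  show ?thesis
  proof (cases "inj_on g (monoms I E)")
    \<comment> \<open>Two exponents with the same product already give a relation with two
      terms.\<close>
    case False
    then obtain a b where ab: "a \<in> monoms I E" "b \<in> monoms I E" "a \<noteq> b" "g a = g b"
      by (auto simp: inj_on_def)
    define q :: "'i mpoly" where "q = single a 1 - single b 1"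
    have "lookup q a = 1"
      using ab by (simp add: q_def lookup_minus lookup_single)
    then have "q \<noteq> 0" by auto
    moreover have "mp_supported I q"
      using ab unfolding q_def by (intro mp_supported_diff mp_supported_single) (auto simp: monoms_def)
    moreover have "mp_eval (\<lambda>i. mp_eval x (f i)) q = 0" for x
      unfolding q_def mp_eval_diff mp_eval_single eval_g[OF ab(1), symmetric]
        eval_g[OF ab(2), symmetric] ab(4) by simp
    ultimately show ?thesis by (intro exI[of _ q] conjI allI)
  next
    case True
    let ?T = "(\<lambda>m. single m 1 :: 'v mpoly) ` monoms V E'"
    \<comment> \<open>The distinct products outnumber the monomials spanning the space that contains
      them, so they are linearly dependent; the coefficients of that dependence are those of
      \<open>q\<close>.\<close>
    have "card ?T \<le> card (monoms V E')"
      by (intro card_image_le finite_monoms fin)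
    also have "\<dots> = (E' + 1) ^ card V"
      using fin by (simp add: card_monoms)
    also have "\<dots> \<le> ((card I * D + 1) * (E + 1)) ^ card V"
      by (intro power_mono) (simp_all add: E'_def algebra_simps)
    also have "\<dots> = E * (E + 1) ^ card V"
      by (simp only: E_def power_mult_distrib)
    also have "\<dots> < (E + 1) ^ Suc (card V)"
      by simp
    also have "\<dots> \<le> (E + 1) ^ card I"
      using card by (intro power_increasing) auto
    also have "\<dots> = card (g ` monoms I E)"
      using True fin by (simp add: card_image card_monoms)
    finally have "card ?T < card (g ` monoms I E)" .
    moreover have "finite ?T" "g ` monoms I E \<subseteq> mp.span ?T"
      using g_span finite_monoms[OF fin(2)] by auto
    ultimately have "mp.dependent (g ` monoms I E)"
      using mp.independent_span_bound[of ?T "g ` monoms I E"] by linarith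
    moreover have "finite (g ` monoms I E)"
      by (simp add: finite_monoms fin(1))
    ultimately have "\<exists>u. (\<exists>v\<in>g ` monoms I E. u v \<noteq> 0) \<and>
        (\<Sum>v\<in>g ` monoms I E. mp_scale (u v) v) = 0"
      by (simp only: mp.dependent_finite)
    then obtain u v where v: "v \<in> g ` monoms I E" "u v \<noteq> 0"
      and u: "(\<Sum>v\<in>g ` monoms I E. mp_scale (u v) v) = 0"
      by (elim exE bexE conjE)
    define q where "q = (\<Sum>e\<in>monoms I E. single e (u (g e)))"
    have "lookup q e = u (g e)" if "e \<in> monoms I E" for e
      using that finite_monoms[OF fin(1)] by (simp add: q_def lookup_sum lookup_single when_def)
    with v have "q \<noteq> 0"
      by (metis imageE lookup_zero)
    moreover have "mp_supported I q"
      unfolding q_def mp_supported_def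
    proof
      fix m assume "m \<in> keys (\<Sum>e\<in>monoms I E. single e (u (g e)))"
      then obtain e where "e \<in> monoms I E" "m \<in> keys (single e (u (g e)))"
        using keys_sum[of "\<lambda>e. single e (u (g e))" "monoms I E"] by blast
      then show "keys m \<subseteq> I"
        by (auto simp: monoms_def split: if_splits)
    qed
    moreover have "mp_eval (\<lambda>i. mp_eval x (f i)) q = 0" for x
    proof -
      have "mp_eval (\<lambda>i. mp_eval x (f i)) q = (\<Sum>e\<in>monoms I E. u (g e) * mp_eval x (g e))"
        by (simp add: q_def eval_g)
      also have "\<dots> = mp_eval x (\<Sum>v\<in>g ` monoms I E. mp_scale (u v) v)"
        using True by (simp add: sum.reindex)
      finally show ?thesis by (simp add: u)
    qed
    ultimately show ?thesis by (intro exI[of _ q] conjI allI)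
  qed
qed

text \<open>Functions in place of polynomials: the closure lemmas then certify which variables a
  parametrisation uses without its polynomials being written out.\<close>

definition polyfun :: "'v set \<Rightarrow> (('v \<Rightarrow> complex) \<Rightarrow> complex) \<Rightarrow> bool" where
  "polyfun V g \<longleftrightarrow> (\<exists>p. mp_supported V p \<and> g = (\<lambda>x. mp_eval x p))"

lemma polyfun_const: "polyfun V (\<lambda>_. c)"
  unfolding polyfun_def by (rule exI[of _ "mp_const c"]) simp

lemma polyfun_var: "i \<in> V \<Longrightarrow> polyfun V (\<lambda>x. x i)"
  unfolding polyfun_def by (rule exI[of _ "mp_var i"]) (simp add: mp_supported_var)

lemma polyfun_add: "polyfun V f \<Longrightarrow> polyfun V g \<Longrightarrow> polyfun V (\<lambda>x. f x + g x)"
proof -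
  assume "polyfun V f" "polyfun V g"
  then obtain p q where "mp_supported V p" "f = (\<lambda>x. mp_eval x p)" "mp_supported V q" "g = (\<lambda>x. mp_eval x q)"
    unfolding polyfun_def by (elim exE conjE)
  then show ?thesis
    unfolding polyfun_def by (intro exI[of _ "p + q"]) (simp add: mp_supported_add)
qed

lemma polyfun_mult: "polyfun V f \<Longrightarrow> polyfun V g \<Longrightarrow> polyfun V (\<lambda>x. f x * g x)"
proof -
  assume "polyfun V f" "polyfun V g"
  then obtain p q where "mp_supported V p" "f = (\<lambda>x. mp_eval x p)" "mp_supported V q" "g = (\<lambda>x. mp_eval x q)"
    unfolding polyfun_def by (elim exE conjE)
  then show ?thesis
    unfolding polyfun_def by (intro exI[of _ "p * q"]) (simp add: mp_supported_mult)
qed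

lemma polyfun_diff: "polyfun V f \<Longrightarrow> polyfun V g \<Longrightarrow> polyfun V (\<lambda>x. f x - g x)"
proof -
  assume "polyfun V f" "polyfun V g"
  then obtain p q where "mp_supported V p" "f = (\<lambda>x. mp_eval x p)" "mp_supported V q" "g = (\<lambda>x. mp_eval x q)"
    unfolding polyfun_def by (elim exE conjE)
  then show ?thesis
    unfolding polyfun_def by (intro exI[of _ "p - q"]) (simp add: mp_supported_diff)
qed

lemma polyfun_power: "polyfun V f \<Longrightarrow> polyfun V (\<lambda>x. f x ^ e)"
  by (induction e) (auto intro: polyfun_mult polyfun_const)

lemma polyfun_sum: "(\<And>i. i \<in> A \<Longrightarrow> polyfun V (f i)) \<Longrightarrow> polyfun V (\<lambda>x. \<Sum>i\<in>A. f i x)"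
  by (induction A rule: infinite_finite_induct) (auto intro: polyfun_add polyfun_const)

lemma polyfun_prod: "(\<And>i. i \<in> A \<Longrightarrow> polyfun V (f i)) \<Longrightarrow> polyfun V (\<lambda>x. \<Prod>i\<in>A. f i x)"
  by (induction A rule: infinite_finite_induct) (auto intro: polyfun_mult polyfun_const)

lemma polyfun_eval:
  assumes "mp_supported W p" "\<And>i. i \<in> W \<Longrightarrow> polyfun V (f i)"
  shows "polyfun V (\<lambda>x. mp_eval (\<lambda>i. f i x) p)"
  unfolding mp_eval_def
  by (intro polyfun_sum polyfun_prod polyfun_mult polyfun_const polyfun_power)
    (use assms in \<open>auto simp: mp_supported_def\<close>)

lemma polyfun_rename:
  assumes "polyfun V f" "\<And>i. i \<in> V \<Longrightarrow> h i \<in> W"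
  shows "polyfun W (\<lambda>x. f (\<lambda>i. x (h i)))"
proof -
  obtain p where p: "mp_supported V p" "f = (\<lambda>x. mp_eval x p)"
    using assms(1) unfolding polyfun_def by (elim exE conjE)
  then show ?thesis
    using polyfun_eval[of V p W "\<lambda>i x. x (h i)"] assms(2) by (simp add: polyfun_var)
qed

lemma polyfun_coeff_prod:
  assumes "\<And>j i. j \<in> A \<Longrightarrow> polyfun V (\<lambda>x. coeff (p j x) i)"
  shows "polyfun V (\<lambda>x. coeff (\<Prod>j\<in>A. p j x) i)"
  using assms
proof (induction A arbitrary: i rule: infinite_finite_induct)
  case (insert a A)
  then show ?case by (auto simp: coeff_mult intro!: polyfun_sum polyfun_mult)
qed (auto intro: polyfun_const)

section \<open>Polynomials with few roots form a proper closed subset\<close>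

lemma mp_supported_prod:
  "(\<And>i. i \<in> A \<Longrightarrow> mp_supported V (p i)) \<Longrightarrow> mp_supported V (\<Prod>i\<in>A. p i)"
proof (induction A rule: infinite_finite_induct)
  case (insert x F)
  then show ?case by (simp add: mp_supported_mult)
qed (simp_all add: mp_supported_def)

section \<open>Monic polynomials and the distribution of their roots\<close>

definition monic_poly :: "nat \<Rightarrow> (nat \<Rightarrow> complex) \<Rightarrow> complex poly" where
  "monic_poly d c = monom 1 d + (\<Sum>i=1..d. monom (c i) (d - i))"

lemma poly_monic_poly: "poly (monic_poly d c) u = u ^ d + (\<Sum>i=1..d. c i * u ^ (d - i))"
  by (simp add: monic_poly_def poly_monom poly_sum)

lemma coeff_monic_poly_low:
  assumes "i \<in> {1..d}"
  shows "coeff (monic_poly d c) (d - i) = c i"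
proof -
  have "coeff (monic_poly d c) (d - i) = (\<Sum>j=1..d. if j = i then c j else 0)"
    unfolding monic_poly_def coeff_add coeff_sum coeff_monom
    by (subst sum.cong[OF refl, of "{1..d}" _ "\<lambda>j. if j = i then c j else 0"]) (use assms in auto)
  then show ?thesis
    using assms by simp
qed

lemma coeff_monic_poly_high:
  assumes "j \<ge> d"
  shows "coeff (monic_poly d c) j = (if j = d then 1 else 0)"
  unfolding monic_poly_def coeff_add coeff_sum coeff_monom
  using assms by (auto intro!: sum.neutral)

lemma
  shows degree_monic_poly: "degree (monic_poly d c) = d"
    and lead_coeff_monic_poly: "lead_coeff (monic_poly d c) = 1"
proof -
  show "degree (monic_poly d c) = d"
  proof (rule antisym)
    show "degree (monic_poly d c) \<le> d"
      by (rule degree_le) (simp add: coeff_monic_poly_high)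
    show "d \<le> degree (monic_poly d c)"
      by (rule le_degree) (simp add: coeff_monic_poly_high)
  qed
  then show "lead_coeff (monic_poly d c) = 1"
    by (simp add: coeff_monic_poly_high)
qed

text \<open>The distinct roots are numbered below \<open>q\<close> by \<open>b\<close>, and
  \<open>\<pi>\<close> sends each linear factor to the number of its root. There are only finitely
  many \<open>\<pi>\<close>, and for each of them the coefficients of the product depend
  polynomially on \<open>b\<close>.\<close>

lemma monic_factorization_few_roots:
  fixes p :: "complex poly"
  assumes monic: "lead_coeff p = 1" and deg: "degree p = d" "d > 0"
    and few: "card {u. poly p u = 0} \<le> q"
  obtains b :: "nat \<Rightarrow> complex" and \<pi> where "\<pi> \<in> {..<d} \<rightarrow>\<^sub>E {..<q}" "p = (\<Prod>j<d. [:- b (\<pi> j), 1:])"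
proof -
  have "p \<noteq> 0"
    using monic by auto
  obtain A where A: "size A = degree p" "p = smult (lead_coeff p) (\<Prod>x\<in>#A. [:- x, 1:])"
    using alg_closed_imp_factorization[OF \<open>p \<noteq> 0\<close>] by blast
  obtain xs where xs: "mset xs = A"
    using ex_mset by blast
  have len: "length xs = d"
    using A(1) xs deg by (metis size_mset)
  have p: "p = (\<Prod>j<d. [:- (xs ! j), 1:])"
  proof -
    have "p = prod_list (map (\<lambda>x. [:- x, 1:]) xs)"
      using A(2) monic by (simp add: xs[symmetric] flip: prod_mset_prod_list)
    also have "\<dots> = (\<Prod>j<d. [:- (xs ! j), 1:])"
      by (simp add: prod.list_conv_set_nth len atLeast0LessThan)
    finally show ?thesis .
  qed
  let ?R = "{u. poly p u = 0}"
  have fin: "finite ?R"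
    using \<open>p \<noteq> 0\<close> by (rule poly_roots_finite)
  have root: "xs ! j \<in> ?R" if "j < d" for j
    using that by (subst p) (auto simp: poly_prod)
  obtain b where b: "bij_betw b {..<card ?R} ?R"
    using ex_bij_betw_nat_finite[OF fin] by (auto simp: atLeast0LessThan)
  define \<pi> where "\<pi> = restrict (\<lambda>j. inv_into {..<card ?R} b (xs ! j)) {..<d}"
  have "\<pi> j < card ?R \<and> b (\<pi> j) = xs ! j" if "j < d" for j
  proof -
    have "xs ! j \<in> b ` {..<card ?R}"
      using root[OF that] b by (simp add: bij_betw_def)
    then show ?thesis
      using that inv_into_into[of "xs ! j" b "{..<card ?R}"] by (simp add: \<pi>_def f_inv_into_f)
  qed
  note \<pi> = this
  have "\<pi> \<in> {..<d} \<rightarrow>\<^sub>E {..<q}"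
    using \<pi> few by (auto simp: \<pi>_def intro: less_le_trans)
  moreover have "p = (\<Prod>j<d. [:- b (\<pi> j), 1:])"
    using p \<pi> by simp
  ultimately show thesis by (rule that)
qed

section \<open>Coordinates of the parameter space and generic properties\<close>

definition param_index :: "nat \<Rightarrow> nat \<Rightarrow> (nat \<times> (nat \<Rightarrow>\<^sub>0 nat)) set" where
  "param_index N d = (SIGMA i:{1..d}. {m. keys m \<subseteq> {1..N} \<and>
     (\<Sum>l\<in>keys m. lookup m l) = i})"

lemma finite_param_index: "finite (param_index N d)"
proof -
  have "lookup m l \<le> (\<Sum>l\<in>keys m. lookup m l)"
    for m :: "nat \<Rightarrow>\<^sub>0 nat" and l
    by (cases "l \<in> keys m") (auto intro: member_le_sum simp: in_keys_iff)
  then have "param_index N d \<subseteq> (SIGMA i:{1..d}. monoms {1..N} i)"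
    unfolding param_index_def monoms_def by auto
  then show ?thesis
    by (rule finite_subset) (auto intro: finite_monoms)
qed

lemma deform_params_keys:
  assumes "F \<in> deform_params N d"
  shows "m \<in> keys (F i) \<Longrightarrow> (i, m) \<in> param_index N d"
  using assms by (cases "i \<in> {1..d}") (auto simp: deform_params_def homog_def param_index_def)

lemma mp_eval_deform_params:
  assumes "F \<in> deform_params N d" "i \<in> {1..d}"
  shows "mp_eval x (F i) =
    (\<Sum>m | (i, m) \<in> param_index N d. lookup (F i) m * mon_eval x m)"
proof (rule mp_eval_superset)
  have "{m. (i, m) \<in> param_index N d} \<subseteq> snd ` param_index N d"
    by force
  then show "finite {m. (i, m) \<in> param_index N d}"
    using finite_param_index finite_surj by blast
qed (use deform_params_keys[OF assms(1)] in auto)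

text \<open>The values of the variables at a point where \<open>Q\<close> does not vanish are taken
  as the coefficients of the tuple. This makes the open set defined by \<open>Q\<close>
  non-empty.\<close>

lemma ex_deform_params:
  assumes "Q \<noteq> 0" "mp_supported (param_index N d) Q"
  shows "\<exists>F\<in>deform_params N d. mp_eval (param_coords F) Q \<noteq> 0"
proof -
  obtain x where x: "mp_eval x Q \<noteq> 0"
    using mp_nonvanishing[OF assms(1)] by blast
  define F where "F i = (\<Sum>m | (i, m) \<in> param_index N d. single m (x (i, m)))" for i
  have fin: "finite {m. (i, m) \<in> param_index N d}" for i
    by (rule finite_surj[OF finite_param_index[of N d], of _ snd]) force
  have lookup_F: "lookup (F i) m = (if (i, m) \<in> param_index N d then x (i, m) else 0)" for i m
    using fin[of i] by (simp add: F_def lookup_sum lookup_single when_def)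
  have "F \<in> deform_params N d"
    unfolding deform_params_def
  proof (intro CollectI conjI ballI allI impI)
    fix i assume "i \<in> {1..d}"
    then show "F i \<in> homog {1..N} i"
    proof -
      have "(i, m) \<in> param_index N d" if "m \<in> keys (F i)" for m
        using that by (simp add: in_keys_iff lookup_F split: if_splits)
      then show ?thesis
        unfolding homog_def param_index_def by blast
    qed
  next
    fix i assume "i \<notin> {1..d}"
    then show "F i = 0"
      by (intro poly_mapping_eqI) (auto simp: lookup_F param_index_def)
  qed
  moreover have "mp_eval (param_coords F) Q = mp_eval x Q"
    by (rule mp_eval_cong[OF assms(2)]) (auto simp: param_coords_def lookup_F)
  ultimately show ?thesis
    using x by (intro bexI[of _ F]) simp_all
qed

text \<open>A principal open set defined by one nonzero polynomial. It is automatically non-empty by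
  \<open>ex_deform_params\<close>, and finite intersections correspond to products.\<close>

definition generically :: "nat \<Rightarrow> nat \<Rightarrow> ((nat \<Rightarrow> nat mpoly) \<Rightarrow> bool) \<Rightarrow> bool" where
  "generically N d P \<longleftrightarrow> (\<exists>Q. Q \<noteq> 0 \<and> mp_supported (param_index N d) Q \<and>
     (\<forall>F\<in>deform_params N d. mp_eval (param_coords F) Q \<noteq> 0 \<longrightarrow> P F))"

lemma generically_mono:
  assumes "generically N d P" "\<And>F. F \<in> deform_params N d \<Longrightarrow> P F \<Longrightarrow> P' F"
  shows "generically N d P'"
  using assms(1) unfolding generically_def by (elim ex_forward) (use assms(2) in blast)

text \<open>Irreducibility of the parameter space: the product of the finitely many nonzero
  polynomials is nonzero.\<close>

lemma generically_ball:
  assumes "finite A" "\<And>i. i \<in> A \<Longrightarrow> generically N d (P i)"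
  shows "generically N d (\<lambda>F. \<forall>i\<in>A. P i F)"
proof -
  have "\<forall>i\<in>A. \<exists>Q. Q \<noteq> 0 \<and> mp_supported (param_index N d) Q \<and>
     (\<forall>F\<in>deform_params N d. mp_eval (param_coords F) Q \<noteq> 0 \<longrightarrow> P i F)"
    using assms(2) by (simp add: generically_def)
  from bchoice[OF this] obtain Q where Q: "\<forall>i\<in>A. Q i \<noteq> 0 \<and> mp_supported (param_index N d) (Q i) \<and>
     (\<forall>F\<in>deform_params N d. mp_eval (param_coords F) (Q i) \<noteq> 0 \<longrightarrow> P i F)"
    by (elim exE)
  show ?thesis
    unfolding generically_def
  proof (intro exI[of _ "\<Prod>i\<in>A. Q i"] conjI ballI impI)
    show "(\<Prod>i\<in>A. Q i) \<noteq> 0"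
      by (rule mp_prod_nonzero) (use Q in blast)
    show "mp_supported (param_index N d) (\<Prod>i\<in>A. Q i)"
      by (rule mp_supported_prod) (use Q in blast)
    fix F i
    assume "F \<in> deform_params N d" "mp_eval (param_coords F) (\<Prod>i\<in>A. Q i) \<noteq> 0" "i \<in> A"
    then show "P i F"
      using Q \<open>finite A\<close> by (auto simp: prod_zero_iff)
  qed
qed

text \<open>For a fixed distribution \<open>\<pi>\<close> of the \<open>d\<close> roots onto \<open>q\<close> values \<open>b\<close>, the condition at a point \<open>y\<close>
  determines each \<open>F i\<close> up to a form in a hyperplane complementary to \<open>L\<^sup>i\<close>, where \<open>L\<close> is a linear
  form with value 1 at all the points \<open>\<sigma> y\<close>. So the bad tuples are parametrised by
  \<open>card A + q - d\<close> variables more than there are coefficients.\<close>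

lemma few_roots_pattern:
  fixes \<sigma> :: "nat \<Rightarrow> ('a \<Rightarrow> complex) \<Rightarrow> complex"
  assumes fin: "finite A" and card: "card A + q < d"
    and \<sigma>: "\<And>l. l \<in> {1..N} \<Longrightarrow> polyfun A (\<sigma> l)"
    and \<alpha>: "\<And>y. (\<Sum>l=1..N. \<alpha> l * \<sigma> l y) = 1"
    and \<pi>: "\<pi> \<in> {..<d} \<rightarrow>\<^sub>E {..<q}"
  shows "generically N d (\<lambda>F. \<forall>y b.
    monic_poly d (\<lambda>i. mp_eval (\<lambda>l. \<sigma> l y) (F i)) \<noteq> (\<Prod>j<d. [:- b (\<pi> j), 1:]))"
proof -
  let ?I = "param_index N d"
  define L :: "nat mpoly" where "L = (\<Sum>l=1..N. mp_const (\<alpha> l) * mp_var l)"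
  define T where "T i = L ^ i" for i
  have "L \<in> homog {1..N} 1"
    unfolding L_def
  proof (rule homog_sum)
    fix l assume "l \<in> {1..N}"
    from homog_mult[OF homog_const[of "\<alpha> l"] homog_var[OF this]]
    show "mp_const (\<alpha> l) * mp_var l \<in> homog {1..N} 1"
      by simp
  qed
  then have T_homog: "T i \<in> homog {1..N} i" for i
    using homog_power[of L "{1..N}" 1 i] by (simp add: T_def)
  have T_eval: "mp_eval (\<lambda>l. \<sigma> l y) (T i) = 1" for i y
    using \<alpha>[of y] by (simp add: T_def L_def)
  have "T i \<noteq> 0" for i
    using T_eval[of undefined i] by auto
  then have "\<forall>i. \<exists>m. m \<in> keys (T i)"
    using keys_eq_empty by blast
  \<comment> \<open>The monomial \<open>\<mu> i\<close> occurs in \<open>T i\<close>, so forms of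
    degree \<open>i\<close> without it are a complement of the multiples of \<open>T i\<close>.
    Dropping these \<open>d\<close> coordinates leaves \<open>J\<close>.\<close>
  from choice[OF this] obtain \<mu> where \<mu>': "\<forall>i. \<mu> i \<in> keys (T i)"
    by (elim exE)
  note \<mu> = \<mu>'[rule_format]
  have \<mu>_index: "(i, \<mu> i) \<in> ?I" if "i \<in> {1..d}" for i
    using \<mu>[of i] T_homog[of i] that by (auto simp: homog_def param_index_def)
  define J where "J = ?I - (\<lambda>i. (i, \<mu> i)) ` {1..d}"
  define V :: "('a + nat + nat \<times> (nat \<Rightarrow>\<^sub>0 nat)) set"
    where "V = Inl ` A \<union> (Inr \<circ> Inl) ` {..<q} \<union> (Inr \<circ> Inr) ` J"
  have fin_J: "finite J"
    using finite_param_index by (simp add: J_def)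
  have card_\<mu>: "card ((\<lambda>i. (i, \<mu> i)) ` {1..d}) = d"
    by (subst card_image) (auto simp: inj_on_def)
  have "card J = card ?I - card ((\<lambda>i. (i, \<mu> i)) ` {1..d})"
    unfolding J_def by (intro card_Diff_subset) (use \<mu>_index in auto)
  also note card_\<mu>
  finally have "card J = card ?I - d" .
  moreover have "(\<lambda>i. (i, \<mu> i)) ` {1..d} \<subseteq> ?I"
    using \<mu>_index by blast
  then have "d \<le> card ?I"
    using card_mono[OF finite_param_index[of N d]] card_\<mu> by metis
  moreover have "card V \<le> card A + q + card J"
    unfolding V_def
    by (intro order.trans[OF card_Un_le] add_mono order.trans[OF card_image_le]) (use fin fin_J in auto)
  ultimately have card_V: "card V < card ?I"
    using card by linarith
  have fin_V: "finite V"
    using fin fin_J by (simp add: V_def)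
  define e :: "nat \<Rightarrow> ('a + nat + nat \<times> (nat \<Rightarrow>\<^sub>0 nat) \<Rightarrow> complex) \<Rightarrow> complex"
    where "e i x = coeff (\<Prod>j<d. [:- x (Inr (Inl (\<pi> j))), 1:]) (d - i)" for i x
  define G :: "nat \<Rightarrow> (nat \<Rightarrow>\<^sub>0 nat) \<Rightarrow> ('a + nat + nat \<times> (nat \<Rightarrow>\<^sub>0 nat) \<Rightarrow> complex) \<Rightarrow> complex"
    where "G i m x = (if (i, m) \<in> J then x (Inr (Inr (i, m))) else 0)" for i m x
  define g where "g i x = (\<Sum>m | (i, m) \<in> ?I. G i m x * mon_eval (\<lambda>l. \<sigma> l (\<lambda>a. x (Inl a))) m)" for i x
  \<comment> \<open>The coefficients of \<open>G i + (e i - g i) T i\<close>, where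
    \<open>e i\<close> is the value prescribed by the factorisation and \<open>g i\<close> is the
    value of \<open>G i\<close> at the point. As \<open>T i\<close> has value 1 there, this form
    takes exactly the value \<open>e i\<close>.\<close>
  define f where "f \<iota> x = (case \<iota> of (i, m) \<Rightarrow> G i m x + (e i x - g i x) * lookup (T i) m)" for \<iota> x
  have "polyfun V (f \<iota>)" if \<iota>: "\<iota> \<in> ?I" for \<iota>
  proof -
    obtain i m where im: "\<iota> = (i, m)" by (cases \<iota>)
    have "polyfun V (\<lambda>x. coeff [:- x (Inr (Inl (\<pi> j))), 1:] c)" if "j < d" for j c
    proof -
      have "\<pi> j < q" using \<pi> that by auto
      then have "polyfun V (\<lambda>x. 0 - x (Inr (Inl (\<pi> j))))"
        by (intro polyfun_diff polyfun_const polyfun_var) (auto simp: V_def)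
      then show ?thesis
        by (cases c; cases "c - 1") (auto simp: coeff_pCons intro: polyfun_const)
    qed
    then have "polyfun V (e i)"
      unfolding e_def by (intro polyfun_coeff_prod) auto
    moreover have G: "polyfun V (G i' m')" for i' m'
      unfolding G_def by (cases "(i', m') \<in> J") (auto simp: V_def intro!: polyfun_var polyfun_const)
    moreover have "polyfun V (\<lambda>x. mon_eval (\<lambda>l. \<sigma> l (\<lambda>a. x (Inl a))) m')" if "(i, m') \<in> ?I" for m'
      unfolding mon_eval_def
      by (intro polyfun_prod polyfun_power polyfun_rename[where h = Inl and V = A] \<sigma>)
        (use that in \<open>auto simp: V_def param_index_def\<close>)
    then have "polyfun V (g i)"
      unfolding g_def by (intro polyfun_sum polyfun_mult G) auto
    ultimately show ?thesis
      unfolding f_def im prod.case by (intro polyfun_add polyfun_mult polyfun_diff polyfun_const)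
  qed
  then have "\<forall>\<iota>\<in>?I. \<exists>p. mp_supported V p \<and> f \<iota> = (\<lambda>x. mp_eval x p)"
    by (simp add: polyfun_def)
  from bchoice[OF this] obtain p
    where p': "\<forall>\<iota>\<in>?I. mp_supported V (p \<iota>) \<and> f \<iota> = (\<lambda>x. mp_eval x (p \<iota>))"
    by (elim exE)
  have p: "mp_supported V (p \<iota>)" "f \<iota> x = mp_eval x (p \<iota>)" if "\<iota> \<in> ?I" for \<iota> x
    using bspec[OF p' that] by auto
  have "\<exists>Q. Q \<noteq> 0 \<and> mp_supported ?I Q \<and> (\<forall>x. mp_eval (\<lambda>\<iota>. mp_eval x (p \<iota>)) Q = 0)"
    by (rule algebraic_dependence[OF finite_param_index fin_V card_V]) (rule p(1))
  then obtain Q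
    where Q: "Q \<noteq> 0" "mp_supported ?I Q" "\<forall>x. mp_eval (\<lambda>\<iota>. mp_eval x (p \<iota>)) Q = 0"
    by (elim exE conjE)
  have "mp_eval (param_coords F) Q = 0"
    if F: "F \<in> deform_params N d"
      and eq: "monic_poly d (\<lambda>i. mp_eval (\<lambda>l. \<sigma> l y) (F i)) = (\<Prod>j<d. [:- b (\<pi> j), 1:])" for F y b
  proof -
    \<comment> \<open>Removes the monomial \<open>\<mu> i\<close> from \<open>F i - c i T i\<close>,
      so that this difference is described by coordinates in \<open>J\<close>. The parameter point
      \<open>x\<close> then reproduces \<open>F\<close>, because
      \<open>e i x - g i x = c i\<close>.\<close>
    define c where "c i = lookup (F i) (\<mu> i) / lookup (T i) (\<mu> i)" for i
    define x where "x v = (case v of Inl a \<Rightarrow> y a | Inr (Inl j) \<Rightarrow> b j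
      | Inr (Inr (i, m)) \<Rightarrow> lookup (F i) m - c i * lookup (T i) m)" for v
    have x_simps: "x (Inl a) = y a" "x (Inr (Inl j)) = b j"
      "x (Inr (Inr (i, m))) = lookup (F i) m - c i * lookup (T i) m" for a j i m
      by (simp_all add: x_def)
    have Gx: "G i m x = lookup (F i) m - c i * lookup (T i) m"
      if "(i, m) \<in> ?I" for i m
    proof (cases "(i, m) \<in> J")
      case True
      then show ?thesis by (simp add: G_def x_simps)
    next
      case False
      then have "m = \<mu> i"
        using that by (auto simp: J_def)
      then show ?thesis
        using False \<mu>[of i] by (simp add: G_def c_def in_keys_iff)
    qed
    have "f \<iota> x = param_coords F \<iota>" if \<iota>: "\<iota> \<in> ?I" for \<iota>
    proof -
      obtain i m where im: "\<iota> = (i, m)" by (cases \<iota>)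
      have i: "i \<in> {1..d}"
        using \<iota> by (simp add: im param_index_def)
      let ?E = "\<lambda>m. mon_eval (\<lambda>l. \<sigma> l y) m"
      have eT: "mp_eval (\<lambda>l. \<sigma> l y) (T i) = (\<Sum>m | (i, m) \<in> ?I. lookup (T i) m * ?E m)"
      proof (rule mp_eval_superset)
        show "finite {m. (i, m) \<in> ?I}"
          by (rule finite_surj[OF finite_param_index[of N d], of _ snd]) force
        show "keys (T i) \<subseteq> {m. (i, m) \<in> ?I}"
          using T_homog[of i] i by (auto simp: homog_def param_index_def)
      qed
      have "g i x = (\<Sum>m | (i, m) \<in> ?I. (lookup (F i) m - c i * lookup (T i) m) * ?E m)"
        unfolding g_def x_simps by (rule sum.cong) (simp_all add: Gx)
      also have "\<dots> = mp_eval (\<lambda>l. \<sigma> l y) (F i) - c i * mp_eval (\<lambda>l. \<sigma> l y) (T i)"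
        unfolding mp_eval_deform_params[OF F i] eT
        by (simp add: sum_distrib_left sum_subtractf algebra_simps)
      finally have "g i x = mp_eval (\<lambda>l. \<sigma> l y) (F i) - c i"
        by (simp add: T_eval)
      moreover have "e i x = mp_eval (\<lambda>l. \<sigma> l y) (F i)"
        unfolding e_def x_simps eq[symmetric] by (rule coeff_monic_poly_low[OF i])
      ultimately show ?thesis
        using Gx[of i m] \<iota> by (simp add: f_def im param_coords_def)
    qed
    then have "mp_eval (param_coords F) Q = mp_eval (\<lambda>\<iota>. mp_eval x (p \<iota>)) Q"
      by (intro mp_eval_cong[OF Q(2)]) (simp add: p(2))
    then show ?thesis
      by (simp add: Q(3))
  qed
  then show ?thesis
    unfolding generically_def using Q(1,2) by (intro exI[of _ Q] conjI ballI allI impI notI) simp_all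
qed

text \<open>A monic polynomial with at most \<open>q\<close> roots follows one of finitely many
  patterns \<open>\<pi>\<close>, and each of these is avoided generically.\<close>

lemma few_roots:
  fixes \<sigma> :: "nat \<Rightarrow> ('a \<Rightarrow> complex) \<Rightarrow> complex"
  assumes "finite A" "card A + q < d" "\<And>l. l \<in> {1..N} \<Longrightarrow> polyfun A (\<sigma> l)"
    and "\<And>y. (\<Sum>l=1..N. \<alpha> l * \<sigma> l y) = 1"
  shows "generically N d (\<lambda>F. \<forall>y.
    q < card {u. poly (monic_poly d (\<lambda>i. mp_eval (\<lambda>l. \<sigma> l y) (F i))) u = 0})"
proof (rule generically_mono, rule generically_ball)
  show "finite ({..<d} \<rightarrow>\<^sub>E {..<q})"
    by (simp add: finite_PiE)
  fix F assume F: "\<forall>\<pi>\<in>{..<d} \<rightarrow>\<^sub>E {..<q}. \<forall>y b.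
    monic_poly d (\<lambda>i. mp_eval (\<lambda>l. \<sigma> l y) (F i)) \<noteq> (\<Prod>j<d. [:- b (\<pi> j), 1:])"
  show "\<forall>y. q < card {u. poly (monic_poly d (\<lambda>i. mp_eval (\<lambda>l. \<sigma> l y) (F i))) u = 0}"
  proof (rule allI, rule ccontr)
    fix y assume "\<not> q < card {u. poly (monic_poly d (\<lambda>i. mp_eval (\<lambda>l. \<sigma> l y) (F i))) u = 0}"
    then have few: "card {u. poly (monic_poly d (\<lambda>i. mp_eval (\<lambda>l. \<sigma> l y) (F i))) u = 0} \<le> q"
      by simp
    obtain b \<pi> where "\<pi> \<in> {..<d} \<rightarrow>\<^sub>E {..<q}"
      "monic_poly d (\<lambda>i. mp_eval (\<lambda>l. \<sigma> l y) (F i)) = (\<Prod>j<d. [:- b (\<pi> j), 1:])"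
      by (rule monic_factorization_few_roots[OF _ _ _ few])
        (use assms(2) in \<open>auto simp: degree_monic_poly coeff_monic_poly_high\<close>)
    then show False
      using F by blast
  qed
qed (rule few_roots_pattern[OF assms])

section \<open>Brody reparametrisation without derivatives\<close>

text \<open>\<open>Y\<close> is a choice of homogeneous coordinates, at each point separately, along a curve in projective
  \<open>n\<close>-space that is holomorphic after rescaling by a suitable local factor \<open>g\<close>; \<open>L\<close> is a section of the
  pullback of \<open>O(k)\<close> in the same trivialisation.\<close>

definition wcurve :: "nat \<Rightarrow> nat \<Rightarrow> (complex \<Rightarrow> nat \<Rightarrow> complex) \<Rightarrow> (complex \<Rightarrow> complex) \<Rightarrow> bool" where
  "wcurve n k Y L \<longleftrightarrow> (\<forall>z. \<exists>i\<le>n. Y z i \<noteq> 0) \<and>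
     (\<forall>z. \<exists>U g. open U \<and> z \<in> U \<and> (\<forall>w\<in>U. g w \<noteq> 0) \<and>
        (\<forall>i\<le>n. (\<lambda>w. g w * Y w i) holomorphic_on U) \<and> (\<lambda>w. g w ^ k * L w) holomorphic_on U)"

text \<open>Replaces a bound on the spherical derivative: on \<open>S\<close> the curve stays in the
  chart of one index \<open>j\<close>, with affine coordinates bounded by 2. A factor larger than 1
  leaves room, so that the largest coordinate at a point still dominates nearby and along a
  converging sequence.\<close>

definition dominated :: "nat \<Rightarrow> (complex \<Rightarrow> nat \<Rightarrow> complex) \<Rightarrow> complex set \<Rightarrow> bool" where
  "dominated n Y S \<longleftrightarrow> (\<exists>j\<le>n. \<forall>w\<in>S. \<forall>i\<le>n. norm (Y w i) \<le> 2 * norm (Y w j))"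

text \<open>The 2 by 2 minors do not see the choice of homogeneous coordinates, which here is made
  at each point separately.\<close>

definition nonconstant :: "nat \<Rightarrow> (complex \<Rightarrow> nat \<Rightarrow> complex) \<Rightarrow> bool" where
  "nonconstant n Y \<longleftrightarrow> (\<exists>z w. \<exists>i\<le>n. \<exists>j\<le>n. Y z i * Y w j \<noteq> Y z j * Y w i)"

lemma wcurve_nonzero: "wcurve n k Y L \<Longrightarrow> \<exists>i\<le>n. Y z i \<noteq> 0"
  by (simp add: wcurve_def)

lemma wcurveE:
  assumes "wcurve n k Y L"
  obtains U g where "open U" "z \<in> U" "\<And>w. w \<in> U \<Longrightarrow> g w \<noteq> 0"
    "\<And>i. i \<le> n \<Longrightarrow> (\<lambda>w. g w * Y w i) holomorphic_on U" "(\<lambda>w. g w ^ k * L w) holomorphic_on U"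
proof -
  have "\<exists>U g. open U \<and> z \<in> U \<and> (\<forall>w\<in>U. g w \<noteq> 0) \<and>
        (\<forall>i\<le>n. (\<lambda>w. g w * Y w i) holomorphic_on U) \<and> (\<lambda>w. g w ^ k * L w) holomorphic_on U"
    using assms by (simp add: wcurve_def)
  then show thesis
    by (elim exE conjE) (rule that; simp)
qed

text \<open>The unknown local factor \<open>g\<close> cancels in quotients of equal weight.\<close>

lemma wcurve_ratio_holomorphic:
  assumes Y: "wcurve n k Y L" and j: "j \<le> n" "\<And>w. w \<in> S \<Longrightarrow> Y w j \<noteq> 0" and "open S"
  shows "i \<le> n \<Longrightarrow> (\<lambda>w. Y w i / Y w j) holomorphic_on S"
    and "(\<lambda>w. L w / Y w j ^ k) holomorphic_on S"
proof -
  have "(i \<le> n \<longrightarrow> (\<lambda>w. Y w i / Y w j) analytic_on {z}) \<and> (\<lambda>w. L w / Y w j ^ k) analytic_on {z}"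
    if z: "z \<in> S" for z i
  proof -
    obtain U g where U: "open U" "z \<in> U" "\<And>w. w \<in> U \<Longrightarrow> g w \<noteq> 0"
      and hol: "\<And>i. i \<le> n \<Longrightarrow> (\<lambda>w. g w * Y w i) holomorphic_on U" "(\<lambda>w. g w ^ k * L w) holomorphic_on U"
      by (rule wcurveE[OF Y, of z]) (rule that)
    let ?V = "U \<inter> S"
    have V: "open ?V" "z \<in> ?V"
      using U z \<open>open S\<close> by auto
    have "(\<lambda>w. (g w * Y w i) / (g w * Y w j)) holomorphic_on ?V" if "i \<le> n"
      using hol(1)[OF that] hol(1)[OF j(1)]
      by (intro holomorphic_on_divide) (auto intro: holomorphic_on_subset simp: U j)
    then have "(\<lambda>w. Y w i / Y w j) holomorphic_on ?V" if "i \<le> n"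
      using that by (subst holomorphic_cong[OF refl, where g = "\<lambda>w. (g w * Y w i) / (g w * Y w j)"])
        (auto simp: U)
    moreover have "(\<lambda>w. (g w ^ k * L w) / (g w * Y w j) ^ k) holomorphic_on ?V"
      using hol(2) hol(1)[OF j(1)]
      by (intro holomorphic_on_divide holomorphic_on_power) (auto intro: holomorphic_on_subset simp: U j)
    then have "(\<lambda>w. L w / Y w j ^ k) holomorphic_on ?V"
      by (subst holomorphic_cong[OF refl, where g = "\<lambda>w. (g w ^ k * L w) / (g w * Y w j) ^ k"])
        (auto simp: U power_mult_distrib)
    ultimately show ?thesis
      using V unfolding analytic_at by blast
  qed
  then have "i \<le> n \<longrightarrow> (\<lambda>w. Y w i / Y w j) analytic_on S" "(\<lambda>w. L w / Y w j ^ k) analytic_on S"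
    using analytic_on_analytic_at by blast+
  then show "i \<le> n \<Longrightarrow> (\<lambda>w. Y w i / Y w j) holomorphic_on S"
    "(\<lambda>w. L w / Y w j ^ k) holomorphic_on S"
    by (auto intro: analytic_imp_holomorphic)
qed

lemma wcurve_affine:
  assumes "wcurve n k Y L"
  shows "wcurve n k (\<lambda>z. Y (a + b * z)) (\<lambda>z. L (a + b * z))"
  unfolding wcurve_def
proof (intro conjI allI)
  fix z
  show "\<exists>i\<le>n. Y (a + b * z) i \<noteq> 0"
    using assms by (rule wcurve_nonzero)
  obtain U g where U: "open U" "a + b * z \<in> U" "\<And>w. w \<in> U \<Longrightarrow> g w \<noteq> 0"
    and hol: "\<And>i. i \<le> n \<Longrightarrow> (\<lambda>w. g w * Y w i) holomorphic_on U" "(\<lambda>w. g w ^ k * L w) holomorphic_on U"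
    by (rule wcurveE[OF assms, of "a + b * z"]) (rule that)
  let ?h = "\<lambda>z. a + b * z"
  let ?V = "?h -` U"
  have V: "open ?V"
    by (intro open_vimage U continuous_intros)
  have comp: "(\<lambda>w. f (?h w)) holomorphic_on ?V" if "f holomorphic_on U" for f
  proof -
    have "(f \<circ> ?h) holomorphic_on ?V"
      by (rule holomorphic_on_compose_gen[OF _ that]) (auto intro!: holomorphic_intros)
    then show ?thesis by (simp add: o_def)
  qed
  show "\<exists>U g. open U \<and> z \<in> U \<and> (\<forall>w\<in>U. g w \<noteq> 0) \<and>
        (\<forall>i\<le>n. (\<lambda>w. g w * Y (a + b * w) i) holomorphic_on U) \<and>
        (\<lambda>w. g w ^ k * L (a + b * w)) holomorphic_on U"
    by (intro exI[of _ ?V] exI[of _ "\<lambda>w. g (?h w)"] conjI allI impI ballI V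
        comp[OF hol(1)] comp[OF hol(2)]) (use U in auto)
qed

lemma ex_max_coordinate:
  fixes x :: "nat \<Rightarrow> complex"
  obtains j where "j \<le> n" "\<And>i. i \<le> n \<Longrightarrow> norm (x i) \<le> norm (x j)"
proof -
  let ?M = "Max ((\<lambda>i. norm (x i)) ` {..n})"
  have "?M \<in> (\<lambda>i. norm (x i)) ` {..n}"
    by (rule Max_in) auto
  then obtain j where "j \<in> {..n}" and j: "?M = norm (x j)"
    by (rule imageE)
  then show thesis
    by (intro that[of j]) (auto simp flip: j)
qed

lemma dominated_subset: "dominated n Y T \<Longrightarrow> S \<subseteq> T \<Longrightarrow> dominated n Y S"
  unfolding dominated_def by blast

text \<open>The dominating index may vary with \<open>m\<close>, but there are finitely many
  indices: if each one failed on some set of the chain, all would fail on the largest of these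
  sets.\<close>

lemma dominated_UN:
  fixes S :: "nat \<Rightarrow> complex set"
  assumes "\<And>m. dominated n Y (S m)" and mono: "\<And>m m'. m \<le> m' \<Longrightarrow> S m \<subseteq> S m'"
  shows "dominated n Y (\<Union>m. S m)"
proof (rule ccontr)
  assume "\<not> dominated n Y (\<Union>m. S m)"
  then have "\<forall>j\<in>{..n}. \<exists>m. \<exists>w\<in>S m. \<exists>i\<le>n. \<not> norm (Y w i) \<le> 2 * norm (Y w j)"
    unfolding dominated_def by auto
  from bchoice[OF this] obtain m where m: "\<And>j. j \<le> n \<Longrightarrow> \<exists>w\<in>S (m j). \<exists>i\<le>n. \<not> norm (Y w i) \<le> 2 * norm (Y w j)"
    by auto
  define M where "M = Max (m ` {..n})"
  obtain j where j: "j \<le> n" "\<And>w i. w \<in> S M \<Longrightarrow> i \<le> n \<Longrightarrow> norm (Y w i) \<le> 2 * norm (Y w j)"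
    using assms(1)[of M] by (auto simp: dominated_def)
  have "m j \<le> M"
    unfolding M_def using j(1) by (intro Max_ge) auto
  then show False
    using m[OF j(1)] j(2) mono by blast
qed

lemma dominated_nonzero:
  assumes "wcurve n k Y L" "\<And>i. i \<le> n \<Longrightarrow> norm (Y w i) \<le> 2 * norm (Y w j)"
  shows "Y w j \<noteq> 0"
  using wcurve_nonzero[OF assms(1), of w] assms(2) by force

text \<open>The coordinate that is largest at \<open>z\<close> beats half of every other one
  strictly, and after multiplication by \<open>g\<close> the coordinates are continuous.\<close>

lemma dominated_ball:
  assumes "wcurve n k Y L"
  shows "\<exists>r>0. dominated n Y (ball z r)"
proof -
  obtain U g where U: "open U" "z \<in> U" "\<And>w. w \<in> U \<Longrightarrow> g w \<noteq> 0"
    and hol: "\<And>i. i \<le> n \<Longrightarrow> (\<lambda>w. g w * Y w i) holomorphic_on U"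
    by (rule wcurveE[OF assms, of z]) (rule that)
  obtain j where j: "j \<le> n" "\<And>i. i \<le> n \<Longrightarrow> norm (Y z i) \<le> norm (Y z j)"
    using ex_max_coordinate by blast
  then have nz: "Y z j \<noteq> 0"
    using wcurve_nonzero[OF assms, of z] by force
  have cont: "((\<lambda>w. g w * Y w i) \<longlongrightarrow> g z * Y z i) (nhds z)" if "i \<le> n" for i
  proof -
    have "isCont (\<lambda>w. g w * Y w i) z"
      using holomorphic_on_imp_continuous_on[OF hol[OF that]] U by (simp add: continuous_on_eq_continuous_at)
    then show ?thesis
      unfolding isCont_def by (rule tendsto_at_iff_tendsto_nhds[THEN iffD1])
  qed
  have "eventually (\<lambda>w. \<forall>i\<in>{..n}. norm (g w * Y w i) < 2 * norm (g w * Y w j)) (nhds z)"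
  proof (rule eventually_ball_finite, simp, rule ballI)
    fix i assume "i \<in> {..n}"
    then have i: "i \<le> n" by simp
    have "norm (g z * Y z i) < 2 * norm (g z * Y z j)"
    proof -
      have "norm (g z * Y z i) \<le> norm (g z * Y z j)"
        using j(2)[OF i] by (simp add: norm_mult mult_left_mono)
      moreover have "norm (g z * Y z j) > 0"
        using nz U by simp
      ultimately show ?thesis by linarith
    qed
    moreover have "((\<lambda>w. 2 * norm (g w * Y w j) - norm (g w * Y w i)) \<longlongrightarrow>
        2 * norm (g z * Y z j) - norm (g z * Y z i)) (nhds z)"
      by (intro tendsto_diff tendsto_mult[OF tendsto_const] tendsto_norm cont i j(1))
    ultimately have "eventually (\<lambda>w. 0 < 2 * norm (g w * Y w j) - norm (g w * Y w i)) (nhds z)"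
      by (intro order_tendstoD(1)) (assumption, linarith)
    then show "eventually (\<lambda>w. norm (g w * Y w i) < 2 * norm (g w * Y w j)) (nhds z)"
      by simp
  qed
  moreover have "eventually (\<lambda>w. w \<in> U) (nhds z)"
    using U by (simp add: eventually_nhds_in_open)
  ultimately have "eventually (\<lambda>w. \<forall>i\<le>n. norm (Y w i) \<le> 2 * norm (Y w j)) (nhds z)"
  proof eventually_elim
    case (elim w)
    then have "norm (g w) > 0" using U(3) by simp
    show ?case
    proof (intro allI impI)
      fix i assume "i \<le> n"
      then have "norm (g w) * norm (Y w i) < norm (g w) * (2 * norm (Y w j))"
        using elim(1) by (simp add: norm_mult mult_ac)
      then show "norm (Y w i) \<le> 2 * norm (Y w j)"
        using \<open>norm (g w) > 0\<close> by (meson less_imp_le mult_less_cancel_left_pos)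
    qed
  qed
  then obtain r where "r > 0" "\<And>w. dist w z < r \<Longrightarrow> \<forall>i\<le>n. norm (Y w i) \<le> 2 * norm (Y w j)"
    unfolding eventually_nhds_metric by blast
  then have "dominated n Y (ball z r)"
    unfolding dominated_def using j(1) by (auto simp: dist_commute)
  then show ?thesis
    using \<open>r > 0\<close> by blast
qed

text \<open>Liouville: a coordinate that dominates the others on the whole line makes all ratios bounded.\<close>

lemma dominated_UNIV_constant:
  assumes Y: "wcurve n k Y L" and dom: "dominated n Y UNIV"
  shows "\<not> nonconstant n Y"
proof -
  obtain j where j: "j \<le> n" "\<And>w i. i \<le> n \<Longrightarrow> norm (Y w i) \<le> 2 * norm (Y w j)"
    using dom by (auto simp: dominated_def)
  have nz: "Y w j \<noteq> 0" for w
    using dominated_nonzero[OF Y j(2)] .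
  have const: "\<exists>c. \<forall>w. Y w i = c * Y w j" if i: "i \<le> n" for i
  proof -
    have "(\<lambda>w. Y w i / Y w j) holomorphic_on UNIV"
      using wcurve_ratio_holomorphic(1)[OF Y j(1) nz open_UNIV i] .
    moreover have "norm (Y w i / Y w j) \<le> 2" for w
      using j(2)[OF i, of w] nz[of w] by (simp add: norm_divide field_simps)
    then have "bounded (range (\<lambda>w. Y w i / Y w j))"
      by (auto simp: bounded_iff)
    ultimately have "(\<lambda>w. Y w i / Y w j) constant_on UNIV"
      by (rule Liouville_theorem)
    then obtain c where "\<And>w. Y w i / Y w j = c"
      by (auto simp: constant_on_def)
    then show ?thesis
      using nz by (intro exI[of _ c]) (auto simp: field_simps)
  qed
  show ?thesis
  proof
    assume "nonconstant n Y"
    then obtain z w i l where il: "i \<le> n" "l \<le> n" "Y z i * Y w l \<noteq> Y z l * Y w i"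
      unfolding nonconstant_def by blast
    obtain a b where "\<And>w. Y w i = a * Y w j" "\<And>w. Y w l = b * Y w j"
      using const il(1,2) by metis
    then show False
      using il(3) by simp
  qed
qed

text \<open>Its reciprocal plays the part of the spherical derivative in Brody's argument.\<close>

definition dominance_radius :: "nat \<Rightarrow> (complex \<Rightarrow> nat \<Rightarrow> complex) \<Rightarrow> complex \<Rightarrow> real" where
  "dominance_radius n Y z = Sup {r. 0 < r \<and> dominated n Y (ball z r)}"

section \<open>Brody's lemma for one nonconstant curve\<close>

context
  fixes n k Y L
  assumes Y: "wcurve n k Y L" and nonconst: "nonconstant n Y"
begin

text \<open>If arbitrarily large balls were dominated, then so would be the whole plane by
  \<open>dominated_UN\<close>, and Liouville's theorem would make the curve constant.\<close>

lemma bdd_above_dominated: "bdd_above {r. 0 < r \<and> dominated n Y (ball z r)}"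
proof (rule ccontr)
  assume unb: "\<not> ?thesis"
  have "dominated n Y (ball z (real m))" for m
  proof -
    obtain r where "r > real m" "dominated n Y (ball z r)"
      using unb unfolding bdd_above_def by (auto simp: not_le)
    then show ?thesis
      by (auto intro: dominated_subset)
  qed
  then have "dominated n Y (\<Union>m. ball z (real m))"
    by (intro dominated_UN) auto
  moreover have "(\<Union>m. ball z (real m)) = UNIV"
    using reals_Archimedean2 by auto
  ultimately show False
    using dominated_UNIV_constant[OF Y] nonconst by simp
qed

lemma dominance_radius_upper: "0 < r \<Longrightarrow> dominated n Y (ball z r) \<Longrightarrow> r \<le> dominance_radius n Y z"
  unfolding dominance_radius_def by (intro cSup_upper bdd_above_dominated) auto

lemma dominance_radius_pos: "dominance_radius n Y z > 0"
  using dominated_ball[OF Y, of z] dominance_radius_upper by fastforce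

lemma dominated_less_radius:
  assumes "r < dominance_radius n Y z"
  shows "dominated n Y (ball z r)"
proof -
  obtain r0 where "r0 > 0" "dominated n Y (ball z r0)"
    using dominated_ball[OF Y] by blast
  then have "{r. 0 < r \<and> dominated n Y (ball z r)} \<noteq> {}"
    by blast
  then obtain r' where "r' > r" "dominated n Y (ball z r')"
    using assms less_cSup_iff[OF _ bdd_above_dominated] unfolding dominance_radius_def by blast
  then show ?thesis
    by (auto intro: dominated_subset)
qed

lemma dominance_radius_Lipschitz: "dominance_radius n Y z \<le> dominance_radius n Y w + dist z w"
proof (rule ccontr)
  assume "\<not> ?thesis"
  then obtain r where r: "dominance_radius n Y w + dist z w < r" "r < dominance_radius n Y z"
    using dense not_le by blast
  have "dominated n Y (ball w (r - dist z w))"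
  proof (rule dominated_subset[OF dominated_less_radius[OF r(2)]], rule subsetI)
    fix x assume "x \<in> ball w (r - dist z w)"
    then show "x \<in> ball z r"
      using dist_triangle[of z x w] by simp
  qed
  then have "r - dist z w \<le> dominance_radius n Y w"
    using r dominance_radius_pos[of w] by (intro dominance_radius_upper) auto
  then show False
    using r by simp
qed

lemma continuous_on_dominance_radius: "continuous_on S (dominance_radius n Y)"
proof (rule continuous_on_subset)
  have "1-lipschitz_on UNIV (dominance_radius n Y)"
  proof (rule lipschitz_onI)
    fix x y
    show "dist (dominance_radius n Y x) (dominance_radius n Y y) \<le> 1 * dist x y"
      using dominance_radius_Lipschitz[of x y] dominance_radius_Lipschitz[of y x]
      by (simp add: dist_real_def dist_commute)
  qed simp
  then show "continuous_on UNIV (dominance_radius n Y)"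
    by (rule lipschitz_on_continuous_on)
qed simp

text \<open>A derivative-free form of Brody's reparametrisation lemma: the centre maximises the distance
  to a large circle relative to the dominance radius.\<close>

lemma brody_reparametrisation:
  assumes "m > 0"
  obtains a b where "b \<noteq> (0::complex)"
    "\<And>w. norm w \<le> m \<Longrightarrow> dominated n (\<lambda>x. Y (a + b * x)) (ball w (1/4))"
    "\<not> dominated n (\<lambda>x. Y (a + b * x)) (ball 0 2)"
proof -
  let ?\<rho> = "dominance_radius n Y"
  note pos = dominance_radius_pos
  \<comment> \<open>With this radius the quotient \<open>?\<phi>\<close> has value
    \<open>2 * m\<close> at the origin, so its maximum is at least \<open>2 * m\<close>.\<close>
  define R where "R = 2 * m * ?\<rho> 0"
  have R: "R > 0"
    using assms pos by (simp add: R_def)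
  let ?\<phi> = "\<lambda>z. (R - norm z) / ?\<rho> z"
  have "continuous_on (cball 0 R) ?\<phi>"
    by (intro continuous_intros continuous_on_dominance_radius ballI) (use pos[THEN less_imp_neq] in auto)
  then obtain z where z: "z \<in> cball 0 R" "\<And>x. x \<in> cball 0 R \<Longrightarrow> ?\<phi> x \<le> ?\<phi> z"
    using continuous_attains_sup[of "cball 0 R" ?\<phi>] R by auto
  have "2 * m = ?\<phi> 0"
    using pos[of 0] by (simp add: R_def)
  also have "\<dots> \<le> ?\<phi> z"
    using R by (intro z) auto
  finally have Rz: "2 * m * ?\<rho> z \<le> R - norm z"
    using pos[of z] by (simp add: field_simps)
  \<comment> \<open>Within distance \<open>m * ?\<rho> z\<close> of the maximum point
    \<open>z\<close> the distance to the circle of radius \<open>R\<close> drops at most by half, so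
    maximality of \<open>?\<phi>\<close> lets the dominance radius drop at most by half.\<close>
  have half: "?\<rho> z / 2 \<le> ?\<rho> x" if x: "norm (x - z) \<le> m * ?\<rho> z" for x
  proof -
    have "norm x \<le> norm z + norm (x - z)"
      using norm_triangle_sub by blast
    then have 1: "(R - norm z) / 2 \<le> R - norm x"
      using x Rz by (simp add: field_simps)
    have 2: "R - norm z > 0"
      using Rz assms pos[of z] by (smt (verit) mult_pos_pos)
    have "?\<phi> x \<le> ?\<phi> z"
      using 1 2 by (intro z) auto
    then have "(R - norm x) * ?\<rho> z \<le> (R - norm z) * ?\<rho> x"
      using pos[of x] pos[of z] by (simp add: divide_simps mult.commute)
    moreover have "(R - norm z) / 2 * ?\<rho> z \<le> (R - norm x) * ?\<rho> z"
      using 1 pos[of z] by (intro mult_right_mono) auto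
    ultimately have "(R - norm z) * (?\<rho> z / 2) \<le> (R - norm z) * ?\<rho> x"
      by simp
    then show ?thesis
      using 2 by (simp add: mult_le_cancel_left)
  qed
  define b where "b = complex_of_real (?\<rho> z)"
  show thesis
  proof (rule that[of b z])
    show "b \<noteq> 0"
      using pos[of z] by (simp add: b_def)
    have norm_b: "norm b = ?\<rho> z"
      using pos[of z] by (simp add: b_def)
    show "dominated n (\<lambda>x. Y (z + b * x)) (ball w (1/4))" if w: "norm w \<le> m" for w
    proof -
      have "?\<rho> z / 2 \<le> ?\<rho> (z + b * w)"
        using w pos[of z] by (intro half) (simp add: norm_mult norm_b mult.commute)
      \<comment> \<open>A quarter of \<open>?\<rho> z\<close> stays strictly below the half that is
        guaranteed, as \<open>dominated_less_radius\<close> requires.\<close>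
      then have "dominated n Y (ball (z + b * w) (?\<rho> z / 4))"
        using pos[of z] by (intro dominated_less_radius) simp
      moreover have "z + b * x \<in> ball (z + b * w) (?\<rho> z / 4)" if "x \<in> ball w (1/4)" for x
      proof -
        have "dist (z + b * w) (z + b * x) = norm b * dist w x"
          by (simp add: dist_norm flip: right_diff_distrib norm_mult)
        then show ?thesis
          using that pos[of z] by (simp add: norm_b)
      qed
      ultimately show ?thesis
        unfolding dominated_def by blast
    qed
    show "\<not> dominated n (\<lambda>x. Y (z + b * x)) (ball 0 2)"
    proof
      assume dom: "dominated n (\<lambda>x. Y (z + b * x)) (ball 0 2)"
      \<comment> \<open>Undoing the affine change turns \<open>ball 0 2\<close> into a ball of twice
        the dominance radius about \<open>z\<close>.\<close>
      have "dominated n Y (ball z (2 * ?\<rho> z))"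
      proof -
        have "\<exists>y\<in>ball 0 2. x = z + b * y" if x: "x \<in> ball z (2 * ?\<rho> z)" for x
        proof (rule bexI[of _ "(x - z) / b"])
          show "x = z + b * ((x - z) / b)"
            using \<open>b \<noteq> 0\<close> by simp
          show "(x - z) / b \<in> ball 0 2"
            using x pos[of z] by (simp add: norm_divide norm_b dist_norm divide_simps norm_minus_commute)
        qed
        then show ?thesis
          using dom unfolding dominated_def by metis
      qed
      then have "2 * ?\<rho> z \<le> ?\<rho> z"
        using pos[of z] by (intro dominance_radius_upper) auto
      then show False
        using pos[of z] by simp
    qed
  qed
qed

end

section \<open>Limits of reparametrised curves\<close>

text \<open>Montel's theorem is applied for each \<open>a\<close> in turn to the subsequence found
  so far; the diagonal sequence serves all \<open>a\<close> together.\<close>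

lemma diagonal_Montel:
  fixes f :: "nat \<Rightarrow> nat \<Rightarrow> complex \<Rightarrow> complex"
  assumes S: "\<And>a. open (S a)"
    and hol: "\<And>a m. f a m holomorphic_on S a"
    and bound: "\<And>a m w. w \<in> S a \<Longrightarrow> norm (f a m w) \<le> B"
  obtains r g where "strict_mono (r :: nat \<Rightarrow> nat)" "\<And>a. g a holomorphic_on S a"
    "\<And>a K. compact K \<Longrightarrow> K \<subseteq> S a \<Longrightarrow> uniform_limit K (\<lambda>m. f a (r m)) (g a) sequentially"
proof -
  define P where "P a r \<longleftrightarrow> (\<exists>g. g holomorphic_on S a \<and>
      (\<forall>K. compact K \<longrightarrow> K \<subseteq> S a \<longrightarrow> uniform_limit K (\<lambda>m. f a (r m)) g sequentially))"
    for a and r :: "nat \<Rightarrow> nat"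
  have sub: "\<exists>k. strict_mono k \<and> P a (r \<circ> k)" for a and r :: "nat \<Rightarrow> nat"
  proof -
    obtain g k where g: "g holomorphic_on S a" and k: "strict_mono (k :: nat \<Rightarrow> nat)"
      and lim: "\<And>K. \<lbrakk>compact K; K \<subseteq> S a\<rbrakk> \<Longrightarrow> uniform_limit K ((\<lambda>m. f a (r m)) \<circ> k) g sequentially"
    proof (rule Montel[OF S, of "range (\<lambda>m. f a (r m))" a "\<lambda>m. f a (r m)"])
      show "\<exists>B. \<forall>h\<in>range (\<lambda>m. f a (r m)). \<forall>z\<in>K. norm (h z) \<le> B" if "K \<subseteq> S a" for K
        using bound that by (intro exI[of _ B]) auto
    qed (auto simp: hol)
    have "P a (r \<circ> k)"
      unfolding P_def using g lim by (intro exI[of _ g]) (auto simp: o_def)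
    with k show ?thesis by blast
  qed
  \<comment> \<open>Convergence along \<open>k1\<close> passes to any sequence whose members, from
    some position on, are members of \<open>k1\<close> at the same or later positions. The diagonal
    sequence has this form for every \<open>a\<close>.\<close>
  have stable: "P a (r \<circ> k2)" if "P a (r \<circ> k1)" and k: "\<And>j. N \<le> j \<Longrightarrow> \<exists>j'. j \<le> j' \<and> k2 j = k1 j'"
    for a and r k1 k2 :: "nat \<Rightarrow> nat" and N
  proof -
    obtain g where g: "g holomorphic_on S a"
      and lim: "\<forall>K. compact K \<longrightarrow> K \<subseteq> S a \<longrightarrow> uniform_limit K (\<lambda>m. f a ((r \<circ> k1) m)) g sequentially"
      using \<open>P a (r \<circ> k1)\<close> unfolding P_def by (elim exE conjE)
    have "uniform_limit K (\<lambda>m. f a ((r \<circ> k2) m)) g sequentially" if "compact K" "K \<subseteq> S a" for K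
      unfolding uniform_limit_sequentially_iff
    proof (intro allI impI)
      fix e :: real assume "e > 0"
      have "uniform_limit K (\<lambda>m. f a ((r \<circ> k1) m)) g sequentially"
        using lim that by simp
      then have "\<exists>M. \<forall>m\<ge>M. \<forall>x\<in>K. dist (f a ((r \<circ> k1) m) x) (g x) < e"
        using \<open>e > 0\<close> unfolding uniform_limit_sequentially_iff by simp
      then obtain M where M: "\<forall>m\<ge>M. \<forall>x\<in>K. dist (f a ((r \<circ> k1) m) x) (g x) < e"
        by (elim exE)
      have "dist (f a ((r \<circ> k2) m) x) (g x) < e" if m: "m \<ge> max M N" and x: "x \<in> K" for m x
      proof -
        obtain j' where "m \<le> j'" "k2 m = k1 j'"
          using k[of m] m by auto
        then show ?thesis
          using M m x by auto
      qed
      then show "\<exists>N. \<forall>n\<ge>N. \<forall>x\<in>K. dist (f a ((r \<circ> k2) n) x) (g x) < e"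
        by (intro exI[of _ "max M N"]) simp
    qed
    then show ?thesis
      unfolding P_def using g by (intro exI[of _ g]) auto
  qed
  obtain k where k: "strict_mono (k :: nat \<Rightarrow> nat)" "\<And>a. P a (id \<circ> k)"
    by (rule subsequence_diagonalization_lemma[of P id, OF sub]) (rule stable, assumption+, rule that)
  have "\<forall>a. \<exists>g. g holomorphic_on S a \<and>
      (\<forall>K. compact K \<longrightarrow> K \<subseteq> S a \<longrightarrow> uniform_limit K (\<lambda>m. f a (k m)) g sequentially)"
    using k(2) unfolding P_def by simp
  from choice[OF this] obtain g where g: "\<forall>a. g a holomorphic_on S a \<and>
      (\<forall>K. compact K \<longrightarrow> K \<subseteq> S a \<longrightarrow> uniform_limit K (\<lambda>m. f a (k m)) (g a) sequentially)"
    by (elim exE)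
  show thesis
    by (rule that[OF k(1), of g]) (use g in auto)
qed

text \<open>The quotient of the two normalising factors converges, since it can be read off at an
  index where the limit \<open>b\<close> is nonzero. Its limit is \<open>\<gamma>\<close>, and it
  enters the section of weight \<open>k\<close> with its \<open>k\<close>-th power.\<close>

lemma proportional_limits:
  fixes c c' M :: "nat \<Rightarrow> complex" and y :: "nat \<Rightarrow> nat \<Rightarrow> complex"
  assumes nz: "eventually (\<lambda>m. c m \<noteq> 0 \<and> c' m \<noteq> 0) sequentially"
    and a: "\<And>i. i \<le> n \<Longrightarrow> (\<lambda>m. c m * y m i) \<longlonglongrightarrow> a i" "(\<lambda>m. c m ^ k * M m) \<longlonglongrightarrow> A"
    and b: "\<And>i. i \<le> n \<Longrightarrow> (\<lambda>m. c' m * y m i) \<longlonglongrightarrow> b i" "(\<lambda>m. c' m ^ k * M m) \<longlonglongrightarrow> B"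
    and nonzero: "\<exists>i\<le>n. a i \<noteq> 0" "\<exists>i\<le>n. b i \<noteq> 0"
  shows "\<exists>\<gamma>. \<gamma> \<noteq> 0 \<and> (\<forall>i\<le>n. \<gamma> * b i = a i) \<and> \<gamma> ^ k * B = A"
proof -
  obtain i where i: "i \<le> n" "b i \<noteq> 0"
    using nonzero(2) by blast
  let ?q = "\<lambda>m. (c m * y m i) / (c' m * y m i)"
  have "eventually (\<lambda>m. c' m * y m i \<noteq> 0) sequentially"
    using tendsto_imp_eventually_ne[OF b(1)[OF i(1)] i(2)] .
  with nz have q: "eventually (\<lambda>m. ?q m * c' m = c m) sequentially"
    by eventually_elim auto
  have lim: "?q \<longlonglongrightarrow> a i / b i"
    by (intro tendsto_divide a b i)
  have eq: "a i / b i * b l = a l" if l: "l \<le> n" for l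
  proof (rule LIMSEQ_unique[OF _ a(1)[OF l]])
    have "(\<lambda>m. ?q m * (c' m * y m l)) \<longlonglongrightarrow> a i / b i * b l"
      by (intro tendsto_mult lim b l)
    then show "(\<lambda>m. c m * y m l) \<longlonglongrightarrow> a i / b i * b l"
      by (rule Lim_transform_eventually)
        (use q in eventually_elim, metis mult.assoc)
  qed
  have "(a i / b i) ^ k * B = A"
  proof (rule LIMSEQ_unique[OF _ a(2)])
    have "(\<lambda>m. ?q m ^ k * (c' m ^ k * M m)) \<longlonglongrightarrow> (a i / b i) ^ k * B"
      by (intro tendsto_mult tendsto_power lim b)
    then show "(\<lambda>m. c m ^ k * M m) \<longlonglongrightarrow> (a i / b i) ^ k * B"
      by (rule Lim_transform_eventually)
        (use q in eventually_elim, metis mult.assoc power_mult_distrib)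
  qed
  moreover have "a i / b i \<noteq> 0"
    using nonzero(1) eq by auto
  ultimately show ?thesis
    using eq by blast
qed

text \<open>The outcome of the reparametrisation for a sequence of curves.
  \<open>weight_bound\<close> bounds the section of weight \<open>k\<close> in the chart of a
  dominating coordinate, so that Montel's theorem applies to it together with the
  coordinates.\<close>

locale brody_sequence =
  fixes n k :: nat and Y :: "nat \<Rightarrow> complex \<Rightarrow> nat \<Rightarrow> complex" and L :: "nat \<Rightarrow> complex \<Rightarrow> complex"
    and C :: real
  assumes curve: "\<And>m. wcurve n k (Y m) (L m)"
    and dom: "\<And>m w. norm w \<le> real m \<Longrightarrow> dominated n (Y m) (ball w (1/4))"
    and not_dom: "\<And>m. \<not> dominated n (Y m) (ball 0 2)"
    and weight_bound: "\<And>m w j. j \<le> n \<Longrightarrow> (\<And>i. i \<le> n \<Longrightarrow> norm (Y m w i) \<le> 2 * norm (Y m w j)) \<Longrightarrow>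
      norm (L m w) \<le> C * norm (Y m w j) ^ k"
begin

definition jmax :: "complex \<Rightarrow> nat \<Rightarrow> nat" where
  "jmax p m = (SOME j. j \<le> n \<and> (\<forall>w\<in>ball p (1/4). \<forall>i\<le>n. norm (Y m w i) \<le> 2 * norm (Y m w j)))"

lemma jmax:
  assumes "norm p \<le> real m"
  shows "jmax p m \<le> n"
    and "w \<in> ball p (1/4) \<Longrightarrow> i \<le> n \<Longrightarrow> norm (Y m w i) \<le> 2 * norm (Y m w (jmax p m))"
proof -
  have "jmax p m \<le> n \<and> (\<forall>w\<in>ball p (1/4). \<forall>i\<le>n. norm (Y m w i) \<le> 2 * norm (Y m w (jmax p m)))"
    unfolding jmax_def by (rule someI_ex) (use dom[OF assms] in \<open>simp add: dominated_def\<close>)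
  then show "jmax p m \<le> n"
    and "w \<in> ball p (1/4) \<Longrightarrow> i \<le> n \<Longrightarrow> norm (Y m w i) \<le> 2 * norm (Y m w (jmax p m))"
    by blast+
qed

lemma jmax_nonzero: "norm p \<le> real m \<Longrightarrow> w \<in> ball p (1/4) \<Longrightarrow> Y m w (jmax p m) \<noteq> 0"
  using dominated_nonzero[OF curve] jmax(2) by metis

text \<open>The coordinates normalised at \<open>p\<close>; index \<open>n + 1\<close> holds the section of weight \<open>k\<close>.\<close>

definition chart :: "complex \<Rightarrow> nat \<Rightarrow> nat \<Rightarrow> complex \<Rightarrow> complex" where
  "chart p i m w = (if norm p \<le> real m then
     (if i \<le> n then Y m w i / Y m w (jmax p m) else L m w / Y m w (jmax p m) ^ k) else 0)"

lemma chart_holomorphic: "chart p i m holomorphic_on ball p (1/4)"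
proof (cases "norm p \<le> real m")
  case True
  note rat = wcurve_ratio_holomorphic[OF curve jmax(1)[OF True] jmax_nonzero[OF True] open_ball]
  show ?thesis
    using rat(1)[where i = i] rat(2) True unfolding chart_def by (cases "i \<le> n") auto
next
  case False
  then have "chart p i m = (\<lambda>_. 0)"
    by (simp add: chart_def fun_eq_iff)
  then show ?thesis by simp
qed

lemma chart_bound:
  assumes "w \<in> ball p (1/4)"
  shows "norm (chart p i m w) \<le> max 2 C"
proof (cases "norm p \<le> real m")
  case True
  have nz: "norm (Y m w (jmax p m)) > 0"
    using jmax_nonzero[OF True assms] by simp
  show ?thesis
  proof (cases "i \<le> n")
    case i: True
    then have "norm (chart p i m w) \<le> 2"
      using jmax(2)[OF True assms i] nz True by (simp add: chart_def norm_divide divide_le_eq)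
    then show ?thesis by simp
  next
    case i: False
    have "norm (L m w) \<le> C * norm (Y m w (jmax p m)) ^ k"
      using weight_bound[OF jmax(1)[OF True] jmax(2)[OF True assms]] .
    then have "norm (chart p i m w) \<le> C"
      using nz True i by (simp add: chart_def norm_divide norm_power divide_le_eq)
    then show ?thesis by simp
  qed
qed (simp add: chart_def le_max_iff_disj)

text \<open>On overlaps the limits in two charts differ by a nonzero factor, which becomes the local
  factor of the limit curve \<open>Z\<close>. Nonconstancy comes from \<open>not_dom\<close>: for a
  constant limit, one coordinate would dominate \<open>Y (r m)\<close> on \<open>ball 0 2\<close>
  for large \<open>m\<close>.\<close>

lemma brody_limit:
  obtains Z \<Lambda> r where "wcurve n k Z \<Lambda>" "nonconstant n Z"
    "\<And>w. dominated n Z (ball w (1/8))" "strict_mono (r :: nat \<Rightarrow> nat)"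
    "\<And>w. \<exists>c. eventually (\<lambda>m. c m \<noteq> 0) sequentially \<and>
       (\<forall>i\<le>n. (\<lambda>m. c m * Y (r m) w i) \<longlonglongrightarrow> Z w i) \<and> (\<lambda>m. c m ^ k * L (r m) w) \<longlonglongrightarrow> \<Lambda> w"
proof -
  \<comment> \<open>Countably many centres, so that one diagonal subsequence serves all
    charts.\<close>
  obtain D :: "complex set" where D: "countable D" "\<And>X. open X \<Longrightarrow> X \<noteq> {} \<Longrightarrow> \<exists>d\<in>D. d \<in> X"
    using countable_dense_setE by blast
  have "D \<noteq> {}"
    using D(2)[of UNIV] by auto
  define q where "q = from_nat_into D"
  have q: "\<exists>a. dist (q a) z < 1/16" for z
  proof -
    obtain d where "d \<in> D" "d \<in> ball z (1/16)"
      using D(2)[of "ball z (1/16)"] by auto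
    moreover obtain a where "q a = d"
      unfolding q_def using from_nat_into_surj[OF D(1) \<open>d \<in> D\<close>] by blast
    ultimately show ?thesis
      by (auto simp: dist_commute)
  qed
  \<comment> \<open>The index \<open>a\<close> encodes a centre together with a coordinate.\<close>
  define f where "f a m = chart (q (fst (prod_decode a))) (snd (prod_decode a)) m" for a m
  obtain r g' where r: "strict_mono (r :: nat \<Rightarrow> nat)"
    and g': "\<And>a. g' a holomorphic_on ball (q (fst (prod_decode a))) (1/4)"
      "\<And>a K. compact K \<Longrightarrow> K \<subseteq> ball (q (fst (prod_decode a))) (1/4) \<Longrightarrow>
         uniform_limit K (\<lambda>m. f a (r m)) (g' a) sequentially"
    by (rule diagonal_Montel[of "\<lambda>a. ball (q (fst (prod_decode a))) (1/4)" f "max 2 C"])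
      (auto simp: f_def chart_holomorphic simp del: mem_ball intro!: chart_bound)
  define \<Psi> where "\<Psi> p i = g' (prod_encode (p, i))" for p i
  have hol: "\<Psi> p i holomorphic_on ball (q p) (1/4)" for p i
    using g'(1)[of "prod_encode (p, i)"] by (simp add: \<Psi>_def)
  have unif: "uniform_limit K (\<lambda>m. chart (q p) i (r m)) (\<Psi> p i) sequentially"
    if "compact K" "K \<subseteq> ball (q p) (1/4)" for K p i
    using g'(2)[of K "prod_encode (p, i)"] that by (simp add: \<Psi>_def f_def)
  have lim: "(\<lambda>m. chart (q p) i (r m) w) \<longlonglongrightarrow> \<Psi> p i w" if "w \<in> ball (q p) (1/4)" for p i w
    using tendsto_uniform_limitI[OF unif[of "{w}" p i], of w] that by simp
  have ev_large: "eventually (\<lambda>m. norm (q p) \<le> real (r m)) sequentially" for p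
  proof -
    have "filterlim (\<lambda>m. real (r m)) at_top sequentially"
      by (rule filterlim_compose[OF filterlim_real_sequentially filterlim_subseq[OF r]])
    then show ?thesis
      by (simp add: filterlim_at_top)
  qed
  have chart_jmax: "chart (q p) (jmax (q p) m) m w = 1" if "norm (q p) \<le> real m" "w \<in> ball (q p) (1/4)" for p m w
    using jmax(1)[OF that(1)] jmax_nonzero[OF that] that(1) by (simp add: chart_def)
  \<comment> \<open>For each \<open>m\<close> the normalising coordinate equals 1. Its index may
    vary with \<open>m\<close>, but were all the limits of norm below 1, all coordinates would be so
    for large \<open>m\<close>.\<close>
  have \<Psi>_large: "\<exists>i\<le>n. norm (\<Psi> p i w) \<ge> 1" if w: "w \<in> ball (q p) (1/4)" for p w
  proof (rule ccontr)
    assume "\<not> ?thesis"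
    then have small: "norm (\<Psi> p i w) < 1" if "i \<le> n" for i
      using that by force
    have "\<forall>i\<in>{..n}. eventually (\<lambda>m. norm (chart (q p) i (r m) w) < 1) sequentially"
      by (intro ballI order_tendstoD(2)[OF tendsto_norm[OF lim[OF w]]] small) simp
    then have "eventually (\<lambda>m. \<forall>i\<in>{..n}. norm (chart (q p) i (r m) w) < 1) sequentially"
      by (intro eventually_ball_finite) auto
    with ev_large[of p] have "eventually (\<lambda>m. False) sequentially"
    proof eventually_elim
      case (elim m)
      then show ?case
        using chart_jmax[OF elim(1) w] jmax(1)[OF elim(1)] by force
    qed
    then show False by simp
  qed
  have "\<forall>z. \<exists>a. dist (q a) z < 1/16"
    using q by blast
  \<comment> \<open>The centre is so close that the ball of radius 1/8 about \<open>z\<close> lies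
    in the chart of radius 1/4. The values of \<open>Z\<close> are taken in this chart, which
    changes from point to point; \<open>glue\<close> compares them with a fixed chart.\<close>
  from choice[OF this] obtain P where P: "\<forall>z. dist (q (P z)) z < 1/16"
    by (elim exE)
  define Z where "Z z i = \<Psi> (P z) i z" for z i
  define \<Lambda> where "\<Lambda> z = \<Psi> (P z) (n + 1) z" for z
  have P_ball: "ball z (1/8) \<subseteq> ball (q (P z)) (1/4)" "cball z (1/16) \<subseteq> ball (q (P z)) (1/4)"
    "z \<in> ball (q (P z)) (1/4)" for z
  proof -
    have d: "dist (q (P z)) z < 1/16" using P by blast
    show "ball z (1/8) \<subseteq> ball (q (P z)) (1/4)"
    proof
      fix x assume "x \<in> ball z (1/8)"
      then show "x \<in> ball (q (P z)) (1/4)"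
        using d dist_triangle[of "q (P z)" x z] by simp
    qed
    show "cball z (1/16) \<subseteq> ball (q (P z)) (1/4)"
    proof
      fix x assume "x \<in> cball z (1/16)"
      then show "x \<in> ball (q (P z)) (1/4)"
        using d dist_triangle[of "q (P z)" x z] by simp
    qed
    show "z \<in> ball (q (P z)) (1/4)"
      using d by simp
  qed
  define c where "c p w m = (if norm (q p) \<le> real (r m) then 1 / Y (r m) w (jmax (q p) (r m)) else 0)" for p w m
  have c_nz: "eventually (\<lambda>m. c p w m \<noteq> 0) sequentially" if w: "w \<in> ball (q p) (1/4)" for p w
    using ev_large[of p]
  proof eventually_elim
    case (elim m)
    then show ?case
      using jmax_nonzero[OF elim w] by (simp add: c_def)
  qed
  have c_lim: "i \<le> n \<Longrightarrow> (\<lambda>m. c p w m * Y (r m) w i) \<longlonglongrightarrow> \<Psi> p i w"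
    and c_lim': "(\<lambda>m. c p w m ^ k * L (r m) w) \<longlonglongrightarrow> \<Psi> p (n + 1) w" if w: "w \<in> ball (q p) (1/4)" for p w i
  proof -
    show "(\<lambda>m. c p w m * Y (r m) w i) \<longlonglongrightarrow> \<Psi> p i w" if "i \<le> n"
      by (rule Lim_transform_eventually[OF lim[OF w]], use ev_large[of p] in eventually_elim)
        (use that in \<open>simp add: chart_def c_def\<close>)
    show "(\<lambda>m. c p w m ^ k * L (r m) w) \<longlonglongrightarrow> \<Psi> p (n + 1) w"
      by (rule Lim_transform_eventually[OF lim[OF w]], use ev_large[of p] in eventually_elim)
        (simp add: chart_def c_def power_divide)
  qed
  have \<Psi>_nz: "\<exists>i\<le>n. \<Psi> p i w \<noteq> 0" if "w \<in> ball (q p) (1/4)" for p w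
    using \<Psi>_large[OF that] by force
  have glue: "\<exists>\<gamma>. \<gamma> \<noteq> 0 \<and> (\<forall>i\<le>n. \<gamma> * Z w i = \<Psi> p i w) \<and> \<gamma> ^ k * \<Lambda> w = \<Psi> p (n + 1) w"
    if w: "w \<in> ball (q p) (1/4)" for p w
    unfolding Z_def \<Lambda>_def
  proof (rule proportional_limits[where c = "c p w" and c' = "c (P w) w" and y = "\<lambda>m. Y (r m) w" and M = "\<lambda>m. L (r m) w"])
    show "eventually (\<lambda>m. c p w m \<noteq> 0 \<and> c (P w) w m \<noteq> 0) sequentially"
      using c_nz[OF w] c_nz[OF P_ball(3)] by eventually_elim simp
  qed (use w P_ball(3) c_lim c_lim' \<Psi>_nz in auto)
  have Z_curve: "wcurve n k Z \<Lambda>"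
    unfolding wcurve_def
  proof (intro conjI allI)
    fix z
    show "\<exists>i\<le>n. Z z i \<noteq> 0"
      unfolding Z_def using \<Psi>_nz P_ball(3) by blast
    have "\<forall>w\<in>ball (q (P z)) (1/4). \<exists>\<gamma>. \<gamma> \<noteq> 0 \<and> (\<forall>i\<le>n. \<gamma> * Z w i = \<Psi> (P z) i w) \<and> \<gamma> ^ k * \<Lambda> w = \<Psi> (P z) (n + 1) w"
      using glue by blast
    from bchoice[OF this] obtain \<gamma> where
      \<gamma>: "\<forall>w\<in>ball (q (P z)) (1/4). \<gamma> w \<noteq> 0 \<and> (\<forall>i\<le>n. \<gamma> w * Z w i = \<Psi> (P z) i w) \<and> \<gamma> w ^ k * \<Lambda> w = \<Psi> (P z) (n + 1) w"
      by (elim exE)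
    have "(\<lambda>w. \<gamma> w * Z w i) holomorphic_on ball (q (P z)) (1/4)" if "i \<le> n" for i
      using hol[of "P z" i] by (rule holomorphic_transform) (use \<gamma> that in auto)
    moreover have "(\<lambda>w. \<gamma> w ^ k * \<Lambda> w) holomorphic_on ball (q (P z)) (1/4)"
      using hol[of "P z" "n + 1"] by (rule holomorphic_transform) (use \<gamma> in auto)
    ultimately show "\<exists>U g. open U \<and> z \<in> U \<and> (\<forall>w\<in>U. g w \<noteq> 0) \<and>
        (\<forall>i\<le>n. (\<lambda>w. g w * Z w i) holomorphic_on U) \<and> (\<lambda>w. g w ^ k * \<Lambda> w) holomorphic_on U"
      using \<gamma> P_ball(3)[of z] by (intro exI[of _ "ball (q (P z)) (1/4)"] exI[of _ \<gamma>]) auto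
  qed
  \<comment> \<open>Since \<open>jmax\<close> may vary with \<open>m\<close>, the index is found by
    contradiction: strict failures for all \<open>j\<close> in the limit would persist for large
    \<open>m\<close> simultaneously, and in particular for \<open>j = jmax\<close>.\<close>
  have \<Psi>_dom: "\<exists>j\<le>n. \<forall>x\<in>ball (q p) (1/4). \<forall>i\<le>n. norm (\<Psi> p i x) \<le> 2 * norm (\<Psi> p j x)" for p
  proof (rule ccontr)
    assume neg: "\<not> ?thesis"
    have bad: "\<forall>j\<in>{..n}. \<exists>x i. x \<in> ball (q p) (1/4) \<and> i \<le> n \<and> 2 * norm (\<Psi> p j x) < norm (\<Psi> p i x)"
    proof (rule ballI, rule ccontr)
      fix j assume j: "j \<in> {..n}"
        and no: "\<not> (\<exists>x i. x \<in> ball (q p) (1/4) \<and> i \<le> n \<and> 2 * norm (\<Psi> p j x) < norm (\<Psi> p i x))"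
      have "\<forall>x\<in>ball (q p) (1/4). \<forall>i\<le>n. norm (\<Psi> p i x) \<le> 2 * norm (\<Psi> p j x)"
        using no not_less by blast
      then show False
        using j by - (rule notE[OF neg], rule exI[of _ j], simp)
    qed
    have "\<forall>j\<in>{..n}. eventually (\<lambda>m. \<exists>x i. x \<in> ball (q p) (1/4) \<and> i \<le> n \<and>
        2 * norm (chart (q p) j (r m) x) < norm (chart (q p) i (r m) x)) sequentially"
    proof (rule ballI)
      fix j assume "j \<in> {..n}"
      with bad obtain x i where x: "x \<in> ball (q p) (1/4)" "i \<le> n" "2 * norm (\<Psi> p j x) < norm (\<Psi> p i x)"
        by blast
      have "(\<lambda>m. norm (chart (q p) i (r m) x) - 2 * norm (chart (q p) j (r m) x)) \<longlonglongrightarrow>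
          norm (\<Psi> p i x) - 2 * norm (\<Psi> p j x)"
        by (intro tendsto_diff tendsto_mult[OF tendsto_const] tendsto_norm lim x)
      then have "eventually (\<lambda>m. 0 < norm (chart (q p) i (r m) x) - 2 * norm (chart (q p) j (r m) x)) sequentially"
        by (rule order_tendstoD(1)) (use x in linarith)
      then show "eventually (\<lambda>m. \<exists>x i. x \<in> ball (q p) (1/4) \<and> i \<le> n \<and>
        2 * norm (chart (q p) j (r m) x) < norm (chart (q p) i (r m) x)) sequentially"
        by eventually_elim (use x in force)
    qed
    then have "eventually (\<lambda>m. \<forall>j\<in>{..n}. \<exists>x i. x \<in> ball (q p) (1/4) \<and> i \<le> n \<and>
        2 * norm (chart (q p) j (r m) x) < norm (chart (q p) i (r m) x)) sequentially"
      by (intro eventually_ball_finite) auto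
    with ev_large[of p] have "eventually (\<lambda>m. False) sequentially"
    proof eventually_elim
      case (elim m)
      obtain x i where x: "x \<in> ball (q p) (1/4)" "i \<le> n"
        "2 * norm (chart (q p) (jmax (q p) (r m)) (r m) x) < norm (chart (q p) i (r m) x)"
        using bspec[OF elim(2), of "jmax (q p) (r m)"] jmax(1)[OF elim(1)] by auto
      have "norm (chart (q p) i (r m) x) \<le> 2"
        using jmax(2)[OF elim(1) x(1,2)] jmax_nonzero[OF elim(1) x(1)] elim(1) x(2)
        by (simp add: chart_def norm_divide divide_le_eq)
      then show ?case
        using x(3) chart_jmax[OF elim(1) x(1)] by simp
    qed
    then show False by simp
  qed
  have Z_dom: "dominated n Z (ball w (1/8))" for w
  proof -
    obtain j where j: "j \<le> n" "\<And>x i. x \<in> ball (q (P w)) (1/4) \<Longrightarrow> i \<le> n \<Longrightarrow>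
        norm (\<Psi> (P w) i x) \<le> 2 * norm (\<Psi> (P w) j x)"
      using \<Psi>_dom[of "P w"] by blast
    have "norm (Z x i) \<le> 2 * norm (Z x j)" if x: "x \<in> ball w (1/8)" and i: "i \<le> n" for x i
    proof -
      have x': "x \<in> ball (q (P w)) (1/4)"
        using x P_ball(1) by blast
      obtain \<gamma> where \<gamma>: "\<gamma> \<noteq> 0" "\<And>i. i \<le> n \<Longrightarrow> \<gamma> * Z x i = \<Psi> (P w) i x"
        using glue[OF x'] by blast
      have "norm (\<gamma> * Z x i) \<le> 2 * norm (\<gamma> * Z x j)"
        using j(2)[OF x' i] by (simp only: \<gamma>(2)[OF i] \<gamma>(2)[OF j(1)])
      then have "norm \<gamma> * norm (Z x i) \<le> norm \<gamma> * (2 * norm (Z x j))"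
        by (simp add: norm_mult mult_ac)
      then show ?thesis
        using \<gamma>(1) by (simp add: mult_le_cancel_left_pos)
    qed
    then show ?thesis
      unfolding dominated_def using j(1) by blast
  qed
  have Z_nonconst: "nonconstant n Z"
  proof (rule ccontr)
    assume const: "\<not> nonconstant n Z"
    obtain j where j: "j \<le> n" "\<And>i. i \<le> n \<Longrightarrow> norm (Z 0 i) \<le> norm (Z 0 j)"
      using ex_max_coordinate by blast
    have Z0: "norm (Z 0 j) > 0"
      using wcurve_nonzero[OF Z_curve, of 0] j by force
    have max: "norm (Z w i) \<le> norm (Z w j)" if i: "i \<le> n" for w i
    proof -
      have "Z w i * Z 0 j = Z w j * Z 0 i"
        using const i j(1) unfolding nonconstant_def by blast
      then have "norm (Z w i) * norm (Z 0 j) = norm (Z w j) * norm (Z 0 i)"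
        by (simp flip: norm_mult)
      also have "\<dots> \<le> norm (Z w j) * norm (Z 0 j)"
        using j(2)[OF i] by (intro mult_left_mono) auto
      finally show ?thesis
        using Z0 by simp
    qed
    have \<Psi>_max: "norm (\<Psi> p i x) \<le> norm (\<Psi> p j x)" if x: "x \<in> ball (q p) (1/4)" and i: "i \<le> n" for p x i
    proof -
      obtain \<gamma> where "\<And>i. i \<le> n \<Longrightarrow> \<gamma> * Z x i = \<Psi> p i x"
        using glue[OF x] by blast
      then have "\<Psi> p i x = \<gamma> * Z x i" "\<Psi> p j x = \<gamma> * Z x j"
        using i j(1) by simp_all
      then show ?thesis
        using max[OF i, of x] by (simp add: norm_mult mult_left_mono)
    qed
    have loc: "eventually (\<lambda>m. \<forall>x\<in>cball w (1/16). \<forall>i\<le>n. norm (Y (r m) x i) \<le> 2 * norm (Y (r m) x j)) sequentially" for w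
    proof -
      have "eventually (\<lambda>m. \<forall>i\<in>{..n}. \<forall>x\<in>cball w (1/16).
          dist (chart (q (P w)) i (r m) x) (\<Psi> (P w) i x) < 1/4) sequentially"
      proof (rule eventually_ball_finite, simp, rule ballI)
        fix i
        show "eventually (\<lambda>m. \<forall>x\<in>cball w (1/16).
          dist (chart (q (P w)) i (r m) x) (\<Psi> (P w) i x) < 1/4) sequentially"
          using unif[OF compact_cball P_ball(2)] by (rule uniform_limitD) simp
      qed
      with ev_large[of "P w"] show ?thesis
      proof eventually_elim
        case (elim m)
        show ?case
        proof (intro ballI allI impI)
          fix x i assume x: "x \<in> cball w (1/16)" and i: "i \<le> n"
          let ?p = "P w"
          have x': "x \<in> ball (q ?p) (1/4)"
            using x P_ball(2) by blast
          have "norm (\<Psi> ?p j x) \<ge> 1"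
            using \<Psi>_large[OF x'] \<Psi>_max[OF x'] by (meson order_trans)
          moreover have "norm (\<Psi> ?p i x) \<le> norm (\<Psi> ?p j x)"
            using \<Psi>_max[OF x' i] .
          \<comment> \<open>An error of 1/4 is enough: from
            \<open>norm (\<Psi> ?p j x) \<ge> 1\<close> it follows that
            \<open>norm (\<Psi> ?p j x) + 1/4\<close> is at most
            \<open>2 * (norm (\<Psi> ?p j x) - 1/4)\<close>.\<close>
          moreover have "norm (chart (q ?p) i (r m) x - \<Psi> ?p i x) < 1/4"
            "norm (\<Psi> ?p j x - chart (q ?p) j (r m) x) < 1/4"
            using elim(2) x i j(1) by (auto simp: dist_norm norm_minus_commute)
          ultimately have "norm (chart (q ?p) i (r m) x) \<le> 2 * norm (chart (q ?p) j (r m) x)"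
            using norm_triangle_sub[of "chart (q ?p) i (r m) x" "\<Psi> ?p i x"]
              norm_triangle_sub[of "\<Psi> ?p j x" "chart (q ?p) j (r m) x"] by linarith
          then have le: "norm (Y (r m) x i) / norm (Y (r m) x (jmax (q ?p) (r m))) \<le>
              2 * (norm (Y (r m) x j) / norm (Y (r m) x (jmax (q ?p) (r m))))"
            using elim(1) i j(1) by (simp add: chart_def norm_divide)
          have "norm (Y (r m) x (jmax (q ?p) (r m))) > 0"
            using jmax_nonzero[OF elim(1) x'] by simp
          then show "norm (Y (r m) x i) \<le> 2 * norm (Y (r m) x j)"
            using le by (simp add: divide_simps)
        qed
      qed
    qed
    obtain T where T: "finite T" "cball (0::complex) 2 \<subseteq> (\<Union>w\<in>T. ball w (1/16))"
    proof (rule compactE_image[of "cball (0::complex) 2" UNIV "\<lambda>w. ball w (1/16)"])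
      show "cball (0::complex) 2 \<subseteq> (\<Union>w\<in>UNIV. ball w (1/16))"
      proof
        fix x :: complex
        show "x \<in> (\<Union>w\<in>UNIV. ball w (1/16))"
          by (rule UN_I[of x]) auto
      qed
    qed auto
    have "eventually (\<lambda>m. \<forall>w\<in>T. \<forall>x\<in>cball w (1/16). \<forall>i\<le>n. norm (Y (r m) x i) \<le> 2 * norm (Y (r m) x j)) sequentially"
      using T(1) loc by (intro eventually_ball_finite) auto
    then have "eventually (\<lambda>m. False) sequentially"
    proof eventually_elim
      case (elim m)
      have "norm (Y (r m) x i) \<le> 2 * norm (Y (r m) x j)" if "x \<in> ball 0 2" "i \<le> n" for x i
      proof -
        have "x \<in> cball 0 2"
          using that(1) by simp
        then obtain w where "w \<in> T" "x \<in> ball w (1/16)"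
          using T(2) by blast
        then show ?thesis
          using elim that(2) by auto
      qed
      then have "dominated n (Y (r m)) (ball 0 2)"
        unfolding dominated_def using j(1) by blast
      then show False
        using not_dom by blast
    qed
    then show False by simp
  qed
  show thesis
  proof (rule that[OF Z_curve Z_nonconst Z_dom r])
    fix w
    show "\<exists>c. eventually (\<lambda>m. c m \<noteq> 0) sequentially \<and>
       (\<forall>i\<le>n. (\<lambda>m. c m * Y (r m) w i) \<longlonglongrightarrow> Z w i) \<and> (\<lambda>m. c m ^ k * L (r m) w) \<longlonglongrightarrow> \<Lambda> w"
      using c_nz[OF P_ball(3)] c_lim[OF P_ball(3)] c_lim'[OF P_ball(3)]
      by (intro exI[of _ "c (P w) w"]) (simp add: Z_def \<Lambda>_def)
  qed
qed

end

section \<open>Lemmas from one-variable complex analysis and algebra\<close>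

text \<open>The local factor does not change the zeros, so isolation of zeros applies locally. The
  set \<open>A\<close> of points near which \<open>f\<close> vanishes identically is therefore open
  and closed, and it misses \<open>z1\<close>.\<close>

lemma nowhere_zero_off_discrete:
  fixes f :: "complex \<Rightarrow> complex"
  assumes loc: "\<And>z. \<exists>U g. open U \<and> z \<in> U \<and> (\<forall>w\<in>U. g w \<noteq> 0) \<and> (\<lambda>w. g w * f w) holomorphic_on U"
    and nz: "f z1 \<noteq> 0"
  shows "\<exists>r>0. \<forall>w\<in>ball z r - {z}. f w \<noteq> 0"
proof -
  define A where "A = {z. \<exists>r>0. \<forall>w\<in>ball z r. f w = 0}"
  have dich: "z \<in> A \<or> (\<exists>r>0. \<forall>w\<in>ball z r - {z}. f w \<noteq> 0)" for z
  proof -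
    obtain U g where U: "open U" "z \<in> U" "\<forall>w\<in>U. g w \<noteq> 0" "(\<lambda>w. g w * f w) holomorphic_on U"
      using loc[of z] by (elim exE conjE)
    obtain r where r: "r > 0" "ball z r \<subseteq> U"
      using U(1,2) open_contains_ball by blast
    have hol: "(\<lambda>w. g w * f w) holomorphic_on ball z r"
      using U(4) r(2) by (rule holomorphic_on_subset)
    have gnz: "g w \<noteq> 0" if "w \<in> ball z r" for w
      using U(3) r(2) that by blast
    show ?thesis
    proof (cases "\<forall>w\<in>ball z r. f w = 0")
      case True
      then show ?thesis using r(1) by (auto simp: A_def)
    next
      case False
      then obtain b where b: "b \<in> ball z r" "g b * f b \<noteq> 0"
        using gnz by auto
      show ?thesis
      proof (cases "g z * f z = 0")
        case True
        obtain s where s: "0 < s" "ball z s \<subseteq> ball z r" "\<And>w. w \<in> ball z s - {z} \<Longrightarrow> g w * f w \<noteq> 0"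
          by (rule isolated_zeros[OF hol open_ball connected_ball _ True b]) (use r in auto)
        then have "\<forall>w\<in>ball z s - {z}. f w \<noteq> 0"
          by force
        then show ?thesis using s(1) by blast
      next
        case False
        have "continuous_on (ball z r) (\<lambda>w. g w * f w)"
          using hol by (rule holomorphic_on_imp_continuous_on)
        then have "open {w \<in> ball z r. g w * f w \<in> - {0}}"
          using continuous_open_preimage[of "ball z r" "\<lambda>w. g w * f w" "- {0}"]
          by (simp add: vimage_def Int_def open_Compl)
        moreover have "z \<in> {w \<in> ball z r. g w * f w \<in> - {0}}"
          using False r by simp
        ultimately obtain s where "s > 0" "ball z s \<subseteq> {w \<in> ball z r. g w * f w \<in> - {0}}"
          using open_contains_ball by blast
        then show ?thesis by force
      qed
    qed
  qed
  have "open A"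
  proof (unfold open_contains_ball, rule ballI)
    fix z assume "z \<in> A"
    then obtain r where r: "r > 0" "\<forall>w\<in>ball z r. f w = 0"
      by (auto simp: A_def)
    have "ball z r \<subseteq> A"
    proof
      fix x assume "x \<in> ball z r"
      then obtain s where "s > 0" "ball x s \<subseteq> ball z r"
        using open_contains_ball[THEN iffD1, OF open_ball] by blast
      then show "x \<in> A"
        using r(2) unfolding A_def by blast
    qed
    then show "\<exists>e>0. ball z e \<subseteq> A"
      using r(1) by blast
  qed
  moreover have "open (- A)"
  proof (unfold open_contains_ball, rule ballI)
    fix z assume "z \<in> - A"
    then obtain r where r: "r > 0" "\<forall>w\<in>ball z r - {z}. f w \<noteq> 0"
      using dich[of z] by blast
    have "ball z r \<subseteq> - A"
    proof
      fix x assume x: "x \<in> ball z r"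
      show "x \<in> - A"
      proof (cases "x = z")
        case False
        then have "f x \<noteq> 0" using r x by blast
        then show ?thesis unfolding A_def by force
      qed (use \<open>z \<in> - A\<close> in simp)
    qed
    then show "\<exists>e>0. ball z e \<subseteq> - A"
      using r(1) by blast
  qed
  ultimately have "A = {} \<or> A = UNIV"
    using clopen[of A] by (simp add: closed_def)
  moreover have "z1 \<notin> A"
    using nz by (force simp: A_def)
  ultimately show ?thesis
    using dich[of z] by blast
qed

text \<open>The isolated singularities are removable by boundedness, and Liouville's theorem applies
  to the extension.\<close>

lemma bounded_off_discrete_constant:
  fixes h :: "complex \<Rightarrow> complex"
  assumes discrete: "\<And>z. \<exists>r>0. ball z r - {z} \<subseteq> S" and hol: "h holomorphic_on S" and "open S"
    and bound: "\<And>z. z \<in> S \<Longrightarrow> norm (h z) \<le> B"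
  shows "\<exists>c. \<forall>z\<in>S. h z = c"
proof -
  have eq: "remove_sings h z = h z" if "z \<in> S" for z
    using hol \<open>open S\<close> that by (intro remove_sings_at_analytic) (auto simp: analytic_at)
  have loc: "remove_sings h analytic_on {z} \<and> norm (remove_sings h z) \<le> B" for z
  proof -
    obtain r where r: "r > 0" "ball z r - {z} \<subseteq> S"
      using discrete by blast
    have "h holomorphic_on ball z r - {z}"
      using hol r(2) by (rule holomorphic_on_subset)
    moreover have ev: "eventually (\<lambda>w. norm (h w) \<le> B) (at z)"
      unfolding eventually_at
    proof (intro exI[of _ r] conjI ballI impI)
      fix x assume "x \<noteq> z \<and> dist x z < r"
      then have "x \<in> ball z r - {z}"
        by (simp add: dist_commute)
      then show "norm (h x) \<le> B"
        using r(2) bound by blast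
    qed (use r in auto)
    then have "\<exists>B. eventually (\<lambda>w. norm (h w) \<le> B) (at z)"
      by blast
    ultimately have "\<exists>g. g holomorphic_on ball z r \<and> (\<forall>w\<in>ball z r - {z}. g w = h w)"
      using holomorphic_on_extend_bounded[of h "ball z r" z] r(1) by simp
    then obtain g where g: "g holomorphic_on ball z r" "\<forall>w\<in>ball z r - {z}. g w = h w"
      by (elim exE conjE)
    have "isCont g z"
      using g(1) r(1) by (metis centre_in_ball continuous_on_interior holomorphic_on_imp_continuous_on interior_ball)
    moreover have "eventually (\<lambda>w. g w = h w) (at z)"
      unfolding eventually_at using r(1) g(2) by (intro exI[of _ r]) (auto simp: dist_commute)
    ultimately have lim: "h \<midarrow>z\<rightarrow> g z"
      unfolding isCont_def by (rule Lim_transform_eventually)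
    then have at_z: "remove_sings h z = g z"
      by (rule remove_sings_eqI)
    have "remove_sings h holomorphic_on ball z r"
      using g(1) by (rule holomorphic_transform) (use at_z g(2) eq r(2) in force)
    moreover have "norm (g z) \<le> B"
      by (rule Lim_norm_ubound[OF _ lim ev]) simp
    ultimately show ?thesis
      using r(1) at_z by (auto simp: analytic_at intro!: exI[of _ "ball z r"])
  qed
  then have "remove_sings h holomorphic_on UNIV"
    using analytic_on_analytic_at analytic_imp_holomorphic by blast
  moreover have "bounded (range (remove_sings h))"
    using loc by (auto simp: bounded_iff)
  ultimately have "remove_sings h constant_on UNIV"
    by (rule Liouville_theorem)
  then show ?thesis
    using eq by (auto simp: constant_on_def)
qed

section \<open>Growth of polynomials, bounds for roots and derivatives, and squarefree parts\<close>

lemma poly_growth: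
  fixes q :: "complex poly"
  obtains B where "B \<ge> 0" "\<And>x t. norm x \<le> t \<Longrightarrow> 1 \<le> t \<Longrightarrow> norm (poly q x) \<le> B * t ^ degree q"
proof
  let ?B = "\<Sum>i\<le>degree q. norm (coeff q i)"
  show "?B \<ge> 0"
    by (intro sum_nonneg) simp
  show "norm (poly q x) \<le> ?B * t ^ degree q" if "norm x \<le> t" "1 \<le> t" for x t
  proof -
    have "norm (poly q x) \<le> (\<Sum>i\<le>degree q. norm (coeff q i * x ^ i))"
      unfolding poly_altdef by (rule norm_sum)
    also have "\<dots> \<le> (\<Sum>i\<le>degree q. norm (coeff q i) * t ^ degree q)"
    proof (rule sum_mono)
      fix i assume "i \<in> {..degree q}"
      then have "norm x ^ i \<le> t ^ degree q"
        using that by (meson atMost_iff norm_ge_zero order_trans power_increasing power_mono)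
      then show "norm (coeff q i * x ^ i) \<le> norm (coeff q i) * t ^ degree q"
        by (simp add: norm_mult norm_power mult_left_mono)
    qed
    finally show ?thesis
      by (simp add: sum_distrib_right)
  qed
qed

text \<open>If \<open>norm x > 1\<close>, every term except the leading one is at most its
  coefficient times the power \<open>d - 1\<close> of \<open>norm x\<close>, and dividing by this
  power bounds \<open>norm x\<close>.\<close>

lemma monic_root_bound:
  fixes x :: complex
  assumes eq: "x ^ d + (\<Sum>i=1..d. c i * x ^ (d - i)) = y" and "d \<ge> 1"
    and c: "(\<Sum>i=1..d. norm (c i)) \<le> A" and y: "norm y \<le> A'"
  shows "norm x \<le> 1 + A + A'"
proof (cases "norm x \<le> 1")
  case True
  moreover have "0 \<le> (\<Sum>i=1..d. norm (c i))"
    by (intro sum_nonneg) simp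
  ultimately show ?thesis
    using c y norm_ge_zero[of y] by linarith
next
  case False
  then have x: "norm x \<ge> 1" by simp
  have "norm x ^ d = norm (y - (\<Sum>i=1..d. c i * x ^ (d - i)))"
    using eq by (metis add_diff_cancel_right' norm_power)
  also have "\<dots> \<le> norm y + (\<Sum>i=1..d. norm (c i * x ^ (d - i)))"
    by (rule norm_triangle_le_diff) (use norm_sum in \<open>simp add: add_left_mono\<close>)
  also have "\<dots> \<le> A' * norm x ^ (d - 1) + (\<Sum>i=1..d. norm (c i) * norm x ^ (d - 1))"
  proof (intro add_mono sum_mono)
    have "norm y * 1 \<le> A' * norm x ^ (d - 1)"
      using y x by (intro mult_mono) (auto intro: order_trans[OF norm_ge_zero y])
    then show "norm y \<le> A' * norm x ^ (d - 1)"
      by simp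
  next
    fix i assume "i \<in> {1..d}"
    then show "norm (c i * x ^ (d - i)) \<le> norm (c i) * norm x ^ (d - 1)"
      using x by (auto simp: norm_mult norm_power intro!: mult_left_mono power_increasing)
  qed
  also have "\<dots> \<le> (A' + A) * norm x ^ (d - 1)"
    using mult_right_mono[OF c, of "norm x ^ (d - 1)"] by (simp add: distrib_right sum_distrib_right)
  finally have "norm x * norm x ^ (d - 1) \<le> (A' + A) * norm x ^ (d - 1)"
    using \<open>d \<ge> 1\<close> by (simp flip: power_Suc)
  moreover have "norm x ^ (d - 1) > 0"
    using x by (intro zero_less_power) linarith
  ultimately have "norm x \<le> A' + A"
    by (rule mult_right_le_imp_le)
  then show ?thesis by simp
qed

lemma Cauchy_deriv_bound:
  assumes hol: "f holomorphic_on ball z (1/8)" and bound: "\<And>w. w \<in> ball z (1/8) \<Longrightarrow> norm (f w) \<le> K"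
  shows "norm (deriv f z) \<le> 16 * K"
proof -
  have sub: "cball z (1/16) \<subseteq> ball z (1/8)"
    by (rule cball_subset_ball_iff[THEN iffD2]) simp
  have "norm ((deriv ^^ 1) f z) \<le> fact 1 * K / (1/16) ^ 1"
  proof (rule Cauchy_inequality)
    show "f holomorphic_on ball z (1/16)"
      using hol by (rule holomorphic_on_subset) auto
    show "continuous_on (cball z (1/16)) f"
      using holomorphic_on_imp_continuous_on[OF hol] sub by (rule continuous_on_subset)
    show "norm (f x) \<le> K" if "norm (z - x) = 1/16" for x
      using that by (intro bound) (simp add: dist_norm)
  qed simp
  then show ?thesis by simp
qed

text \<open>Dividing \<open>p\<close> by its gcd \<open>D\<close> with the derivative leaves each
  root of \<open>p\<close> exactly once in \<open>R\<close>. The Bezout identity of the gcd, divided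
  by \<open>D\<close>, is what later allows a quotient by \<open>R\<close> to be written without a
  denominator.\<close>

lemma squarefree_decomposition:
  fixes p :: "complex poly"
  assumes "degree p > 0"
  obtains R D Q a b where "p = R * D" "pderiv p = Q * D" "D \<noteq> 0" "a * R + b * Q = 1"
    "card {u. poly p u = 0} \<le> degree R" "degree p = degree R + degree D"
proof -
  have p': "pderiv p \<noteq> 0" and p: "p \<noteq> 0"
    using assms by (auto simp: pderiv_eq_0_iff)
  define D where "D = gcd p (pderiv p)"
  obtain a b where ab: "a * p + b * pderiv p = D"
    using bezout_coefficients_fst_snd[of p "pderiv p"] unfolding D_def by metis
  obtain R Q where RQ: "p = R * D" "pderiv p = Q * D"
    unfolding D_def by (metis dvdE gcd_dvd1 gcd_dvd2 mult.commute)
  have D: "D \<noteq> 0"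
    using p by (simp add: D_def)
  have "(a * R + b * Q) * D = 1 * D"
    using ab by (subst (asm) RQ(2), subst (asm) RQ(1)) (simp add: algebra_simps)
  then have 1: "a * R + b * Q = 1"
    using D by (metis mult_right_cancel)
  have R: "R \<noteq> 0"
    using p RQ(1) by auto
  have "{u. poly p u = 0} \<subseteq> {u. poly R u = 0}"
  proof clarify
    fix u assume "poly p u = 0"
    then have "order u p \<noteq> 0"
      using p order_root by blast
    then have "order u R = 1"
      using poly_squarefree_decomp_order[OF p' RQ ab[symmetric], of u] by simp
    then show "poly R u = 0"
      using order_root[of R u] by simp
  qed
  then have "card {u. poly p u = 0} \<le> card {u. poly R u = 0}"
    by (intro card_mono poly_roots_finite R)
  also have "\<dots> \<le> degree R"
    by (rule card_poly_roots_bound[OF R])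
  finally show thesis
    using RQ D 1 R by (intro that[of R D Q a b]) (simp_all add: degree_mult_eq)
qed

section \<open>Entire curves in superelliptic curves\<close>

text \<open>The limit curve over one point of \<open>D\<close>: \<open>Y z 0\<close> is the factor
  in front of a fixed representative of the point, \<open>Y z 1\<close> the last coordinate of the
  cover, and \<open>L\<close> has weight \<open>k\<close>. By \<open>dom\<close> each small ball is
  controlled in one of the two charts, and \<open>roots\<close> is the exponent count that keeps
  \<open>u\<close> times the differential bounded at infinity.\<close>

locale superelliptic =
  fixes d k :: nat and c :: "nat \<Rightarrow> complex" and Y :: "complex \<Rightarrow> nat \<Rightarrow> complex" and L :: "complex \<Rightarrow> complex"
    and C :: real
  assumes d: "d \<ge> 1" and k: "k \<ge> 1" and curve: "wcurve 1 k Y L"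
    and equation: "\<And>z. Y z 1 ^ (d * k) = L z ^ d + (\<Sum>i=1..d. c i * Y z 0 ^ (i * k) * L z ^ (d - i))"
    and C: "C \<ge> 1"
    and dom: "\<And>z. (\<forall>w\<in>ball z (1/8). norm (Y w 0) \<le> C * norm (Y w 1)) \<or>
       (\<forall>w\<in>ball z (1/8). norm (Y w 1) \<le> C * norm (Y w 0))"
    and roots: "k * card {u. poly (monic_poly d c) u = 0} \<ge> 2 * k + 2"
begin

definition \<Omega> :: "complex set" where "\<Omega> = {z. Y z 0 \<noteq> 0}"
definition V :: "complex \<Rightarrow> complex" where "V z = Y z 1 / Y z 0"
definition u :: "complex \<Rightarrow> complex" where "u z = L z / Y z 0 ^ k"

text \<open>Majorises the root bounds of \<open>monic_root_bound\<close> in both charts; in the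
  chart at infinity the coefficients carry powers of \<open>1 / V\<close>, which are bounded by
  \<open>C ^ (d * k)\<close>.\<close>

definition K :: real where "K = 2 + C + (\<Sum>i=1..d. norm (c i)) * C ^ (d * k) + C ^ (d * k)"

lemma K: "C \<le> K" "1 \<le> K" "1 + (\<Sum>i=1..d. norm (c i)) * C ^ (d * k) + 1 \<le> K"
  "1 + (\<Sum>i=1..d. norm (c i)) + C ^ (d * k) \<le> K"
proof -
  have s: "0 \<le> (\<Sum>i=1..d. norm (c i))"
    by (intro sum_nonneg) simp
  have p: "1 \<le> C ^ (d * k)"
    using C by simp
  have "(\<Sum>i=1..d. norm (c i)) * 1 \<le> (\<Sum>i=1..d. norm (c i)) * C ^ (d * k)"
    using s p by (intro mult_left_mono)
  then show "C \<le> K" "1 \<le> K" "1 + (\<Sum>i=1..d. norm (c i)) * C ^ (d * k) + 1 \<le> K"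
    "1 + (\<Sum>i=1..d. norm (c i)) + C ^ (d * k) \<le> K"
    using C s p unfolding K_def by linarith+
qed

lemma power_index: "i \<in> {1..d} \<Longrightarrow> i * k + (d - i) * k = d * k" "i \<in> {1..d} \<Longrightarrow> i * k \<le> d * k"
  by (simp_all flip: add_mult_distrib)

lemma affine_equation:
  assumes "z \<in> \<Omega>"
  shows "u z ^ d + (\<Sum>i=1..d. c i * u z ^ (d - i)) = V z ^ (d * k)"
proof -
  have nz: "Y z 0 \<noteq> 0"
    using assms by (simp add: \<Omega>_def)
  have L: "L z = u z * Y z 0 ^ k"
    using nz by (simp add: u_def)
  have "V z ^ (d * k) * Y z 0 ^ (d * k) = Y z 1 ^ (d * k)"
    using nz by (simp add: V_def flip: power_mult_distrib)
  also have "\<dots> = u z ^ d * Y z 0 ^ (d * k) + (\<Sum>i=1..d. c i * u z ^ (d - i) * Y z 0 ^ (d * k))"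
    unfolding equation
  proof (intro arg_cong2[where f = "(+)"] sum.cong refl)
    show "L z ^ d = u z ^ d * Y z 0 ^ (d * k)"
      by (simp add: L power_mult_distrib mult.commute[of d] flip: power_mult)
    fix i assume "i \<in> {1..d}"
    then have "Y z 0 ^ (i * k) * Y z 0 ^ ((d - i) * k) = Y z 0 ^ (d * k)"
      by (simp only: power_index flip: power_add)
    then show "c i * Y z 0 ^ (i * k) * L z ^ (d - i) = c i * u z ^ (d - i) * Y z 0 ^ (d * k)"
      by (simp add: L power_mult_distrib mult.commute[of "d - i"] flip: power_mult)
  qed
  also have "\<dots> = (u z ^ d + (\<Sum>i=1..d. c i * u z ^ (d - i))) * Y z 0 ^ (d * k)"
    by (simp add: distrib_right sum_distrib_right)
  finally show ?thesis
    using nz by simp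
qed

lemma poly_u: "z \<in> \<Omega> \<Longrightarrow> poly (monic_poly d c) (u z) = V z ^ (d * k)"
  using affine_equation by (simp add: poly_monic_poly)

lemma infinity_equation:
  assumes "Y z 1 \<noteq> 0"
  shows "(L z / Y z 1 ^ k) ^ d + (\<Sum>i=1..d. (c i * (Y z 0 / Y z 1) ^ (i * k)) * (L z / Y z 1 ^ k) ^ (d - i)) = 1"
proof -
  let ?W = "L z / Y z 1 ^ k"
  have L: "L z = ?W * Y z 1 ^ k"
    using assms by simp
  have "(?W ^ d + (\<Sum>i=1..d. (c i * (Y z 0 / Y z 1) ^ (i * k)) * ?W ^ (d - i))) * Y z 1 ^ (d * k) =
      ?W ^ d * Y z 1 ^ (d * k) + (\<Sum>i=1..d. (c i * (Y z 0 / Y z 1) ^ (i * k)) * ?W ^ (d - i) * Y z 1 ^ (d * k))"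
    by (simp add: distrib_right sum_distrib_right)
  also have "\<dots> = L z ^ d + (\<Sum>i=1..d. c i * Y z 0 ^ (i * k) * L z ^ (d - i))"
  proof (intro arg_cong2[where f = "(+)"] sum.cong refl)
    show "?W ^ d * Y z 1 ^ (d * k) = L z ^ d"
      using assms by (simp add: power_divide mult.commute[of d] flip: power_mult)
    fix i assume "i \<in> {1..d}"
    then have "Y z 1 ^ (i * k) * Y z 1 ^ ((d - i) * k) = Y z 1 ^ (d * k)"
      by (simp only: power_index flip: power_add)
    moreover have "(Y z 0 / Y z 1) ^ (i * k) * Y z 1 ^ (i * k) = Y z 0 ^ (i * k)"
      using assms by (simp flip: power_mult_distrib)
    moreover have "?W ^ (d - i) * Y z 1 ^ ((d - i) * k) = L z ^ (d - i)"
      using assms by (simp add: power_divide mult.commute[of "d - i"] flip: power_mult)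
    ultimately show "(c i * (Y z 0 / Y z 1) ^ (i * k)) * ?W ^ (d - i) * Y z 1 ^ (d * k) =
        c i * Y z 0 ^ (i * k) * L z ^ (d - i)"
      by (metis mult.assoc mult.left_commute)
  qed
  also have "\<dots> = 1 * Y z 1 ^ (d * k)"
    using equation[of z] by simp
  finally show ?thesis
    using assms by simp
qed

lemma nonzero: "Y z 0 \<noteq> 0 \<or> Y z 1 \<noteq> 0"
  using wcurve_nonzero[OF curve, of z] by (auto simp: le_Suc_eq)

text \<open>Near a point where \<open>V\<close> is bounded, Cauchy's estimate applies to \<open>V\<close> and \<open>u\<close>; elsewhere it
  applies to the coordinates \<open>1/V\<close> and \<open>u/V\<^sup>k\<close> at infinity.\<close>

lemma derivative_bounds:
  obtains K1 where "K1 \<ge> 1"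
    "\<And>z. z \<in> \<Omega> \<Longrightarrow> norm (V z) \<le> C \<Longrightarrow> norm (u z) \<le> K1 \<and> norm (deriv u z) \<le> K1 \<and> norm (deriv V z) \<le> K1"
    "\<And>z. z \<in> \<Omega> \<Longrightarrow> norm (V z) > C \<Longrightarrow> norm (u z) \<le> K1 * norm (V z) ^ k \<and> norm (deriv u z) \<le> K1 * norm (V z) ^ (k + 1)"
proof -
  define K0 where "K0 = 16 * K + 16 * real k * K * K"
  \<comment> \<open>The extra factor absorbs the powers of \<open>V\<close> at points where
    \<open>norm (V z) \<le> C\<close> but the estimate has to be taken from the chart at
    infinity.\<close>
  define K1 where "K1 = K0 * C ^ (k + 2)"
  have K0: "16 * K \<le> K0" "0 \<le> K0"
    using K by (simp_all add: K0_def)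
  have Cpow: "1 \<le> C ^ m" for m
    using C by simp
  have K1: "K0 \<le> K1"
    using mult_left_mono[OF Cpow K0(2), of "k + 2"] by (simp add: K1_def)
  have A: "norm (u z) \<le> K \<and> norm (V z) \<le> C \<and> norm (deriv u z) \<le> 16 * K \<and> norm (deriv V z) \<le> 16 * K"
    if small: "\<forall>w\<in>ball z (1/8). norm (Y w 1) \<le> C * norm (Y w 0)" for z
  proof -
    have nz: "Y w 0 \<noteq> 0" if "w \<in> ball z (1/8)" for w
      using nonzero[of w] small that by force
    then have in_\<Omega>: "w \<in> \<Omega>" if "w \<in> ball z (1/8)" for w
      using that by (simp add: \<Omega>_def)
    have holV: "V holomorphic_on ball z (1/8)"
      unfolding V_def[abs_def] by (rule wcurve_ratio_holomorphic(1)[OF curve _ nz open_ball]) simp_all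
    have holu: "u holomorphic_on ball z (1/8)"
      unfolding u_def[abs_def] by (rule wcurve_ratio_holomorphic(2)[OF curve _ nz open_ball]) simp_all
    have bV: "norm (V w) \<le> C" if "w \<in> ball z (1/8)" for w
      using small that nz[OF that] by (simp add: V_def norm_divide divide_le_eq)
    have bu: "norm (u w) \<le> K" if "w \<in> ball z (1/8)" for w
    proof -
      have "norm (u w) \<le> 1 + (\<Sum>i=1..d. norm (c i)) + C ^ (d * k)"
        by (rule monic_root_bound[OF affine_equation[OF in_\<Omega>[OF that]] d order_refl])
          (use bV[OF that] in \<open>simp add: norm_power power_mono\<close>)
      then show ?thesis using K(4) by linarith
    qed
    have "norm (V w) \<le> K" if "w \<in> ball z (1/8)" for w
      using bV[OF that] K(1) by linarith
    then show ?thesis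
      using Cauchy_deriv_bound[OF holV] Cauchy_deriv_bound[OF holu bu] bu[of z] bV[of z] by simp
  qed
  have B: "norm (u z) \<le> K * norm (V z) ^ k \<and> norm (deriv V z) \<le> 16 * K * norm (V z) ^ 2 \<and>
      norm (deriv u z) \<le> 16 * K * norm (V z) ^ k + 16 * real k * K * K * norm (V z) ^ (k + 1)"
    if large: "\<forall>w\<in>ball z (1/8). norm (Y w 0) \<le> C * norm (Y w 1)" and z: "z \<in> \<Omega>" for z
  proof -
    define T where "T w = Y w 0 / Y w 1" for w
    define W where "W w = L w / Y w 1 ^ k" for w
    have nz: "Y w 1 \<noteq> 0" if "w \<in> ball z (1/8)" for w
      using nonzero[of w] large that by force
    have holT: "T holomorphic_on ball z (1/8)"
      unfolding T_def[abs_def] by (rule wcurve_ratio_holomorphic(1)[OF curve _ nz open_ball]) simp_all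
    have holW: "W holomorphic_on ball z (1/8)"
      unfolding W_def[abs_def] by (rule wcurve_ratio_holomorphic(2)[OF curve _ nz open_ball]) simp_all
    have bT: "norm (T w) \<le> C" if "w \<in> ball z (1/8)" for w
      using large that nz[OF that] by (simp add: T_def norm_divide divide_le_eq)
    have bW: "norm (W w) \<le> K" if w: "w \<in> ball z (1/8)" for w
    proof -
      have sum: "(\<Sum>i=1..d. norm (c i * T w ^ (i * k))) \<le> (\<Sum>i=1..d. norm (c i)) * C ^ (d * k)"
        unfolding sum_distrib_right
      proof (rule sum_mono)
        fix i assume i: "i \<in> {1..d}"
        have "norm (T w) ^ (i * k) \<le> C ^ (i * k)"
          using bT[OF w] by (simp add: power_mono)
        also have "\<dots> \<le> C ^ (d * k)"
          using C power_index(2)[OF i] by (rule power_increasing[rotated])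
        finally show "norm (c i * T w ^ (i * k)) \<le> norm (c i) * C ^ (d * k)"
          by (simp add: norm_mult norm_power mult_left_mono)
      qed
      have "W w ^ d + (\<Sum>i=1..d. (c i * T w ^ (i * k)) * W w ^ (d - i)) = 1"
        using infinity_equation[OF nz[OF w]] by (simp add: T_def W_def)
      then have "norm (W w) \<le> 1 + (\<Sum>i=1..d. norm (c i)) * C ^ (d * k) + 1"
        by (rule monic_root_bound[OF _ d sum]) simp
      then show ?thesis using K(3) by linarith
    qed
    have bT': "norm (deriv T z) \<le> 16 * K"
      using bT K(1) by (intro Cauchy_deriv_bound[OF holT]) force
    have bW': "norm (deriv W z) \<le> 16 * K"
      using bW by (intro Cauchy_deriv_bound[OF holW])
    have zb: "z \<in> ball z (1/8)" by simp
    have T0: "T z \<noteq> 0"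
      using z nz[OF zb] by (simp add: T_def \<Omega>_def)
    have dT: "(T has_field_derivative deriv T z) (at z)" and dW: "(W has_field_derivative deriv W z) (at z)"
      using holT holW zb by (auto intro: holomorphic_derivI)
    have V_eq: "V w = 1 / T w" for w
      by (simp add: V_def T_def)
    have "((\<lambda>w. 1 / T w) has_field_derivative - deriv T z * V z ^ 2) (at z)"
      using T0 by (auto intro!: derivative_eq_intros dT simp: V_eq power2_eq_square divide_simps)
    then have dV: "(V has_field_derivative - deriv T z * V z ^ 2) (at z)"
      by (simp add: V_eq[abs_def])
    \<comment> \<open>In terms of the bounded coordinates \<open>T = 1 / V\<close> and
      \<open>W\<close> at infinity, the product rule for \<open>W * V ^ k\<close> with
      \<open>V' = - T' V\<^sup>2\<close> produces the growth exponent \<open>k + 1\<close>.\<close>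
    have u_eq: "u w = W w * V w ^ k" if "w \<in> ball z (1/8)" for w
      using nz[OF that] by (simp add: u_def W_def V_def power_divide)
    have "((\<lambda>w. W w * V w ^ k) has_field_derivative
        deriv W z * V z ^ k + W z * (of_nat k * (- deriv T z * V z ^ 2) * V z ^ (k - 1))) (at z)"
      by (auto intro!: derivative_eq_intros dV dW)
    then have du: "(u has_field_derivative
        deriv W z * V z ^ k + W z * (of_nat k * (- deriv T z * V z ^ 2) * V z ^ (k - 1))) (at z)"
      by (rule has_field_derivative_transform_within_open[OF _ open_ball zb]) (simp add: u_eq)
    have Vpow: "V z ^ 2 * V z ^ (k - 1) = V z ^ (k + 1)"
      using k by (simp flip: power_add)
    have "norm (deriv u z) \<le> norm (deriv W z * V z ^ k) + norm (W z * (of_nat k * (- deriv T z * V z ^ 2) * V z ^ (k - 1)))"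
      unfolding DERIV_imp_deriv[OF du] by (rule norm_triangle_ineq)
    also have "norm (W z * (of_nat k * (- deriv T z * V z ^ 2) * V z ^ (k - 1))) =
        norm (W z) * (real k * norm (deriv T z)) * norm (V z) ^ (k + 1)"
      using Vpow by (metis (no_types, lifting) mult.assoc norm_minus_cancel norm_mult norm_of_nat norm_power)
    also have "norm (deriv W z * V z ^ k) + \<dots> \<le>
        16 * K * norm (V z) ^ k + K * (real k * (16 * K)) * norm (V z) ^ (k + 1)"
      unfolding norm_mult norm_power
      by (intro add_mono mult_mono bW' bT' bW[OF zb] mult_nonneg_nonneg) (use K(2) in auto)
    finally have "norm (deriv u z) \<le> 16 * K * norm (V z) ^ k + 16 * real k * K * K * norm (V z) ^ (k + 1)"
      by (simp add: mult_ac)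
    moreover have "norm (u z) \<le> K * norm (V z) ^ k"
      unfolding u_eq[OF zb] norm_mult norm_power by (intro mult_right_mono bW zb) simp
    moreover have "norm (deriv V z) \<le> 16 * K * norm (V z) ^ 2"
      unfolding DERIV_imp_deriv[OF dV] norm_mult norm_power norm_minus_cancel
      by (intro mult_right_mono bT') simp
    ultimately show ?thesis by blast
  qed
  show thesis
  proof (rule that[of K1])
    show "1 \<le> K1"
      using K1 K0(1) K(2) by linarith
    fix z assume z: "z \<in> \<Omega>"
    show "norm (u z) \<le> K1 \<and> norm (deriv u z) \<le> K1 \<and> norm (deriv V z) \<le> K1" if V: "norm (V z) \<le> C"
      using dom[of z]
    proof
      assume "\<forall>w\<in>ball z (1/8). norm (Y w 1) \<le> C * norm (Y w 0)"
      from A[OF this] show ?thesis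
        using K1 K0 K(2) by linarith
    next
      assume "\<forall>w\<in>ball z (1/8). norm (Y w 0) \<le> C * norm (Y w 1)"
      note B' = B[OF this z]
      have pow: "norm (V z) ^ m \<le> C ^ (k + 2)" if "m \<le> k + 2" for m
        using power_mono[OF V, of m] power_increasing[OF that C] by simp
      have "K * norm (V z) ^ k \<le> K * C ^ (k + 2)" "16 * K * norm (V z) ^ 2 \<le> 16 * K * C ^ (k + 2)"
        "16 * K * norm (V z) ^ k \<le> 16 * K * C ^ (k + 2)"
        "16 * real k * K * K * norm (V z) ^ (k + 1) \<le> 16 * real k * K * K * C ^ (k + 2)"
        by (intro mult_left_mono pow; use K(2) in simp)+
      with B' have "norm (u z) \<le> K * C ^ (k + 2)" "norm (deriv V z) \<le> 16 * K * C ^ (k + 2)"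
        "norm (deriv u z) \<le> 16 * K * C ^ (k + 2) + 16 * real k * K * K * C ^ (k + 2)"
        by linarith+
      moreover have "K * C ^ (k + 2) \<le> K1" "16 * K * C ^ (k + 2) \<le> K1"
        unfolding K1_def by (rule mult_right_mono; use K0 K(2) C in simp)+
      moreover have "16 * K * C ^ (k + 2) + 16 * real k * K * K * C ^ (k + 2) = K1"
        by (simp add: K1_def K0_def distrib_right)
      ultimately show ?thesis by linarith
    qed
    show "norm (u z) \<le> K1 * norm (V z) ^ k \<and> norm (deriv u z) \<le> K1 * norm (V z) ^ (k + 1)" if V: "norm (V z) > C"
    proof -
      \<comment> \<open>In the other case of \<open>dom\<close>, estimate \<open>A\<close> would
        give \<open>norm (V z) \<le> C\<close>.\<close>
      have "\<forall>w\<in>ball z (1/8). norm (Y w 0) \<le> C * norm (Y w 1)"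
        using dom[of z] A[of z] V by force
      note B' = B[OF this z]
      have V1: "1 \<le> norm (V z)"
        using V C by linarith
      have "norm (u z) \<le> K1 * norm (V z) ^ k"
        using B' mult_right_mono[of K K1 "norm (V z) ^ k"] K1 K0(1) K(2) by force
      moreover have "norm (deriv u z) \<le> K0 * norm (V z) ^ (k + 1)"
      proof -
        have "16 * K * norm (V z) ^ k \<le> 16 * K * norm (V z) ^ (k + 1)"
          using V1 K(2) by (intro mult_left_mono power_increasing) auto
        then show ?thesis
          using B' by (simp add: K0_def distrib_right)
      qed
      moreover have "K0 * norm (V z) ^ (k + 1) \<le> K1 * norm (V z) ^ (k + 1)"
        using K1 by (intro mult_right_mono) auto
      ultimately show ?thesis by linarith
    qed
  qed
qed

lemma local_lift: "\<exists>U g. open U \<and> z \<in> U \<and> (\<forall>w\<in>U. g w \<noteq> 0) \<and>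
    (\<lambda>w. g w * (\<alpha> * Y w 0 + \<beta> * Y w 1)) holomorphic_on U"
proof -
  obtain U g where U: "open U" "z \<in> U" "\<And>w. w \<in> U \<Longrightarrow> g w \<noteq> 0"
    and hol: "\<And>i. i \<le> 1 \<Longrightarrow> (\<lambda>w. g w * Y w i) holomorphic_on U"
    by (rule wcurveE[OF curve, of z]) (rule that)
  have "(\<lambda>w. \<alpha> * (g w * Y w 0) + \<beta> * (g w * Y w 1)) holomorphic_on U"
    by (intro holomorphic_on_add holomorphic_on_mult holomorphic_on_const hol) simp_all
  also have "(\<lambda>w. \<alpha> * (g w * Y w 0) + \<beta> * (g w * Y w 1)) = (\<lambda>w. g w * (\<alpha> * Y w 0 + \<beta> * Y w 1))"
    by (simp add: fun_eq_iff algebra_simps)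
  finally show ?thesis
    using U by (intro exI[of _ U] exI[of _ g]) simp
qed

text \<open>With \<open>p = R D\<close> for the product \<open>R\<close> of the distinct linear factors of \<open>p\<close>, the function \<open>h\<close> is the
  pullback of the differential \<open>V du / R(u)\<close>, which is regular on the curve \<open>V\<^sup>d\<^sup>k = p(u)\<close>; so is \<open>u\<close>
  times it, because \<open>R\<close> has large degree. The Bezout form of \<open>h\<close> avoids dividing by \<open>R(u)\<close>.\<close>

theorem not_nonconstant: "\<not> nonconstant 1 Y"
proof
  assume nc: "nonconstant 1 Y"
  \<comment> \<open>A nonconstant curve satisfies no linear relation. This is used twice: for
    \<open>Y z 0\<close>, to make the poles of \<open>V\<close> isolated, and for
    \<open>Y z 1 - V z1 * Y z 0\<close> in the final contradiction.\<close>
  have nontriv: "\<exists>z. \<alpha> * Y z 0 + \<beta> * Y z 1 \<noteq> 0" if "\<alpha> \<noteq> 0 \<or> \<beta> \<noteq> 0" for \<alpha> \<beta>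
  proof (rule ccontr)
    assume "\<not> ?thesis"
    then have zero: "\<alpha> * Y z 0 = - \<beta> * Y z 1" for z
      by (simp add: add_eq_0_iff)
    have "Y z 0 * Y w 1 = Y z 1 * Y w 0" for z w
    proof (cases "\<alpha> = 0")
      case True
      then show ?thesis using zero[of z] zero[of w] that by simp
    next
      case False
      have "\<alpha> * (Y z 0 * Y w 1) = (\<alpha> * Y z 0) * Y w 1"
        by simp
      also have "\<dots> = Y z 1 * (\<alpha> * Y w 0)"
        unfolding zero by simp
      finally have "\<alpha> * (Y z 0 * Y w 1) = \<alpha> * (Y z 1 * Y w 0)"
        by simp
      then show ?thesis using False by simp
    qed
    then have "Y z i * Y w j = Y z j * Y w i" if "i \<le> 1" "j \<le> 1" for z w i j
      using that by (auto simp: le_Suc_eq mult.commute)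
    then show False
      using nc unfolding nonconstant_def by blast
  qed
  have "\<exists>z. 1 * Y z 0 + 0 * Y z 1 \<noteq> 0"
    by (rule nontriv) simp
  then obtain z0 where z0: "1 * Y z0 0 + 0 * Y z0 1 \<noteq> 0"
    by (elim exE)
  have isolated: "\<exists>r>0. \<forall>w\<in>ball z r - {z}. 1 * Y w 0 + 0 * Y w 1 \<noteq> 0" for z
    by (rule nowhere_zero_off_discrete[OF local_lift z0])
  have discrete: "\<exists>r>0. ball z r - {z} \<subseteq> \<Omega>" for z
    using isolated[of z] by (auto simp: \<Omega>_def)
  have "open \<Omega>"
  proof (unfold open_contains_ball, rule ballI)
    fix z assume z: "z \<in> \<Omega>"
    obtain r where r: "r > 0" "ball z r - {z} \<subseteq> \<Omega>"
      using discrete by blast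
    then have "ball z r \<subseteq> \<Omega>"
      using z by blast
    then show "\<exists>e>0. ball z e \<subseteq> \<Omega>"
      using r(1) by blast
  qed
  have Y0: "Y z 0 \<noteq> 0" if "z \<in> \<Omega>" for z
    using that by (simp add: \<Omega>_def)
  have holV: "V holomorphic_on \<Omega>"
    unfolding V_def[abs_def] by (rule wcurve_ratio_holomorphic(1)[OF curve _ Y0 \<open>open \<Omega>\<close>]) simp_all
  have holu: "u holomorphic_on \<Omega>"
    unfolding u_def[abs_def] by (rule wcurve_ratio_holomorphic(2)[OF curve _ Y0 \<open>open \<Omega>\<close>]) simp_all
  note dV = holomorphic_derivI[OF holV \<open>open \<Omega>\<close>]
  note du = holomorphic_derivI[OF holu \<open>open \<Omega>\<close>]
  let ?p = "monic_poly d c"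
  obtain R D Q a b where RD: "?p = R * D" and QD: "pderiv ?p = Q * D" and "D \<noteq> 0"
    and bezout: "a * R + b * Q = 1" and card: "card {u. poly ?p u = 0} \<le> degree R"
    and deg: "degree ?p = degree R + degree D"
    by (rule squarefree_decomposition[of ?p]) (use d in \<open>simp add: degree_monic_poly\<close>)
  have diff: "of_nat (d * k) * V z ^ (d * k - 1) * deriv V z = poly (pderiv ?p) (u z) * deriv u z" if z: "z \<in> \<Omega>" for z
  proof -
    have "((\<lambda>w. V w ^ (d * k)) has_field_derivative of_nat (d * k) * V z ^ (d * k - 1) * deriv V z) (at z)"
      by (auto intro!: derivative_eq_intros dV z)
    moreover have "((\<lambda>w. poly ?p (u w)) has_field_derivative poly (pderiv ?p) (u z) * deriv u z) (at z)"
      using DERIV_chain2[OF poly_DERIV du[OF z]] .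
    then have "((\<lambda>w. V w ^ (d * k)) has_field_derivative poly (pderiv ?p) (u z) * deriv u z) (at z)"
      by (rule has_field_derivative_transform_within_open[OF _ \<open>open \<Omega>\<close> z]) (simp add: poly_u)
    ultimately show ?thesis
      by (rule DERIV_unique)
  qed
  define h where "h z = poly a (u z) * V z * deriv u z + of_nat (d * k) * poly b (u z) * deriv V z" for z
  \<comment> \<open>Differentiating \<open>p(u) = V ^ (d * k)\<close> and cancelling
    \<open>D(u)\<close> gives \<open>d * k * R(u) * V' = V * Q(u) * u'\<close>. Inserting this into
    \<open>h * R(u)\<close> leaves the Bezout combination \<open>a * R + b * Q = 1\<close>.\<close>
  have h_eq: "h z * poly R (u z) = V z * deriv u z" if z: "z \<in> \<Omega>" and nz: "V z \<noteq> 0" for z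
  proof -
    have p: "poly R (u z) * poly D (u z) = V z ^ (d * k)"
      using poly_u[OF z] by (simp add: RD)
    then have D: "poly D (u z) \<noteq> 0"
      using nz by auto
    have "V z ^ (d * k - 1) * V z = V z ^ (d * k)"
      using d k by (metis One_nat_def Suc_pred' mult.commute mult_pos_pos less_eq_Suc_le power_Suc)
    then have "poly D (u z) * (of_nat (d * k) * poly R (u z) * deriv V z) =
        of_nat (d * k) * V z ^ (d * k - 1) * deriv V z * V z"
      using p by (metis mult.assoc mult.commute)
    also have "\<dots> = poly D (u z) * (V z * poly Q (u z) * deriv u z)"
      unfolding diff[OF z] QD by simp
    finally have 1: "of_nat (d * k) * poly R (u z) * deriv V z = V z * poly Q (u z) * deriv u z"
      using D by (metis mult_left_cancel)
    have "h z * poly R (u z) = poly a (u z) * poly R (u z) * V z * deriv u z +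
        poly b (u z) * (of_nat (d * k) * poly R (u z) * deriv V z)"
      by (simp add: h_def algebra_simps)
    also have "\<dots> = poly (a * R + b * Q) (u z) * V z * deriv u z"
      unfolding 1 by (simp add: algebra_simps)
    finally show ?thesis
      by (simp add: bezout)
  qed
  have holp: "(\<lambda>z. poly q (u z)) holomorphic_on \<Omega>" for q
    using holu by (induction q) (auto intro!: holomorphic_intros)
  have holh: "h holomorphic_on \<Omega>"
    unfolding h_def[abs_def]
    by (intro holomorphic_on_add holomorphic_on_mult holp holV holomorphic_deriv holu \<open>open \<Omega>\<close> holomorphic_on_const)
  obtain K1 where K1: "K1 \<ge> 1"
    and small: "\<And>z. z \<in> \<Omega> \<Longrightarrow> norm (V z) \<le> C \<Longrightarrow> norm (u z) \<le> K1 \<and> norm (deriv u z) \<le> K1 \<and> norm (deriv V z) \<le> K1"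
    and large: "\<And>z. z \<in> \<Omega> \<Longrightarrow> norm (V z) > C \<Longrightarrow> norm (u z) \<le> K1 * norm (V z) ^ k \<and> norm (deriv u z) \<le> K1 * norm (V z) ^ (k + 1)"
    by (rule derivative_bounds) (rule that)
  obtain Ba where Ba: "Ba \<ge> 0" "\<And>x t. norm x \<le> t \<Longrightarrow> 1 \<le> t \<Longrightarrow> norm (poly a x) \<le> Ba * t ^ degree a"
    by (rule poly_growth[of a]) (rule that)
  obtain Bb where Bb: "Bb \<ge> 0" "\<And>x t. norm x \<le> t \<Longrightarrow> 1 \<le> t \<Longrightarrow> norm (poly b x) \<le> Bb * t ^ degree b"
    by (rule poly_growth[of b]) (rule that)
  obtain B where B: "B \<ge> 0" "\<And>x t. norm x \<le> t \<Longrightarrow> 1 \<le> t \<Longrightarrow> norm (poly D x) \<le> B * t ^ degree D"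
    by (rule poly_growth[of D]) (rule that)
  define K2 where "K2 = Ba * K1 ^ degree a * C * K1 + real (d * k) * (Bb * K1 ^ degree b) * K1"
  define K3 where "K3 = K1 * (B * K1 ^ degree D)"
  have h_small: "norm (h z) \<le> K2" if z: "z \<in> \<Omega>" "norm (V z) \<le> C" for z
  proof -
    note s = small[OF z]
    have "norm (h z) \<le> norm (poly a (u z)) * norm (V z) * norm (deriv u z) +
        real (d * k) * norm (poly b (u z)) * norm (deriv V z)"
      unfolding h_def by (rule norm_triangle_le) (simp add: norm_mult)
    also have "\<dots> \<le> K2"
      unfolding K2_def
      by (intro add_mono mult_mono Ba Bb mult_nonneg_nonneg) (use s z K1 C Ba(1) Bb(1) in auto)
    finally show ?thesis .
  qed
  \<comment> \<open>The summand \<open>k + 2\<close> is the growth of \<open>V\<close> times the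
    derivative of \<open>u\<close>, the next \<open>k\<close> that of an additional factor
    \<open>u\<close>, and \<open>k * degree D\<close> that of \<open>D(u)\<close>. The exponent
    \<open>d * k\<close> comes from \<open>p(u) = R(u) * D(u)\<close>.\<close>
  have exp: "k + 2 + k + k * degree D \<le> d * k"
  proof -
    have "2 * k + 2 \<le> k * degree R"
      using roots card by (meson le_trans mult_le_mono2)
    moreover have "d * k = k * degree R + k * degree D"
      using deg by (simp add: degree_monic_poly algebra_simps)
    ultimately show ?thesis by simp
  qed
  have h_large: "norm (h z) * norm (V z) ^ k \<le> K3" if z: "z \<in> \<Omega>" "norm (V z) > C" for z
  proof -
    let ?v = "norm (V z)"
    have v: "1 \<le> ?v"
      using z C by linarith
    then have nz: "V z \<noteq> 0"
      by auto
    note l = large[OF z]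
    have t: "1 \<le> K1 * ?v ^ k"
      using mult_mono[OF K1 one_le_power[OF v, of k]] K1 by simp
    have "h z * V z ^ (d * k) = V z * deriv u z * poly D (u z)"
    proof -
      have "V z ^ (d * k) = poly R (u z) * poly D (u z)"
        using poly_u[OF z(1)] by (simp add: RD)
      then have "h z * V z ^ (d * k) = (h z * poly R (u z)) * poly D (u z)"
        by (simp add: mult.assoc)
      then show ?thesis
        by (simp only: h_eq[OF z(1) nz])
    qed
    then have "norm (h z) * ?v ^ (d * k) = ?v * norm (deriv u z) * norm (poly D (u z))"
      by (metis norm_mult norm_power)
    also have "\<dots> \<le> ?v * (K1 * ?v ^ (k + 1)) * (B * (K1 * ?v ^ k) ^ degree D)"
      using l t K1 by (intro mult_mono B(2) mult_nonneg_nonneg) auto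
    also have "\<dots> = K3 * ?v ^ (k + 2 + k * degree D)"
      by (simp add: K3_def power_mult_distrib power_add power_mult algebra_simps power2_eq_square)
    finally have 1: "norm (h z) * ?v ^ (d * k) \<le> K3 * ?v ^ (k + 2 + k * degree D)" .
    have "K3 \<ge> 0"
      using K1 B(1) by (simp add: K3_def)
    have "norm (h z) * ?v ^ k * ?v ^ (k + 2 + k * degree D) = norm (h z) * ?v ^ (k + 2 + k + k * degree D)"
      by (simp add: power_add algebra_simps)
    also have "\<dots> \<le> norm (h z) * ?v ^ (d * k)"
      using exp v by (intro mult_left_mono power_increasing) auto
    also note 1
    finally show ?thesis
      by (rule mult_right_le_imp_le) (intro zero_less_power, use v in linarith)
  qed
  have h_bound: "norm (h z) \<le> K2 + K3" and uh_bound: "norm (u z * h z) \<le> K1 * K2 + K1 * K3" if z: "z \<in> \<Omega>" for z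
  proof -
    have K0: "0 \<le> K2" "0 \<le> K3"
      using K1 Ba(1) Bb(1) B(1) C by (simp_all add: K2_def K3_def)
    have "norm (h z) \<le> K2 + K3 \<and> norm (u z) * norm (h z) \<le> K1 * K2 + K1 * K3"
    proof (cases "norm (V z) \<le> C")
      case True
      have "norm (u z) * norm (h z) \<le> K1 * K2"
        using small[OF z True] h_small[OF z True] K1 by (intro mult_mono) auto
      moreover have "0 \<le> K1 * K3"
        using K1 K0 by simp
      ultimately show ?thesis
        using h_small[OF z True] K0 by linarith
    next
      case False
      then have v: "norm (V z) > C" by simp
      have "norm (h z) * 1 \<le> norm (h z) * norm (V z) ^ k"
        using v C by (intro mult_left_mono one_le_power) auto
      then have "norm (h z) \<le> K3"
        using h_large[OF z v] by linarith
      moreover have "norm (u z) * norm (h z) \<le> K1 * norm (V z) ^ k * norm (h z)"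
        using large[OF z v] by (intro mult_right_mono) auto
      then have "norm (u z) * norm (h z) \<le> K1 * (norm (h z) * norm (V z) ^ k)"
        by (simp add: mult_ac)
      then have "norm (u z) * norm (h z) \<le> K1 * K3"
        by (rule order_trans) (intro mult_left_mono h_large z v, use K1 in linarith)
      moreover have "0 \<le> K1 * K2"
        using K1 K0 by simp
      ultimately show ?thesis
        using K0 by linarith
    qed
    then show "norm (h z) \<le> K2 + K3" "norm (u z * h z) \<le> K1 * K2 + K1 * K3"
      by (simp_all add: norm_mult)
  qed
  obtain e where e: "\<forall>z\<in>\<Omega>. h z = e"
    using bounded_off_discrete_constant[OF discrete holh \<open>open \<Omega>\<close> h_bound] by blast
  obtain e' where e': "\<forall>z\<in>\<Omega>. u z * h z = e'"
    using bounded_off_discrete_constant[OF discrete holomorphic_on_mult[OF holu holh] \<open>open \<Omega>\<close> uh_bound] by blast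
  \<comment> \<open>Either the constant \<open>e\<close> is nonzero and \<open>u = e' / e\<close> is
    constant, or \<open>h = 0\<close> and the identity \<open>h_eq\<close> applies.\<close>
  have u': "V z * deriv u z = 0" if z: "z \<in> \<Omega>" for z
  proof (cases "e = 0 \<or> V z = 0")
    case True
    then show ?thesis
      using h_eq[OF z] e z by (cases "V z = 0") auto
  next
    case False
    then have "u w = e' / e" if "w \<in> \<Omega>" for w
      using e e' that by (metis nonzero_eq_divide_eq)
    then have "(u has_field_derivative 0) (at z)"
      by (intro has_field_derivative_transform_within_open[OF DERIV_const \<open>open \<Omega>\<close> z]) simp
    then show ?thesis
      by (simp add: DERIV_imp_deriv)
  qed
  have V': "deriv V z = 0" if z: "z \<in> \<Omega>" "V z \<noteq> 0" for z
    using diff[OF z(1)] u'[OF z(1)] z(2) d k by simp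
  obtain z1 where z1: "z1 \<in> \<Omega>"
    using z0 by (auto simp: \<Omega>_def)
  then obtain r where r: "r > 0" "ball z1 r \<subseteq> \<Omega>"
    using \<open>open \<Omega>\<close> open_contains_ball by blast
  \<comment> \<open>The square has derivative \<open>2 * V * V'\<close>, which also vanishes at
    zeros of \<open>V\<close>, where nothing is known about \<open>V'\<close>. Constancy of the
    square then shows whether \<open>V\<close> has zeros in the ball.\<close>
  have "V w ^ 2 = V z1 ^ 2" if w: "w \<in> ball z1 r" for w
  proof -
    have "\<exists>cst. \<forall>x\<in>ball z1 r. V x ^ 2 = cst"
    proof (rule has_field_derivative_zero_constant)
      fix x assume "x \<in> ball z1 r"
      then have x: "x \<in> \<Omega>" using r by blast
      have "((\<lambda>x. V x ^ 2) has_field_derivative 2 * V x * deriv V x) (at x)"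
        by (auto intro!: derivative_eq_intros dV x)
      moreover have "2 * V x * deriv V x = 0"
        using V'[OF x] by auto
      ultimately show "((\<lambda>x. V x ^ 2) has_field_derivative 0) (at x within ball z1 r)"
        by (metis has_field_derivative_at_within)
    qed simp
    then show ?thesis
      using w r(1) by (metis centre_in_ball)
  qed
  note sq = this
  have const: "V w = V z1" if w: "w \<in> ball z1 r" for w
  proof (cases "V z1 = 0")
    case True
    then show ?thesis using sq[OF w] by simp
  next
    case False
    have "\<exists>cst. \<forall>x\<in>ball z1 r. V x = cst"
    proof (rule has_field_derivative_zero_constant)
      fix x assume xb: "x \<in> ball z1 r"
      then have x: "x \<in> \<Omega>" using r by blast
      have "V x \<noteq> 0"
        using sq[OF xb] False by auto
      then show "(V has_field_derivative 0) (at x within ball z1 r)"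
        using dV[OF x] V'[OF x] by (metis has_field_derivative_at_within)
    qed simp
    then show ?thesis
      using w r(1) by (metis centre_in_ball)
  qed
  have "\<exists>z. - V z1 * Y z 0 + 1 * Y z 1 \<noteq> 0"
    by (rule nontriv) simp
  then obtain z2 where z2: "- V z1 * Y z2 0 + 1 * Y z2 1 \<noteq> 0"
    by (elim exE)
  obtain s where s: "s > 0" "\<forall>w\<in>ball z1 s - {z1}. - V z1 * Y w 0 + 1 * Y w 1 \<noteq> 0"
    using nowhere_zero_off_discrete[OF local_lift z2, of z1] by (elim exE conjE)
  \<comment> \<open>A point of the punctured ball around \<open>z1\<close> at which \<open>V\<close>
    has its constant value, while \<open>Y w 1 - V z1 * Y w 0\<close> must be nonzero.\<close>
  define w where "w = z1 + of_real (min r s / 2)"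
  have "dist z1 w = min r s / 2"
    using r(1) s(1) by (simp add: w_def dist_norm)
  then have w: "w \<in> ball z1 r" "w \<in> ball z1 s - {z1}"
    using r(1) s(1) by (auto simp: min_def split: if_splits)
  then have "w \<in> \<Omega>"
    using r(2) by blast
  then have "Y w 1 = V z1 * Y w 0"
    using const[OF w(1)] by (simp add: V_def \<Omega>_def field_simps)
  then show False
    using s(2) w(2) by force
qed

end

section \<open>Holomorphic curves and their lifts\<close>

lemma proj_class_self: "x \<in> proj_class x"
  unfolding proj_class_def by (rule CollectI, rule exI[of _ 1]) simp

lemma proj_class_eqI:
  assumes "c \<noteq> 0" "\<And>i. y i = c * x i"
  shows "proj_class y = proj_class x"
proof -
  have y: "y = (\<lambda>i. c * x i)"
    using assms(2) by (simp add: fun_eq_iff)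
  show ?thesis
  proof (intro equalityI subsetI)
    fix z assume "z \<in> proj_class y"
    then obtain e where "e \<noteq> 0" "z = (\<lambda>i. e * y i)"
      by (auto simp: proj_class_def)
    then show "z \<in> proj_class x"
      unfolding proj_class_def using assms(1) y by (intro CollectI exI[of _ "e * c"]) (auto simp: mult.assoc)
  next
    fix z assume "z \<in> proj_class x"
    then obtain e where "e \<noteq> 0" "z = (\<lambda>i. e * x i)"
      by (auto simp: proj_class_def)
    then show "z \<in> proj_class y"
      unfolding proj_class_def using assms(1) y by (intro CollectI exI[of _ "e / c"]) auto
  qed
qed

lemma proj_class_memD:
  assumes "y \<in> proj_class x"
  shows "proj_class y = proj_class x"
proof -
  obtain c where "c \<noteq> 0" "y = (\<lambda>i. c * x i)"
    using assms by (auto simp: proj_class_def)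
  then show ?thesis
    by (intro proj_class_eqI[of c]) auto
qed

lemma proj_space_memD:
  assumes "p \<in> proj_space n" "x \<in> p"
  shows "x \<in> nonzero_vecs n" "p = proj_class x"
proof -
  obtain y where y: "y \<in> nonzero_vecs n" "p = proj_class y"
    using assms(1) by (auto simp: proj_space_def)
  then obtain c where "c \<noteq> 0" "x = (\<lambda>i. c * y i)"
    using assms(2) by (auto simp: proj_class_def)
  then show "x \<in> nonzero_vecs n"
    using y(1) by (auto simp: nonzero_vecs_def)
  show "p = proj_class x"
    using proj_class_memD assms(2) y(2) by simp
qed

lemma nonzero_vecs_ex: "x \<in> nonzero_vecs n \<Longrightarrow> \<exists>i\<le>n. x i \<noteq> 0"
  unfolding nonzero_vecs_def by (auto simp: not_less) (metis not_less)

lemma holo_curve_proj_space: "holo_curve n f \<Longrightarrow> f z \<in> proj_space n"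
  unfolding holo_curve_def chart_dom_def by blast

lemma mp_eval_holomorphic:
  assumes "mp_supported V p" "\<And>i. i \<in> V \<Longrightarrow> (\<lambda>w. x w i) holomorphic_on S"
  shows "(\<lambda>w. mp_eval (x w) p) holomorphic_on S"
  unfolding mp_eval_def
  by (intro holomorphic_on_sum holomorphic_on_mult holomorphic_on_const holomorphic_on_prod holomorphic_on_power)
    (use assms in \<open>auto simp: mp_supported_def\<close>)

lemma mp_eval_tendsto:
  assumes "mp_supported V p" "\<And>i. i \<in> V \<Longrightarrow> ((\<lambda>w. x w i) \<longlongrightarrow> y i) F"
  shows "((\<lambda>w. mp_eval (x w) p) \<longlongrightarrow> mp_eval y p) F"
  unfolding mp_eval_def
  by (intro tendsto_sum tendsto_mult tendsto_const tendsto_prod tendsto_power)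
    (use assms in \<open>auto simp: mp_supported_def\<close>)

lemma mp_eval_bounded:
  fixes p :: "'v mpoly"
  assumes "mp_supported V p"
  obtains B where "B \<ge> 0" "\<And>x. (\<And>i. i \<in> V \<Longrightarrow> norm (x i) \<le> 2) \<Longrightarrow> norm (mp_eval x p) \<le> B"
proof
  let ?B = "\<Sum>m\<in>keys p. norm (lookup p m) *
     (\<Prod>i\<in>keys m. 2 ^ lookup m i)"
  show "?B \<ge> 0"
    by (intro sum_nonneg mult_nonneg_nonneg prod_nonneg) auto
  fix x :: "'v \<Rightarrow> complex" assume x: "\<And>i. i \<in> V \<Longrightarrow> norm (x i) \<le> 2"
  show "norm (mp_eval x p) \<le> ?B"
    unfolding mp_eval_def
  proof (rule sum_norm_le)
    fix m assume m: "m \<in> keys p"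
    have "(\<Prod>i\<in>keys m. norm (x i) ^ lookup m i) \<le>
        (\<Prod>i\<in>keys m. 2 ^ lookup m i)"
      by (intro prod_mono conjI power_mono x) (use assms m in \<open>auto simp: mp_supported_def\<close>)
    then show "norm (lookup p m * (\<Prod>i\<in>keys m. x i ^ lookup m i)) \<le>
        norm (lookup p m) * (\<Prod>i\<in>keys m. 2 ^ lookup m i)"
      by (simp add: norm_mult norm_power mult_left_mono flip: prod_norm)
  qed
qed

text \<open>Chosen at each point with no continuity at all; the local factor in
  \<open>wcurve\<close> restores holomorphy.\<close>

definition representative :: "(complex \<Rightarrow> (nat \<Rightarrow> complex) set) \<Rightarrow> complex \<Rightarrow> nat \<Rightarrow> complex" where
  "representative f z = (SOME x. x \<in> f z)"

lemma representative:
  assumes "holo_curve n f"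
  shows "representative f z \<in> f z" "representative f z \<in> nonzero_vecs n" "f z = proj_class (representative f z)"
proof -
  obtain y where "f z = proj_class y"
    using holo_curve_proj_space[OF assms] by (auto simp: proj_space_def)
  then have "y \<in> f z"
    by (simp add: proj_class_self)
  then show 1: "representative f z \<in> f z"
    unfolding representative_def by (rule someI[of "\<lambda>x. x \<in> f z"])
  show "representative f z \<in> nonzero_vecs n" "f z = proj_class (representative f z)"
    using proj_space_memD[OF holo_curve_proj_space[OF assms] 1] by simp_all
qed

text \<open>The last coordinate is rescaled by \<open>s\<close>, the \<open>k\<close>-th root of the deformation parameter \<open>t\<close>.\<close>

lemma wcurve_of_holo_curve:
  fixes f defines "X \<equiv> representative f"
  assumes f: "holo_curve (n + 1) f" and sD: "sD \<in> homog {..n} k" and s: "s \<noteq> 0"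
  shows "wcurve (n + 1) k (\<lambda>z i. if i \<le> n then X z i else X z i / s) (\<lambda>z. mp_eval (X z) sD / t)"
  unfolding wcurve_def
proof (intro conjI allI)
  fix z
  show "\<exists>i\<le>n + 1. (if i \<le> n then X z i else X z i / s) \<noteq> 0"
    using nonzero_vecs_ex[OF representative(2)[OF f, of z]] s by (auto simp: X_def)
  obtain i U where iU: "i \<le> n + 1" "open U" "z \<in> U" "f ` U \<subseteq> chart_dom (n + 1) i"
    and hol: "\<forall>j\<le>n + 1. (\<lambda>w. affine_coord i (f w) j) holomorphic_on U"
    using f unfolding holo_curve_def by blast
  have Xi: "X w i \<noteq> 0" if "w \<in> U" for w
    using iU(4) that representative(1)[OF f, of w] unfolding chart_dom_def X_def by blast
  have coord: "affine_coord i (f w) j = 1 / X w i * X w j" for w j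
    using representative(3)[OF f, of w] affine_coord_proj_class[of i "X w" j] by (simp add: X_def)
  have hol': "(\<lambda>w. 1 / X w i * X w j) holomorphic_on U" if "j \<le> n + 1" for j
    using hol that by (simp add: coord)
  have "(\<lambda>w. 1 / X w i * (if j \<le> n then X w j else X w j / s)) holomorphic_on U" if "j \<le> n + 1" for j
  proof (cases "j \<le> n")
    case False
    have "(\<lambda>w. (1 / X w i * X w j) * (1 / s)) holomorphic_on U"
      by (intro holomorphic_on_mult hol' that holomorphic_on_const)
    then show ?thesis using False by simp
  qed (use hol'[OF that] in simp)
  moreover have "(\<lambda>w. (1 / X w i) ^ k * (mp_eval (X w) sD / t)) holomorphic_on U"
  proof -
    have "(\<lambda>w. mp_eval (\<lambda>j. 1 / X w i * X w j) sD * (1 / t)) holomorphic_on U"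
      by (intro holomorphic_on_mult holomorphic_on_const mp_eval_holomorphic[OF homog_supported[OF sD]] hol') simp
    then show ?thesis
      unfolding mp_eval_homog[OF sD] by simp
  qed
  \<comment> \<open>The factor \<open>1 / X w i\<close> turns homogeneous coordinates into the
    affine coordinates of chart \<open>i\<close>.\<close>
  ultimately show "\<exists>U g. open U \<and> z \<in> U \<and> (\<forall>w\<in>U. g w \<noteq> 0) \<and>
      (\<forall>j\<le>n + 1. (\<lambda>w. g w * (if j \<le> n then X w j else X w j / s)) holomorphic_on U) \<and>
      (\<lambda>w. g w ^ k * (mp_eval (X w) sD / t)) holomorphic_on U"
    using iU Xi by (intro exI[of _ U] exI[of _ "\<lambda>w. 1 / X w i"]) auto
qed

lemma nonconstant_representative:
  fixes f defines "X \<equiv> representative f"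
  assumes f: "holo_curve (n + 1) f" and nc: "\<not> (\<exists>p. \<forall>z. f z = p)" and s: "s \<noteq> 0"
  shows "nonconstant (n + 1) (\<lambda>z i. if i \<le> n then X z i else X z i / s)"
proof (rule ccontr)
  assume "\<not> ?thesis"
  then have eq: "(if i \<le> n then X z i else X z i / s) * (if j \<le> n then X w j else X w j / s) =
      (if j \<le> n then X z j else X z j / s) * (if i \<le> n then X w i else X w i / s)"
    if "i \<le> n + 1" "j \<le> n + 1" for z w i j
    using that unfolding nonconstant_def by blast
  have cross: "X z i * X w j = X z j * X w i" if "i \<le> n + 1" "j \<le> n + 1" for z w i j
    using eq[OF that, of z w] s by (cases "i \<le> n"; cases "j \<le> n") (simp_all add: field_simps)
  have "f z = f 0" for z
  proof -
    obtain j where j: "j \<le> n + 1" "X 0 j \<noteq> 0"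
      using nonzero_vecs_ex[OF representative(2)[OF f, of 0]] by (auto simp: X_def)
    obtain i where i: "i \<le> n + 1" "X z i \<noteq> 0"
      using nonzero_vecs_ex[OF representative(2)[OF f, of z]] by (auto simp: X_def)
    have beyond: "X w l = 0" if "l > n + 1" for w l
      using representative(2)[OF f, of w] that by (auto simp: X_def nonzero_vecs_def)
    have eq: "X z l = X z j / X 0 j * X 0 l" for l
      using cross[of l j z 0] j beyond[of l] by (cases "l \<le> n + 1") (auto simp: field_simps)
    have nz: "X z j / X 0 j \<noteq> 0"
    proof
      assume 0: "X z j / X 0 j = 0"
      have "X z i = 0"
        unfolding eq[of i] 0 by simp
      with i show False by simp
    qed
    show ?thesis
      unfolding representative(3)[OF f, of z] representative(3)[OF f, of 0] X_def[symmetric]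
      by (rule proj_class_eqI[OF nz eq])
  qed
  then show False
    using nc by blast
qed

text \<open>As long as all coordinates vanish at \<open>z\<close>, each is divided by
  \<open>w - z\<close>. This stops after at most \<open>N\<close> divisions, because the coordinate
  \<open>j\<close> vanishes only to order \<open>N\<close>.\<close>

lemma common_zero_factor:
  fixes a :: "nat \<Rightarrow> complex \<Rightarrow> complex"
  assumes "r > 0" "\<And>i. i \<le> n \<Longrightarrow> a i holomorphic_on ball z r" "j \<le> n"
    and "h holomorphic_on ball z r" "h z \<noteq> 0" "\<And>w. w \<in> ball z r - {z} \<Longrightarrow> a j w = (w - z) ^ N * h w"
  shows "\<exists>p b. (\<forall>i\<le>n. b i holomorphic_on ball z r) \<and> (\<exists>i\<le>n. b i z \<noteq> 0) \<and>
    (\<forall>i\<le>n. \<forall>w\<in>ball z r. a i w = (w - z) ^ p * b i w)"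
  using assms(2,6)
proof (induction N arbitrary: a)
  case 0
  \<comment> \<open>The factorisation is assumed only away from \<open>z\<close>; continuity gives
    it at \<open>z\<close>.\<close>
  have cont: "isCont (a j) z" "isCont h z"
    using 0(1)[OF assms(3)] assms(1,4) holomorphic_on_imp_continuous_on
    by (metis centre_in_ball continuous_on_eq_continuous_at open_ball)+
  have "eventually (\<lambda>w. h w = a j w) (at z)"
    unfolding eventually_at using assms(1) 0(2) by (intro exI[of _ r]) (auto simp: dist_commute)
  then have "a j \<midarrow>z\<rightarrow> h z"
    using cont(2) unfolding isCont_def by (rule Lim_transform_eventually[rotated])
  then have "a j z = h z"
    using cont(1) LIM_unique unfolding isCont_def by blast
  then show ?case
    using 0(1) assms(3,5) by (intro exI[of _ 0] exI[of _ a]) auto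
next
  case (Suc N)
  show ?case
  proof (cases "\<exists>i\<le>n. a i z \<noteq> 0")
    case True
    then show ?thesis
      using Suc.prems(1) by (intro exI[of _ 0] exI[of _ a]) auto
  next
    case False
    define a' where "a' i w = (if w = z then deriv (a i) z else (a i w - a i z) / (w - z))" for i w
    have hol: "a' i holomorphic_on ball z r" if "i \<le> n" for i
      unfolding a'_def[abs_def] using Suc.prems(1)[OF that] by (rule pole_lemma_open) simp
    have eq: "a i w = (w - z) * a' i w" if "i \<le> n" for i w
      using False that by (cases "w = z") (auto simp: a'_def)
    have "\<exists>p b. (\<forall>i\<le>n. b i holomorphic_on ball z r) \<and> (\<exists>i\<le>n. b i z \<noteq> 0) \<and>
        (\<forall>i\<le>n. \<forall>w\<in>ball z r. a' i w = (w - z) ^ p * b i w)"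
    proof (rule Suc.IH[OF hol])
      fix w assume w: "w \<in> ball z r - {z}"
      then have "(w - z) * a' j w = (w - z) * ((w - z) ^ N * h w)"
        using Suc.prems(2)[OF w] eq[OF assms(3), of w] by simp
      then show "a' j w = (w - z) ^ N * h w"
        using w by simp
    qed
    then obtain p b where "(\<forall>i\<le>n. b i holomorphic_on ball z r) \<and> (\<exists>i\<le>n. b i z \<noteq> 0) \<and>
        (\<forall>i\<le>n. \<forall>w\<in>ball z r. a' i w = (w - z) ^ p * b i w)"
      by (elim exE)
    then show ?thesis
      using eq by (intro exI[of _ "Suc p"] exI[of _ b]) auto
  qed
qed

text \<open>Homogeneous coordinates near \<open>z\<close> for the projection of the curve to its
  first \<open>n + 1\<close> coordinates, with the common zero at \<open>z\<close> removed, so that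
  they define the projected point at \<open>z\<close> as well.\<close>

definition reduced_lift :: "nat \<Rightarrow> nat \<Rightarrow> (complex \<Rightarrow> nat \<Rightarrow> complex) \<Rightarrow> complex \<Rightarrow> real \<Rightarrow> (nat \<Rightarrow> complex \<Rightarrow> complex) \<Rightarrow> bool" where
  "reduced_lift n j Z z r b \<longleftrightarrow> r > 0 \<and> (\<forall>i\<le>n. b i holomorphic_on ball z r) \<and> (\<exists>i\<le>n. b i z \<noteq> 0) \<and>
    (\<forall>w\<in>ball z r. (\<exists>i\<le>n. Z w i \<noteq> 0) \<longrightarrow> (\<exists>\<gamma>. \<gamma> \<noteq> 0 \<and> (\<forall>i\<le>n. b i w = \<gamma> * Z w i))) \<and>
    (\<forall>w\<in>ball z r - {z}. Z w j \<noteq> 0)"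

text \<open>Points where the first \<open>n + 1\<close> coordinates vanish together are isolated,
  because coordinate \<open>j\<close> is not identically zero. Dividing out the common power of
  \<open>w - z\<close> extends the projection across such a point.\<close>

lemma local_extension:
  assumes Z: "wcurve (n + 1) k Z \<Lambda>" and j: "j \<le> n" "Z z1 j \<noteq> 0"
  shows "\<exists>r b. reduced_lift n j Z z r b"
proof -
  have lift: "\<exists>U g. open U \<and> z \<in> U \<and> (\<forall>w\<in>U. g w \<noteq> 0) \<and> (\<lambda>w. g w * Z w j) holomorphic_on U" for z
    using Z j(1) unfolding wcurve_def by (meson le_add1 le_trans)
  obtain r0 where r0: "r0 > 0" "\<forall>w\<in>ball z r0 - {z}. Z w j \<noteq> 0"
    using nowhere_zero_off_discrete[of "\<lambda>w. Z w j", OF lift j(2)] by blast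
  obtain U g where U: "open U" "z \<in> U" "\<And>w. w \<in> U \<Longrightarrow> g w \<noteq> 0"
    and hol: "\<And>i. i \<le> n + 1 \<Longrightarrow> (\<lambda>w. g w * Z w i) holomorphic_on U"
    by (rule wcurveE[OF Z, of z]) (rule that)
  obtain r1 where r1: "r1 > 0" "ball z r1 \<subseteq> U"
    using U(1,2) open_contains_ball by blast
  define r2 where "r2 = min r0 r1"
  have r2: "r2 > 0" "ball z r2 \<subseteq> U" "\<And>w. w \<in> ball z r2 - {z} \<Longrightarrow> Z w j \<noteq> 0"
    using r0 r1 by (auto simp: r2_def)
  let ?a = "\<lambda>i w. g w * Z w i"
  have hola: "?a i holomorphic_on ball z r2" if "i \<le> n" for i
    by (rule holomorphic_on_subset[OF hol r2(2)]) (use that in simp)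
  obtain N h r where r: "0 < r" "r \<le> r2" "h holomorphic_on ball z r" "h z \<noteq> 0"
    "\<And>w. w \<in> ball z r \<Longrightarrow> ?a j w = (w - z) ^ N * h w"
  proof (cases "?a j z = 0")
    case False
    show thesis
      by (rule that[of r2 "?a j" 0]) (use False r2 hola[OF j(1)] in auto)
  next
    case True
    let ?x = "z + of_real (r2 / 2)"
    have x: "?x \<in> ball z r2 - {z}"
      using r2(1) by (auto simp: dist_norm)
    then have "?a j ?x \<noteq> 0"
      using r2 U(3) by auto
    then have "\<not> ?a j constant_on ball z r2"
      using True x r2(1) unfolding constant_on_def by (metis DiffD1 centre_in_ball)
    then obtain g' r m where *: "0 < m" "0 < r" "ball z r \<subseteq> ball z r2" "g' holomorphic_on ball z r"
      "\<And>w. w \<in> ball z r \<Longrightarrow> ?a j w = (w - z) ^ m * g' w" "\<And>w. w \<in> ball z r \<Longrightarrow> g' w \<noteq> 0"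
      by (rule holomorphic_factor_zero_nonconstant[OF hola[OF j(1)] open_ball connected_ball _ True, rotated])
        (use r2 in auto)
    show thesis
      by (rule that[of r g' m]) (use * in \<open>auto simp: ball_subset_ball_iff\<close>)
  qed
  have sub: "ball z r \<subseteq> ball z r2"
    using r(2) by auto
  have "\<exists>p b. (\<forall>i\<le>n. b i holomorphic_on ball z r) \<and> (\<exists>i\<le>n. b i z \<noteq> 0) \<and>
    (\<forall>i\<le>n. \<forall>w\<in>ball z r. ?a i w = (w - z) ^ p * b i w)"
    by (rule common_zero_factor[OF r(1) _ j(1) r(3,4)])
      (use r(5) holomorphic_on_subset[OF hola sub] in auto)
  then obtain p b where b': "(\<forall>i\<le>n. b i holomorphic_on ball z r) \<and> (\<exists>i\<le>n. b i z \<noteq> 0) \<and>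
    (\<forall>i\<le>n. \<forall>w\<in>ball z r. ?a i w = (w - z) ^ p * b i w)"
    by (elim exE)
  note b = b'[THEN conjunct1] b'[THEN conjunct2, THEN conjunct1] b'[THEN conjunct2, THEN conjunct2]
  have prop_Z: "\<exists>\<gamma>. \<gamma> \<noteq> 0 \<and> (\<forall>i\<le>n. b i w = \<gamma> * Z w i)"
    if w: "w \<in> ball z r" and nz: "\<exists>i\<le>n. Z w i \<noteq> 0" for w
  proof -
    have g: "g w \<noteq> 0"
      using w sub r2(2) U(3) by blast
    have "(w - z) ^ p \<noteq> 0"
    proof
      assume "(w - z) ^ p = 0"
      then have "?a i w = 0" if "i \<le> n" for i
        using b(3) w that by auto
      then show False
        using nz g by auto
    qed
    then show ?thesis
      using b(3) w g by (intro exI[of _ "g w / (w - z) ^ p"]) (auto simp: field_simps)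
  qed
  have "reduced_lift n j Z z r b"
    unfolding reduced_lift_def using r(1) b(1,2) prop_Z r2(3) sub by auto
  then show ?thesis
    by blast
qed

lemma proj_class_truncate_eq:
  assumes "\<gamma> \<noteq> 0" "\<And>i. i \<le> n \<Longrightarrow> b i = \<gamma> * x i"
  shows "proj_class (\<lambda>i. if i \<le> n then b i else 0) = proj_class (\<lambda>i. if i \<le> n then x i else 0)"
  by (rule proj_class_eqI[OF assms(1)]) (use assms(2) in auto)

text \<open>The curve \<open>Z\<close> lies on the cone over the zero locus of \<open>p\<close> and
  may pass through the vertex, where the projection has no value. Hyperbolicity of the base can only
  be applied after the projection has been extended; the filled-in points lie in the zero locus by
  continuity.\<close>

lemma extended_curve:
  assumes Z: "wcurve (n + 1) k Z \<Lambda>" and j: "j \<le> n" "Z z1 j \<noteq> 0"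
    and p: "p \<in> homog {..n} e" and zero: "\<And>w. mp_eval (Z w) p = 0"
  obtains f where "holo_curve n f" "\<And>z. f z \<in> zero_locus n p"
    "\<And>z. \<exists>i\<le>n. Z z i \<noteq> 0 \<Longrightarrow> f z = proj_class (\<lambda>i. if i \<le> n then Z z i else 0)"
proof -
  have "\<forall>z. \<exists>r b. reduced_lift n j Z z r b"
    using local_extension[OF Z j] by blast
  from choice[OF this] obtain r where "\<forall>z. \<exists>b. reduced_lift n j Z z (r z) b"
    by (elim exE)
  from choice[OF this] obtain b where b: "\<forall>z. reduced_lift n j Z z (r z) (b z)"
    by (elim exE)
  have r: "r z > 0" and hol: "\<And>i. i \<le> n \<Longrightarrow> b z i holomorphic_on ball z (r z)" and bz: "\<exists>i\<le>n. b z i z \<noteq> 0"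
    and prop_Z: "\<And>w. w \<in> ball z (r z) \<Longrightarrow> \<exists>i\<le>n. Z w i \<noteq> 0 \<Longrightarrow> \<exists>\<gamma>. \<gamma> \<noteq> 0 \<and> (\<forall>i\<le>n. b z i w = \<gamma> * Z w i)"
    and Znz: "\<And>w. w \<in> ball z (r z) - {z} \<Longrightarrow> Z w j \<noteq> 0" for z
    using b unfolding reduced_lift_def by auto
  let ?tr = "\<lambda>x i. if i \<le> n then x i else (0::complex)"
  define f where "f z = proj_class (?tr (\<lambda>i. b z i z))" for z
  have f_Z: "f z = proj_class (?tr (Z z))" if nz: "\<exists>i\<le>n. Z z i \<noteq> 0" for z
  proof -
    obtain \<gamma> where "\<gamma> \<noteq> 0" "\<forall>i\<le>n. b z i z = \<gamma> * Z z i"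
      using prop_Z[OF centre_in_ball[THEN iffD2, OF r[of z]] nz] by blast
    then show ?thesis
      unfolding f_def by (intro proj_class_truncate_eq) auto
  qed
  have f_b: "f w = proj_class (?tr (\<lambda>i. b z i w))" if w: "w \<in> ball z (r z)" for z w
  proof (cases "w = z")
    case False
    then have nz: "\<exists>i\<le>n. Z w i \<noteq> 0"
      using Znz[of w z] w j(1) by auto
    obtain \<gamma> where "\<gamma> \<noteq> 0" "\<forall>i\<le>n. b z i w = \<gamma> * Z w i"
      using prop_Z[OF w nz] by blast
    then have "proj_class (?tr (\<lambda>i. b z i w)) = proj_class (?tr (Z w))"
      by (intro proj_class_truncate_eq) auto
    then show ?thesis
      using f_Z[OF nz] by simp
  next
    case True
    then show ?thesis by (simp only: f_def)
  qed
  have curve: "holo_curve n f"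
    unfolding holo_curve_def
  proof
    fix z
    obtain l where l: "l \<le> n" "b z l z \<noteq> 0"
      using bz by blast
    have "isCont (b z l) z"
      using hol[OF l(1)] r[of z] holomorphic_on_imp_continuous_on
      by (metis centre_in_ball continuous_on_eq_continuous_at open_ball)
    then obtain \<delta> where \<delta>: "\<delta> > 0" "\<forall>w. dist z w < \<delta> \<longrightarrow> b z l w \<noteq> 0"
      using continuous_at_avoid[of z "b z l" 0] l(2) by blast
    let ?U = "ball z (min \<delta> (r z))"
    have U: "w \<in> ball z (r z)" "b z l w \<noteq> 0" if "w \<in> ?U" for w
      using that \<delta> by auto
    have "f w \<in> chart_dom n l" if w: "w \<in> ?U" for w
    proof -
      have "?tr (\<lambda>i. b z i w) \<in> nonzero_vecs n"
        using U(2)[OF w] l(1) by (auto simp: nonzero_vecs_def)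
      then show ?thesis
        unfolding chart_dom_def f_b[OF U(1)[OF w]] proj_space_def
        using U(2)[OF w] l(1) by (auto simp: proj_class_def)
    qed
    moreover have "(\<lambda>w. affine_coord l (f w) i) holomorphic_on ?U" if "i \<le> n" for i
    proof -
      have "(\<lambda>w. b z i w / b z l w) holomorphic_on ?U"
        by (intro holomorphic_on_divide holomorphic_on_subset[OF hol] that l(1) U(2)) auto
      then show ?thesis
        by (rule holomorphic_transform) (use that l(1) f_b[OF U(1)] in \<open>simp add: affine_coord_proj_class\<close>)
    qed
    ultimately show "\<exists>i\<le>n. \<exists>U. open U \<and> z \<in> U \<and> f ` U \<subseteq> chart_dom n i \<and>
        (\<forall>j\<le>n. (\<lambda>w. affine_coord i (f w) j) holomorphic_on U)"
      using l(1) \<delta>(1) r[of z] by (intro exI[of _ l] conjI exI[of _ ?U]) auto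
  qed
  have in_D: "f z \<in> zero_locus n p" for z
  proof -
    have p_tr: "mp_eval (?tr x) p = mp_eval x p" for x
      by (rule mp_eval_cong[OF homog_supported[OF p]]) simp
    have off: "mp_eval (\<lambda>i. b z i w) p = 0" if w: "w \<in> ball z (r z) - {z}" for w
    proof -
      have "\<exists>i\<le>n. Z w i \<noteq> 0"
        using Znz[OF w] j(1) by blast
      then obtain \<gamma> where "\<forall>i\<le>n. b z i w = \<gamma> * Z w i"
        using prop_Z w by blast
      then have "mp_eval (\<lambda>i. b z i w) p = mp_eval (\<lambda>i. \<gamma> * Z w i) p"
        by (intro mp_eval_cong[OF homog_supported[OF p]]) simp
      then show ?thesis
        by (simp add: mp_eval_homog[OF p] zero)
    qed
    have "((\<lambda>w. mp_eval (\<lambda>i. b z i w) p) \<longlongrightarrow> mp_eval (\<lambda>i. b z i z) p) (at z)"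
    proof (rule mp_eval_tendsto[OF homog_supported[OF p]])
      fix i assume "i \<in> {..n}"
      then have "isCont (b z i) z"
        using hol[of i z] r[of z] holomorphic_on_imp_continuous_on
        by (metis atMost_iff centre_in_ball continuous_on_eq_continuous_at open_ball)
      then show "(b z i \<longlongrightarrow> b z i z) (at z)"
        by (simp add: isCont_def)
    qed
    moreover have "eventually (\<lambda>w. mp_eval (\<lambda>i. b z i w) p = 0) (at z)"
      unfolding eventually_at using r[of z] off by (intro exI[of _ "r z"]) (auto simp: dist_commute)
    then have "((\<lambda>w. mp_eval (\<lambda>i. b z i w) p) \<longlongrightarrow> 0) (at z)"
      by (rule tendsto_eventually)
    ultimately have "mp_eval (\<lambda>i. b z i z) p = 0"
      by (rule LIM_unique)
    then have "mp_eval x p = 0" if "x \<in> f z" for x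
      using that by (auto simp: f_def proj_class_def mp_eval_homog[OF p] p_tr)
    then show ?thesis
      using holo_curve_proj_space[OF curve] by (simp add: zero_locus_def)
  qed
  show thesis
    by (rule that[OF curve in_D f_Z])
qed

section \<open>Entire curves in cyclic covers\<close>

lemma deformation_homog:
  assumes "sD \<in> homog {..n} k" "\<And>l. l \<in> {1..N} \<Longrightarrow> s l \<in> homog {..n} k" "F \<in> deform_params N d"
  shows "deformation d sD s F t \<in> homog {..n} (d * k)"
  unfolding deformation_def
proof (intro homog_add homog_sum homog_power assms(1))
  fix i assume i: "i \<in> {1..d}"
  then have "F i \<in> homog {1..N} i"
    using assms(3) by (simp add: deform_params_def)
  then have "mp_subst s (F i) * sD ^ (d - i) * mp_const (t ^ i) \<in> homog {..n} (i * k + (d - i) * k + 0)"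
    by (intro homog_mult homog_subst[of _ "{1..N}"] homog_power homog_const assms)
  also have "i * k + (d - i) * k + 0 = d * k"
    using i by (simp flip: add_mult_distrib)
  finally show "mp_subst s (F i) * sD ^ (d - i) * mp_const (t ^ i) \<in> homog {..n} (d * k)" .
qed

lemma hypersurface_cyclic_cover:
  assumes G: "G \<in> homog {..n} e" and "e > 0"
  shows "hypersurface (n + 1) e (cyclic_cover n e G)"
proof -
  have "mp_var (n + 1) ^ e \<in> homog {..n + 1} (e * 1)"
    by (intro homog_power homog_var) simp
  moreover have "G \<in> homog {..n + 1} e"
    using G homog_mono[of "{..n}" "{..n + 1}" e] by auto
  ultimately have "cyclic_cover n e G \<in> homog {..n + 1} e"
    using homog_add[OF _ homog_uminus, of "mp_var (n + 1) ^ e" _ e G] by (simp add: cyclic_cover_def)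
  moreover have "cyclic_cover n e G \<noteq> 0"
  proof
    \<comment> \<open>At the point whose only nonzero coordinate is the last one the power equals 1,
      while \<open>G\<close> vanishes, being homogeneous of positive degree in the other
      variables.\<close>
    let ?x = "\<lambda>i. if i = n + 1 then 1 else 0 :: complex"
    assume "cyclic_cover n e G = 0"
    then have "mp_eval ?x (cyclic_cover n e G) = 0"
      by simp
    then have "mp_eval ?x G = 1"
      by (simp add: cyclic_cover_def)
    moreover have "mp_eval ?x G = mp_eval (\<lambda>i. 0 * ?x i) G"
      by (rule mp_eval_cong[OF homog_supported[OF G]]) auto
    ultimately show False
      using \<open>e > 0\<close> mp_eval_homog[OF G, of 0 ?x] by (simp add: power_0_left)
  qed
  ultimately show ?thesis
    by (simp add: hypersurface_def)
qed

text \<open>Division by \<open>t ^ d\<close>, which equals \<open>r ^ (d * k)\<close>, removes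
  \<open>t\<close> from the equation. The rescaled curves for all \<open>t\<close> thus satisfy the
  same equation, and \<open>t\<close> survives only in the relation between \<open>sD\<close> and
  the section of weight \<open>k\<close>.\<close>

lemma cyclic_cover_equation:
  assumes "x \<in> p" "p \<in> zero_locus (n + 1) (cyclic_cover n (d * k) (deformation d sD s F t))" and t: "t \<noteq> 0" "r ^ k = t"
  shows "(x (n + 1) / r) ^ (d * k) = (mp_eval x sD / t) ^ d +
    (\<Sum>i=1..d. mp_eval x (mp_subst s (F i)) * (mp_eval x sD / t) ^ (d - i))"
proof -
  have "x (n + 1) ^ (d * k) = mp_eval x sD ^ d + (\<Sum>i=1..d. mp_eval x (mp_subst s (F i)) * mp_eval x sD ^ (d - i) * t ^ i)"
    using assms(1,2) by (auto simp: zero_locus_def cyclic_cover_def deformation_def)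
  moreover have "r ^ (d * k) = t ^ d"
    by (simp add: power_mult[of r k d] t(2) mult.commute[of d])
  ultimately have "(x (n + 1) / r) ^ (d * k) = (mp_eval x sD ^ d +
      (\<Sum>i=1..d. mp_eval x (mp_subst s (F i)) * mp_eval x sD ^ (d - i) * t ^ i)) / t ^ d"
    by (simp add: power_divide)
  also have "\<dots> = (mp_eval x sD / t) ^ d +
      (\<Sum>i=1..d. mp_eval x (mp_subst s (F i)) * mp_eval x sD ^ (d - i) * t ^ i / t ^ d)"
    by (simp add: add_divide_distrib sum_divide_distrib power_divide)
  also have "(\<Sum>i=1..d. mp_eval x (mp_subst s (F i)) * mp_eval x sD ^ (d - i) * t ^ i / t ^ d) =
      (\<Sum>i=1..d. mp_eval x (mp_subst s (F i)) * (mp_eval x sD / t) ^ (d - i))"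
  proof (rule sum.cong)
    fix i assume "i \<in> {1..d}"
    then have "t ^ d = t ^ i * t ^ (d - i)"
      by (simp flip: power_add)
    then show "mp_eval x (mp_subst s (F i)) * mp_eval x sD ^ (d - i) * t ^ i / t ^ d =
        mp_eval x (mp_subst s (F i)) * (mp_eval x sD / t) ^ (d - i)"
      using t(1) by (simp add: power_divide)
  qed simp
  finally show ?thesis .
qed

text \<open>With weight \<open>k\<close> for \<open>l\<close>, every term of the equation has weight
  \<open>d * k\<close>.\<close>

lemma monic_equation_scale:
  fixes n k d :: nat and E :: "nat \<Rightarrow> nat mpoly"
  assumes E: "\<And>i. i \<in> {1..d} \<Longrightarrow> E i \<in> homog {..n} (i * k)"
    and eq: "y (n + 1) ^ (d * k) = l ^ d + (\<Sum>i=1..d. mp_eval y (E i) * l ^ (d - i))"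
  shows "(c * y (n + 1)) ^ (d * k) =
    (c ^ k * l) ^ d + (\<Sum>i=1..d. mp_eval (\<lambda>a. c * y a) (E i) * (c ^ k * l) ^ (d - i))"
proof -
  have "(c * y (n + 1)) ^ (d * k) = c ^ (d * k) * l ^ d + (\<Sum>i=1..d. c ^ (d * k) * (mp_eval y (E i) * l ^ (d - i)))"
    unfolding power_mult_distrib eq by (simp add: distrib_left sum_distrib_left)
  also have "(\<Sum>i=1..d. c ^ (d * k) * (mp_eval y (E i) * l ^ (d - i))) =
      (\<Sum>i=1..d. mp_eval (\<lambda>a. c * y a) (E i) * (c ^ k * l) ^ (d - i))"
  proof (rule sum.cong)
    fix i assume i: "i \<in> {1..d}"
    then have "c ^ (d * k) = c ^ (i * k) * c ^ (k * (d - i))"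
      by (simp add: mult.commute[of k] flip: power_add add_mult_distrib)
    then show "c ^ (d * k) * (mp_eval y (E i) * l ^ (d - i)) = mp_eval (\<lambda>a. c * y a) (E i) * (c ^ k * l) ^ (d - i)"
      unfolding mp_eval_homog[OF E[OF i]] by (simp add: power_mult_distrib power_mult)
  qed simp
  finally show ?thesis
    by (simp add: power_mult_distrib mult.commute[of d] flip: power_mult)
qed

text \<open>The section \<open>sD / t\<close> is controlled by the dominating coordinate, since it solves a monic equation.\<close>

lemma weight_bound:
  fixes n k d :: nat and E :: "nat \<Rightarrow> nat mpoly"
  assumes E: "\<And>i. i \<in> {1..d} \<Longrightarrow> E i \<in> homog {..n} (i * k)" and "d \<ge> 1"
  obtains C where "\<And>y l j. y (n + 1) ^ (d * k) = l ^ d + (\<Sum>i=1..d. mp_eval y (E i) * l ^ (d - i)) \<Longrightarrow>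
    (\<And>i. i \<le> n + 1 \<Longrightarrow> norm (y i) \<le> 2 * norm (y j)) \<Longrightarrow> y j \<noteq> 0 \<Longrightarrow> norm l \<le> C * norm (y j) ^ k"
proof -
  have "\<forall>i\<in>{1..d}. \<exists>B\<ge>0. \<forall>x. (\<forall>l\<in>{..n}. norm (x l) \<le> 2) \<longrightarrow> norm (mp_eval x (E i)) \<le> B"
  proof
    fix i assume "i \<in> {1..d}"
    obtain B where "B \<ge> 0" "\<And>x. (\<And>l. l \<in> {..n} \<Longrightarrow> norm (x l) \<le> 2) \<Longrightarrow> norm (mp_eval x (E i)) \<le> B"
      by (rule mp_eval_bounded[OF homog_supported[OF E[OF \<open>i \<in> {1..d}\<close>]]]) (rule that, assumption, blast)
    then show "\<exists>B\<ge>0. \<forall>x. (\<forall>l\<in>{..n}. norm (x l) \<le> 2) \<longrightarrow> norm (mp_eval x (E i)) \<le> B"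
      by (intro exI[of _ B]) simp
  qed
  from bchoice[OF this] obtain B where B: "\<forall>i\<in>{1..d}. B i \<ge> 0 \<and> (\<forall>x. (\<forall>l\<in>{..n}. norm (x l) \<le> 2) \<longrightarrow> norm (mp_eval x (E i)) \<le> B i)"
    by (elim exE)
  let ?C = "1 + (\<Sum>i=1..d. B i) + 2 ^ (d * k)"
  show thesis
  proof (rule that[of ?C])
    fix y l j
    assume eq: "y (n + 1) ^ (d * k) = l ^ d + (\<Sum>i=1..d. mp_eval y (E i) * l ^ (d - i))"
      and dom: "\<And>i. i \<le> n + 1 \<Longrightarrow> norm (y i) \<le> 2 * norm (y j)" and nz: "y j \<noteq> 0"
    \<comment> \<open>Scaling makes the dominating coordinate equal to 1. All coordinates are then
      bounded by 2, which bounds the coefficients and the right-hand side of the monic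
      equation.\<close>
    define c where "c = 1 / y j"
    have c: "c \<noteq> 0"
      using nz by (simp add: c_def)
    have norm_c: "norm (c * y i) \<le> 2" if "i \<le> n + 1" for i
      using dom[OF that] nz by (simp add: c_def norm_divide norm_mult divide_le_eq)
    have "(c ^ k * l) ^ d + (\<Sum>i=1..d. mp_eval (\<lambda>a. c * y a) (E i) * (c ^ k * l) ^ (d - i)) = (c * y (n + 1)) ^ (d * k)"
      by (rule monic_equation_scale[OF _ eq, symmetric]) (rule E)
    then have "norm (c ^ k * l) \<le> 1 + (\<Sum>i=1..d. B i) + 2 ^ (d * k)"
    proof (rule monic_root_bound[OF _ \<open>d \<ge> 1\<close>])
      show "(\<Sum>i=1..d. norm (mp_eval (\<lambda>a. c * y a) (E i))) \<le> (\<Sum>i=1..d. B i)"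
      proof (rule sum_mono)
        fix i assume i: "i \<in> {1..d}"
        have "\<forall>l\<in>{..n}. norm (c * y l) \<le> 2"
          by (intro ballI norm_c) simp
        with bspec[OF B i, THEN conjunct2, THEN spec[of _ "\<lambda>a. c * y a"]]
        show "norm (mp_eval (\<lambda>a. c * y a) (E i)) \<le> B i"
          by blast
      qed
      show "norm ((c * y (n + 1)) ^ (d * k)) \<le> 2 ^ (d * k)"
        unfolding norm_power by (intro power_mono norm_c) simp_all
    qed
    then show "norm l \<le> ?C * norm (y j) ^ k"
      using nz by (simp add: c_def norm_mult norm_power norm_divide power_one_over divide_le_eq)
  qed
qed

definition root_count :: "nat \<Rightarrow> (nat \<Rightarrow> nat mpoly) \<Rightarrow> (nat \<Rightarrow> nat mpoly) \<Rightarrow> (nat \<Rightarrow> complex) \<Rightarrow> nat" where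
  "root_count d s F x = card {u. poly (monic_poly d (\<lambda>i. mp_eval x (mp_subst s (F i)))) u = 0}"

text \<open>A uniform \<epsilon> is obtained by contradiction, from curves for parameters tending to
  0. The factor \<open>c\<close> in the assumption on the roots permits a convenient representative
  of each point of \<open>D\<close>, such as the one in an affine chart.\<close>

lemma cyclic_covers_brody_hyperbolic:
  assumes k: "k \<ge> 1" and d: "d \<ge> 1" and sD: "sD \<in> homog {..n} k"
    and hyp: "brody_hyperbolic n (zero_locus n sD)"
    and s: "\<And>l. l \<in> {1..N} \<Longrightarrow> s l \<in> homog {..n} k" and F: "F \<in> deform_params N d"
    and roots: "\<And>x. x \<in> nonzero_vecs n \<Longrightarrow> mp_eval x sD = 0 \<Longrightarrow> \<exists>c. c \<noteq> 0 \<and>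
      k * root_count d s F (\<lambda>a. c * x a) \<ge> 2 * k + 2"
  shows "\<exists>\<epsilon>>0. \<forall>t. t \<noteq> 0 \<and> norm t \<le> \<epsilon> \<longrightarrow>
    brody_hyperbolic (n + 1) (zero_locus (n + 1) (cyclic_cover n (d * k) (deformation d sD s F t)))"
proof (rule ccontr)
  let ?W = "\<lambda>t. zero_locus (n + 1) (cyclic_cover n (d * k) (deformation d sD s F t))"
  define E where "E i = mp_subst s (F i)" for i
  have E: "E i \<in> homog {..n} (i * k)" if "i \<in> {1..d}" for i
    unfolding E_def using F that by (intro homog_subst[of _ "{1..N}"] s) (simp_all add: deform_params_def)
  assume "\<not> ?thesis"
  then have "\<exists>t. t \<noteq> 0 \<and> norm t \<le> 1 / real (Suc m) \<and> \<not> brody_hyperbolic (n + 1) (?W t)" for m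
    using of_nat_0_less_iff[of "Suc m"] by (metis divide_pos_pos zero_less_one zero_less_Suc)
  then have "\<forall>m. \<exists>t. t \<noteq> 0 \<and> norm t \<le> 1 / real (Suc m) \<and> \<not> brody_hyperbolic (n + 1) (?W t)"
    by blast
  from choice[OF this] obtain t where
    t: "\<forall>m. t m \<noteq> 0 \<and> norm (t m) \<le> 1 / real (Suc m) \<and> \<not> brody_hyperbolic (n + 1) (?W (t m))"
    by (elim exE)
  have t_lim: "t \<longlonglongrightarrow> 0"
    by (rule Lim_null_comparison[OF _ lim_inverse_n'[THEN LIMSEQ_Suc]]) (use t in auto)
  obtain C where C: "\<And>y l j. y (n + 1) ^ (d * k) = l ^ d + (\<Sum>i=1..d. mp_eval y (E i) * l ^ (d - i)) \<Longrightarrow>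
    (\<And>i. i \<le> n + 1 \<Longrightarrow> norm (y i) \<le> 2 * norm (y j)) \<Longrightarrow> y j \<noteq> 0 \<Longrightarrow> norm l \<le> C * norm (y j) ^ k"
    by (rule weight_bound[where E = E and n = n and k = k and d = d]) (rule E, assumption, rule d, rule that, blast)
  have "\<forall>m. \<exists>Y. \<exists>L. wcurve (n + 1) k Y L \<and>
      (\<forall>w. norm w \<le> real m \<longrightarrow> dominated (n + 1) Y (ball w (1/4))) \<and> \<not> dominated (n + 1) Y (ball 0 2) \<and>
      (\<forall>z. Y z (n + 1) ^ (d * k) = L z ^ d + (\<Sum>i=1..d. mp_eval (Y z) (E i) * L z ^ (d - i)) \<and>
        mp_eval (Y z) sD = t m * L z)"
  proof
    fix m
    obtain f where f: "holo_curve (n + 1) f" "\<forall>z. f z \<in> ?W (t m)" "\<not> (\<exists>p. \<forall>z. f z = p)"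
      using t unfolding brody_hyperbolic_def by blast
    have tm: "t m \<noteq> 0"
      using t by blast
    obtain r where r: "r ^ k = t m"
      using nth_root_exists[of k "t m"] k by auto
    then have r0: "r \<noteq> 0"
      using tm k by (auto simp: power_0_left)
    define X where "X = representative f"
    define Y where "Y z i = (if i \<le> n then X z i else X z i / r)" for z i
    define L where "L z = mp_eval (X z) sD / t m" for z
    have XY: "mp_eval (Y z) p = mp_eval (X z) p" if "p \<in> homog {..n} e" for z p e
      by (rule mp_eval_cong[OF homog_supported[OF that]]) (simp add: Y_def)
    have curve: "wcurve (n + 1) k Y L"
      using wcurve_of_holo_curve[OF f(1) sD r0] unfolding X_def Y_def[abs_def] L_def[abs_def] .
    have "nonconstant (n + 1) Y"
      using nonconstant_representative[OF f(1,3) r0] unfolding X_def Y_def[abs_def] .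
    \<comment> \<open>The radius is \<open>Suc m\<close> because the reparametrisation needs a
      positive one.\<close>
    then obtain a b where "b \<noteq> 0"
      and dom: "\<And>w. norm w \<le> real (Suc m) \<Longrightarrow> dominated (n + 1) (\<lambda>x. Y (a + b * x)) (ball w (1/4))"
      and not_dom: "\<not> dominated (n + 1) (\<lambda>x. Y (a + b * x)) (ball 0 2)"
      by (rule brody_reparametrisation[OF curve, of "real (Suc m)"]) auto
    have eq: "Y z (n + 1) ^ (d * k) = L z ^ d + (\<Sum>i=1..d. mp_eval (Y z) (E i) * L z ^ (d - i))" for z
    proof -
      have "X z \<in> f z"
        using representative(1)[OF f(1)] by (simp add: X_def)
      from cyclic_cover_equation[OF this _ tm r] f(2)
      have "Y z (n + 1) ^ (d * k) = L z ^ d + (\<Sum>i=1..d. mp_eval (X z) (E i) * L z ^ (d - i))"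
        by (simp add: Y_def L_def E_def)
      also have "(\<Sum>i=1..d. mp_eval (X z) (E i) * L z ^ (d - i)) = (\<Sum>i=1..d. mp_eval (Y z) (E i) * L z ^ (d - i))"
        by (intro sum.cong refl) (simp add: XY[OF E])
      finally show ?thesis .
    qed
    have "mp_eval (Y z) sD = t m * L z" for z
      using tm by (simp add: XY[OF sD] L_def)
    then show "\<exists>Y L. wcurve (n + 1) k Y L \<and>
      (\<forall>w. norm w \<le> real m \<longrightarrow> dominated (n + 1) Y (ball w (1/4))) \<and> \<not> dominated (n + 1) Y (ball 0 2) \<and>
      (\<forall>z. Y z (n + 1) ^ (d * k) = L z ^ d + (\<Sum>i=1..d. mp_eval (Y z) (E i) * L z ^ (d - i)) \<and>
        mp_eval (Y z) sD = t m * L z)"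
      using wcurve_affine[OF curve, of a b] dom not_dom eq
      by (intro exI[of _ "\<lambda>x. Y (a + b * x)"] exI[of _ "\<lambda>x. L (a + b * x)"]) simp
  qed
  from choice[OF this] obtain Y where "\<forall>m. \<exists>L. wcurve (n + 1) k (Y m) L \<and>
      (\<forall>w. norm w \<le> real m \<longrightarrow> dominated (n + 1) (Y m) (ball w (1/4))) \<and> \<not> dominated (n + 1) (Y m) (ball 0 2) \<and>
      (\<forall>z. Y m z (n + 1) ^ (d * k) = L z ^ d + (\<Sum>i=1..d. mp_eval (Y m z) (E i) * L z ^ (d - i)) \<and>
        mp_eval (Y m z) sD = t m * L z)"
    by (elim exE)
  from choice[OF this] obtain L where YL: "\<forall>m. wcurve (n + 1) k (Y m) (L m) \<and>
      (\<forall>w. norm w \<le> real m \<longrightarrow> dominated (n + 1) (Y m) (ball w (1/4))) \<and> \<not> dominated (n + 1) (Y m) (ball 0 2) \<and>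
      (\<forall>z. Y m z (n + 1) ^ (d * k) = L m z ^ d + (\<Sum>i=1..d. mp_eval (Y m z) (E i) * L m z ^ (d - i)) \<and>
        mp_eval (Y m z) sD = t m * L m z)"
    by (elim exE)
  have eq: "Y m z (n + 1) ^ (d * k) = L m z ^ d + (\<Sum>i=1..d. mp_eval (Y m z) (E i) * L m z ^ (d - i))"
    and sDY: "mp_eval (Y m z) sD = t m * L m z" for m z
    using YL by blast+
  interpret brody_sequence "n + 1" k Y L C
  proof
    show "norm (L m w) \<le> C * norm (Y m w j) ^ k"
      if "j \<le> n + 1" and dom: "\<And>i. i \<le> n + 1 \<Longrightarrow> norm (Y m w i) \<le> 2 * norm (Y m w j)" for m w j
      by (rule C[OF eq dom]) (use dominated_nonzero[of "n + 1" k "Y m" "L m" w j] YL dom in auto)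
  qed (use YL in auto)
  obtain Z \<Lambda> r where Z: "wcurve (n + 1) k Z \<Lambda>" and nc: "nonconstant (n + 1) Z"
    and domZ: "\<And>w. dominated (n + 1) Z (ball w (1/8))" and r: "strict_mono (r :: nat \<Rightarrow> nat)"
    and lim: "\<And>w. \<exists>c. eventually (\<lambda>m. c m \<noteq> 0) sequentially \<and>
       (\<forall>i\<le>n + 1. (\<lambda>m. c m * Y (r m) w i) \<longlonglongrightarrow> Z w i) \<and> (\<lambda>m. c m ^ k * L (r m) w) \<longlonglongrightarrow> \<Lambda> w"
    by (rule brody_limit) (rule that)
  have sDZ: "mp_eval (Z w) sD = 0"
    and eqZ: "Z w (n + 1) ^ (d * k) = \<Lambda> w ^ d + (\<Sum>i=1..d. mp_eval (Z w) (E i) * \<Lambda> w ^ (d - i))" for w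
  proof -
    obtain c where c: "\<And>i. i \<le> n + 1 \<Longrightarrow> (\<lambda>m. c m * Y (r m) w i) \<longlonglongrightarrow> Z w i"
      "(\<lambda>m. c m ^ k * L (r m) w) \<longlonglongrightarrow> \<Lambda> w"
      using lim[of w] by blast
    have lim_p: "(\<lambda>m. mp_eval (\<lambda>i. c m * Y (r m) w i) p) \<longlonglongrightarrow> mp_eval (Z w) p" if "p \<in> homog {..n} e" for p e
      by (rule mp_eval_tendsto[OF homog_supported[OF that] c(1)]) simp
    \<comment> \<open>The section \<open>L\<close> stays convergent after normalisation, so
      \<open>sD = t * L\<close> tends to 0.\<close>
    have "(\<lambda>m. t (r m) * (c m ^ k * L (r m) w)) \<longlonglongrightarrow> 0 * \<Lambda> w"
      using LIMSEQ_subseq_LIMSEQ[OF t_lim r] by (intro tendsto_mult c(2)) (simp add: o_def)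
    moreover have "mp_eval (\<lambda>i. c m * Y (r m) w i) sD = t (r m) * (c m ^ k * L (r m) w)" for m
      by (simp add: mp_eval_homog[OF sD] sDY)
    ultimately show "mp_eval (Z w) sD = 0"
      using LIMSEQ_unique[OF lim_p[OF sD]] by simp
    have scaled: "(c m * Y (r m) w (n + 1)) ^ (d * k) = (c m ^ k * L (r m) w) ^ d +
        (\<Sum>i=1..d. mp_eval (\<lambda>a. c m * Y (r m) w a) (E i) * (c m ^ k * L (r m) w) ^ (d - i))" for m
      by (rule monic_equation_scale[OF _ eq]) (rule E)
    show "Z w (n + 1) ^ (d * k) = \<Lambda> w ^ d + (\<Sum>i=1..d. mp_eval (Z w) (E i) * \<Lambda> w ^ (d - i))"
    proof (rule LIMSEQ_unique)
      show "(\<lambda>m. (c m * Y (r m) w (n + 1)) ^ (d * k)) \<longlonglongrightarrow> Z w (n + 1) ^ (d * k)"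
        by (intro tendsto_power c) simp
      show "(\<lambda>m. (c m * Y (r m) w (n + 1)) ^ (d * k)) \<longlonglongrightarrow>
          \<Lambda> w ^ d + (\<Sum>i=1..d. mp_eval (Z w) (E i) * \<Lambda> w ^ (d - i))"
        unfolding scaled by (intro tendsto_add tendsto_sum tendsto_mult tendsto_power c(2) lim_p[OF E])
    qed
  qed
  \<comment> \<open>Otherwise the limit curve would sit at the vertex of the cone and be
    constant.\<close>
  have "\<exists>z i. i \<le> n \<and> Z z i \<noteq> 0"
  proof (rule ccontr)
    assume "\<not> ?thesis"
    then have "Z z i = 0" if "i \<noteq> n + 1" "i \<le> n + 1" for z i
      using that by (metis Suc_eq_plus1 le_SucE)
    then have "Z z i * Z w j = Z z j * Z w i" if "i \<le> n + 1" "j \<le> n + 1" for z w i j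
      using that by (cases "i = n + 1"; cases "j = n + 1") auto
    then show False
      using nc unfolding nonconstant_def by blast
  qed
  then obtain z1 j where j: "j \<le> n" "Z z1 j \<noteq> 0"
    by blast
  obtain f where f: "holo_curve n f" "\<And>z. f z \<in> zero_locus n sD"
    "\<And>z. \<exists>i\<le>n. Z z i \<noteq> 0 \<Longrightarrow> f z = proj_class (\<lambda>i. if i \<le> n then Z z i else 0)"
    by (rule extended_curve[OF Z j sD sDZ]) (rule that)
  obtain p where p: "\<And>z. f z = p"
    using hyp f(1,2) unfolding brody_hyperbolic_def by blast
  define x0 where "x0 = representative f 0"
  have x0: "x0 \<in> nonzero_vecs n" "p = proj_class x0" "mp_eval x0 sD = 0"
    using representative[OF f(1), of 0] f(2)[of 0] by (simp_all add: x0_def p zero_locus_def)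
  obtain c where c: "c \<noteq> 0" "k * card {u. poly (monic_poly d (\<lambda>i. mp_eval (\<lambda>a. c * x0 a) (E i))) u = 0} \<ge> 2 * k + 2"
    using roots[OF x0(1,3)] unfolding E_def root_count_def by blast
  define x where "x a = c * x0 a" for a
  obtain l where l: "l \<le> n" "x l \<noteq> 0"
    using nonzero_vecs_ex[OF x0(1)] c(1) by (auto simp: x_def)
  define \<kappa> where "\<kappa> z = Z z l / x l" for z
  \<comment> \<open>The projected curve is the single point represented by \<open>x\<close>, so the
    first \<open>n + 1\<close> coordinates are a multiple of \<open>x\<close>; the multiple is 0
    where \<open>Z\<close> passes through the vertex.\<close>
  have Zx: "Z z i = \<kappa> z * x i" if i: "i \<le> n" for z i
  proof -
    have "\<exists>e. \<forall>i\<le>n. Z z i = e * x i"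
    proof (cases "\<exists>i\<le>n. Z z i \<noteq> 0")
      case True
      have "(\<lambda>i. if i \<le> n then Z z i else 0) \<in> proj_class x0"
        using f(3)[OF True] p x0(2) proj_class_self by metis
      then obtain e where "(\<lambda>i. if i \<le> n then Z z i else 0) = (\<lambda>i. e * x0 i)"
        by (auto simp: proj_class_def)
      then have "Z z i = e * x0 i" if "i \<le> n" for i
        using that by (metis (mono_tags, lifting))
      then show ?thesis
        using c(1) by (intro exI[of _ "e / c"]) (simp add: x_def)
    next
      case False
      then show ?thesis by (intro exI[of _ 0]) auto
    qed
    then obtain e where "\<forall>i\<le>n. Z z i = e * x i"
      by blast
    then show ?thesis
      using l i by (simp add: \<kappa>_def)
  qed
  define y where "y z i = (if i = 0 then \<kappa> z else Z z (n + 1))" for z and i :: nat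
  let ?S = "\<Sum>i\<le>n. norm (x i)"
  \<comment> \<open>The two entries translate dominance of the last coordinate and of a coordinate
    in the base, respectively: \<open>\<kappa>\<close> is a coordinate divided by
    \<open>x l\<close>, and the coordinates in the base are \<open>\<kappa>\<close> times entries of
    \<open>x\<close>.\<close>
  define C' where "C' = max 1 (max (2 / norm (x l)) (2 * ?S))"
  interpret superelliptic d k "\<lambda>i. mp_eval x (E i)" y \<Lambda> C'
  proof
    show "1 \<le> d" "1 \<le> k"
      by (rule d k)+
    show "1 \<le> C'"
      by (simp add: C'_def)
    show "2 * k + 2 \<le> k * card {u. poly (monic_poly d (\<lambda>i. mp_eval x (E i))) u = 0}"
      using c(2) by (simp add: x_def[abs_def])
    show "wcurve 1 k y \<Lambda>"
      unfolding wcurve_def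
    proof (intro conjI allI)
      fix z
      obtain i where i: "i \<le> n + 1" "Z z i \<noteq> 0"
        using wcurve_nonzero[OF Z] by blast
      show "\<exists>i\<le>1. y z i \<noteq> 0"
      proof (cases "i \<le> n")
        case True
        then have "\<kappa> z \<noteq> 0" using i Zx by auto
        then show ?thesis by (intro exI[of _ 0]) (simp add: y_def)
      next
        case False
        then have "i = n + 1" using i by simp
        then show ?thesis using i by (intro exI[of _ 1]) (simp add: y_def)
      qed
      obtain U g where U: "open U" "z \<in> U" "\<And>w. w \<in> U \<Longrightarrow> g w \<noteq> 0"
        and hol: "\<And>i. i \<le> n + 1 \<Longrightarrow> (\<lambda>w. g w * Z w i) holomorphic_on U" "(\<lambda>w. g w ^ k * \<Lambda> w) holomorphic_on U"
        by (rule wcurveE[OF Z, of z]) (rule that)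
      have "(\<lambda>w. (g w * Z w l) * (1 / x l)) holomorphic_on U"
        by (intro holomorphic_on_mult hol holomorphic_on_const) (use l in simp)
      then have "(\<lambda>w. g w * y w i) holomorphic_on U" if "i \<le> 1" for i
        using that hol(1)[of "n + 1"] by (cases "i = 0") (simp_all add: y_def \<kappa>_def)
      then show "\<exists>U g. open U \<and> z \<in> U \<and> (\<forall>w\<in>U. g w \<noteq> 0) \<and>
          (\<forall>i\<le>1. (\<lambda>w. g w * y w i) holomorphic_on U) \<and> (\<lambda>w. g w ^ k * \<Lambda> w) holomorphic_on U"
        using U hol(2) by (intro exI[of _ U] exI[of _ g]) simp
    qed
    fix z
    have "mp_eval (Z z) (E i) = \<kappa> z ^ (i * k) * mp_eval x (E i)" if "i \<in> {1..d}" for i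
    proof -
      have "mp_eval (Z z) (E i) = mp_eval (\<lambda>a. \<kappa> z * x a) (E i)"
        by (rule mp_eval_cong[OF homog_supported[OF E[OF that]]]) (simp add: Zx)
      then show ?thesis
        by (simp add: mp_eval_homog[OF E[OF that]])
    qed
    then show "y z 1 ^ (d * k) = \<Lambda> z ^ d + (\<Sum>i=1..d. mp_eval x (E i) * y z 0 ^ (i * k) * \<Lambda> z ^ (d - i))"
      using eqZ[of z] by (simp add: y_def mult_ac)
    obtain i where i: "i \<le> n + 1" "\<And>w a. w \<in> ball z (1/8) \<Longrightarrow> a \<le> n + 1 \<Longrightarrow> norm (Z w a) \<le> 2 * norm (Z w i)"
      using domZ[of z] unfolding dominated_def by blast
    show "(\<forall>w\<in>ball z (1/8). norm (y w 0) \<le> C' * norm (y w 1)) \<or>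
        (\<forall>w\<in>ball z (1/8). norm (y w 1) \<le> C' * norm (y w 0))"
    proof (cases "i \<le> n")
      case True
      have "norm (y w 1) \<le> C' * norm (y w 0)" if w: "w \<in> ball z (1/8)" for w
      proof -
        have "norm (Z w (n + 1)) \<le> 2 * (norm (\<kappa> w) * norm (x i))"
          using i(2)[OF w, of "n + 1"] Zx[OF True, of w] by (simp add: norm_mult)
        also have "\<dots> \<le> (2 * ?S) * norm (\<kappa> w)"
          using member_le_sum[of i "{..n}" "\<lambda>i. norm (x i)"] True
            mult_left_mono[of "norm (x i)" ?S "norm (\<kappa> w)"] by (simp add: mult_ac)
        also have "\<dots> \<le> C' * norm (\<kappa> w)"
          by (intro mult_right_mono) (auto simp: C'_def)
        finally show ?thesis by (simp add: y_def)
      qed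
      then show ?thesis by blast
    next
      case False
      then have i': "i = n + 1" using i(1) by simp
      have "norm (y w 0) \<le> C' * norm (y w 1)" if w: "w \<in> ball z (1/8)" for w
      proof -
        have "norm (\<kappa> w) \<le> 2 / norm (x l) * norm (Z w (n + 1))"
          using i(2)[OF w, of l] l by (simp add: \<kappa>_def norm_divide i' divide_right_mono)
        also have "\<dots> \<le> C' * norm (Z w (n + 1))"
          by (intro mult_right_mono) (auto simp: C'_def)
        finally show ?thesis by (simp add: y_def)
      qed
      then show ?thesis by blast
    qed
  qed
  have cross: "y z 0 * y w 1 = y z 1 * y w 0" for z w
    using not_nonconstant unfolding nonconstant_def by (metis le_refl zero_le)
  have "Z z i * Z w j = Z z j * Z w i" if "i \<le> n + 1" "j \<le> n + 1" for z w i j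
    using that cross[of z w] by (cases "i \<le> n"; cases "j \<le> n") (auto simp: Zx y_def le_Suc_eq mult_ac)
  then show False
    using nc unfolding nonconstant_def by blast
qed

section \<open>Generic choice of the deformation\<close>

lemma mp_eval_linear_form:
  assumes "p \<in> homog V 1"
  shows "mp_eval (\<lambda>i. x i + y i) p = mp_eval x p + mp_eval y p"
proof -
  have "mon_eval (\<lambda>i. x i + y i) m = mon_eval x m + mon_eval y m" if m: "m \<in> keys p" for m
  proof -
    have "(\<Sum>i\<in>keys m. lookup m i) = 1"
      using assms m by (simp add: homog_def)
    then obtain i where i: "i \<in> keys m" "lookup m i = 1"
      "\<forall>j\<in>keys m. i \<noteq> j \<longrightarrow> lookup m j = 0"
      using sum_eq_1_iff[OF finite_keys, of "lookup m" m] by blast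
    then have "keys m = {i}"
      by (auto simp: in_keys_iff)
    then show ?thesis
      by (simp add: mon_eval_def i(2))
  qed
  then show ?thesis
    by (simp add: mp_eval_mon_eval distrib_left sum.distrib)
qed

definition unit_vec :: "nat \<Rightarrow> nat \<Rightarrow> complex" where
  "unit_vec i j = (if j = i then 1 else 0)"

lemma mp_eval_unit_vec_combination:
  assumes "p \<in> homog V 1"
  shows "mp_eval (\<lambda>a. \<alpha> * unit_vec i a + \<beta> * unit_vec j a) p =
    \<alpha> * mp_eval (unit_vec i) p + \<beta> * mp_eval (unit_vec j) p"
  unfolding mp_eval_linear_form[OF assms] mp_eval_homog[OF assms] by simp

text \<open>The map \<open>a + z b\<close> parametrises an affine line in the hyperplane. Because
  \<open>b i = 0\<close>, it stays in chart \<open>i\<close>, where its coordinate \<open>j\<close>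
  is not constant.\<close>

lemma line_not_brody_hyperbolic:
  assumes p: "p \<in> homog {..n} 1"
    and beyond: "\<And>l. l > n \<Longrightarrow> a l = 0" "\<And>l. l > n \<Longrightarrow> b l = 0"
    and i: "i \<le> n" "a i \<noteq> 0" "b i = 0" and j: "j \<le> n" "b j \<noteq> 0"
    and zero: "mp_eval a p = 0" "mp_eval b p = 0"
  shows "\<not> brody_hyperbolic n (zero_locus n p)"
proof
  assume hyp: "brody_hyperbolic n (zero_locus n p)"
  define f where "f z = proj_class (\<lambda>l. a l + z * b l)" for z
  have vec: "(\<lambda>l. a l + z * b l) \<in> nonzero_vecs n" for z
    using beyond i by (auto simp: nonzero_vecs_def intro!: exI[of _ i])
  have chart: "f z \<in> chart_dom n i" for z
    using vec[of z] i by (auto simp: f_def chart_dom_def proj_space_def proj_class_def)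
  have "holo_curve n f"
    unfolding holo_curve_def
  proof
    fix z
    have "(\<lambda>w. affine_coord i (f w) l) holomorphic_on UNIV" for l
      using i by (auto simp: f_def affine_coord_proj_class intro!: holomorphic_intros)
    then show "\<exists>i\<le>n. \<exists>U. open U \<and> z \<in> U \<and> f ` U \<subseteq> chart_dom n i \<and>
        (\<forall>j\<le>n. (\<lambda>w. affine_coord i (f w) j) holomorphic_on U)"
      using i(1) chart by (intro exI[of _ i] conjI exI[of _ UNIV]) auto
  qed
  moreover have "mp_eval (\<lambda>l. a l + z * b l) p = 0" for z
    by (simp add: mp_eval_linear_form[OF p] mp_eval_homog[OF p] zero)
  then have "mp_eval x p = 0" if "x \<in> f z" for x z
    using that mp_eval_homog[OF p] by (auto simp: f_def proj_class_def)
  then have "f z \<in> zero_locus n p" for z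
    using chart[of z] by (simp add: zero_locus_def chart_dom_def)
  ultimately obtain q where "\<And>z. f z = q"
    using hyp unfolding brody_hyperbolic_def by blast
  then have "affine_coord i (f 0) j = affine_coord i (f 1) j"
    by simp
  then show False
    using i j by (simp add: f_def affine_coord_proj_class divide_simps)
qed

text \<open>For \<open>n \<ge> 2\<close> a hyperplane contains a line. Two independent zeros of the
  form are combined from the first three unit vectors, according to which of its first two
  coefficients vanish.\<close>

lemma hyperbolic_hyperplane_dimension:
  assumes p: "p \<in> homog {..n} 1" and hyp: "brody_hyperbolic n (zero_locus n p)"
  shows "n \<le> 1"
proof (rule ccontr)
  assume "\<not> n \<le> 1"
  then have n: "n \<ge> 2" by simp
  let ?\<phi> = "\<lambda>i. mp_eval (unit_vec i) p"
  let ?c = "\<lambda>\<alpha> i \<beta> j a. \<alpha> * unit_vec i a + \<beta> * unit_vec j a"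
  note comb = mp_eval_unit_vec_combination[OF p]
  show False
  proof (cases "?\<phi> 0 = 0")
    case False
    have z: "mp_eval (?c (?\<phi> 1) 0 (- ?\<phi> 0) 1) p = 0" "mp_eval (?c (?\<phi> 2) 0 (- ?\<phi> 0) 2) p = 0"
      unfolding comb by simp_all
    have "\<not> brody_hyperbolic n (zero_locus n p)"
      by (rule line_not_brody_hyperbolic[OF p _ _ _ _ _ _ _ z, of 1 2])
        (use n False in \<open>auto simp: unit_vec_def\<close>)
    then show False using hyp by simp
  next
    case 0: True
    show False
    proof (cases "?\<phi> 1 = 0")
      case True
      have "\<not> brody_hyperbolic n (zero_locus n p)"
        by (rule line_not_brody_hyperbolic[OF p _ _ _ _ _ _ _ 0 True, of 0 1])
          (use n in \<open>auto simp: unit_vec_def\<close>)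
      then show False using hyp by simp
    next
      case False
      have z: "mp_eval (?c (?\<phi> 2) 1 (- ?\<phi> 1) 2) p = 0"
        unfolding comb by simp
      have "\<not> brody_hyperbolic n (zero_locus n p)"
        by (rule line_not_brody_hyperbolic[OF p _ _ _ _ _ _ _ 0 z, of 0 2])
          (use n False in \<open>auto simp: unit_vec_def\<close>)
      then show False using hyp by simp
    qed
  qed
qed

text \<open>The coefficient vector of \<open>p\<close> is nonzero and annihilates both vectors, so
  their determinant vanishes.\<close>

lemma linear_form_zeros_proportional:
  assumes p: "p \<in> homog {..1} 1" "p \<noteq> 0" and x: "x \<in> nonzero_vecs 1" "mp_eval x p = 0"
    and y: "y \<in> nonzero_vecs 1" "mp_eval y p = 0"
  shows "\<exists>c. c \<noteq> 0 \<and> y = (\<lambda>i. c * x i)"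
proof -
  let ?\<phi> = "\<lambda>i. mp_eval (unit_vec i) p"
  have ev: "mp_eval z p = z 0 * ?\<phi> 0 + z 1 * ?\<phi> 1" for z
    unfolding mp_eval_unit_vec_combination[OF p(1), symmetric]
    by (rule mp_eval_cong[OF homog_supported[OF p(1)]]) (auto simp: unit_vec_def le_Suc_eq)
  obtain z where z: "mp_eval z p \<noteq> 0"
    using mp_nonvanishing[OF p(2)] by blast
  have "?\<phi> 0 \<noteq> 0 \<or> ?\<phi> 1 \<noteq> 0"
    using z unfolding ev[of z] by auto
  moreover have "x 0 * ?\<phi> 0 + x 1 * ?\<phi> 1 = 0" "y 0 * ?\<phi> 0 + y 1 * ?\<phi> 1 = 0"
    using x(2) y(2) unfolding ev[of x] ev[of y] .
  then have "?\<phi> 0 * (x 0 * y 1 - x 1 * y 0) = 0" "?\<phi> 1 * (x 0 * y 1 - x 1 * y 0) = 0"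
    by algebra+
  ultimately have cross: "x 0 * y 1 = x 1 * y 0"
    by auto
  have beyond: "x i = 0" "y i = 0" if "i > 1" for i
    using x(1) y(1) that by (auto simp: nonzero_vecs_def)
  have nz: "x 0 \<noteq> 0 \<or> x 1 \<noteq> 0" "y 0 \<noteq> 0 \<or> y 1 \<noteq> 0"
    using nonzero_vecs_ex[OF x(1)] nonzero_vecs_ex[OF y(1)] by (auto simp: le_Suc_eq)
  have ext: "y = (\<lambda>i. c * x i)" if "y 0 = c * x 0" "y 1 = c * x 1" for c
  proof
    fix i :: nat
    consider "i = 0" | "i = 1" | "i > 1" by linarith
    then show "y i = c * x i"
      by cases (use that beyond in auto)
  qed
  show ?thesis
  proof (cases "x 0 = 0")
    case True
    then have "x 1 \<noteq> 0" "y 0 = 0" "y 1 \<noteq> 0"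
      using nz cross by auto
    then show ?thesis
      using True by (intro exI[of _ "y 1 / x 1"] conjI ext) auto
  next
    case False
    then have "y 0 \<noteq> 0"
      using nz cross by auto
    then show ?thesis
      using False cross by (intro exI[of _ "y 0 / x 0"] conjI ext) (auto simp: field_simps)
  qed
qed

lemma ex_linear_form_zero:
  assumes "p \<in> homog {..1} 1"
  shows "\<exists>x\<in>nonzero_vecs 1. mp_eval x p = 0"
proof (cases "mp_eval (unit_vec 0) p = 0")
  case True
  then show ?thesis
    by (intro bexI[of _ "unit_vec 0"]) (auto simp: nonzero_vecs_def unit_vec_def)
next
  case False
  let ?x = "\<lambda>a. mp_eval (unit_vec 1) p * unit_vec 0 a + (- mp_eval (unit_vec 0) p) * unit_vec 1 a"
  have "mp_eval ?x p = 0"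
    unfolding mp_eval_unit_vec_combination[OF assms] by simp
  moreover have "?x \<in> nonzero_vecs 1"
    using False by (auto simp: nonzero_vecs_def unit_vec_def intro!: exI[of _ 1])
  ultimately show ?thesis by blast
qed

text \<open>Supplies the linear form that \<open>few_roots\<close> asks for: the section
  \<open>x j ^ k\<close> is identically 1 on the affine chart \<open>x j = 1\<close>.\<close>

lemma basis_power_combination:
  assumes "is_basis_of (homog {..n} k) N s" "j \<le> n"
  obtains \<alpha> where "\<And>x. (\<Sum>l=1..N. \<alpha> l * mp_eval x (s l)) = x j ^ k"
proof -
  have inj: "inj_on s {1..N}" and span: "mp.span (s ` {1..N}) = homog {..n} k"
    using assms(1) by (simp_all add: is_basis_of_def)
  have "mp_var j ^ k \<in> homog {..n} (k * 1)"
    by (intro homog_power homog_var) (use assms(2) in simp)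
  then have "mp_var j ^ k \<in> mp.span (s ` {1..N})"
    unfolding span by simp
  then obtain u where "mp_var j ^ k = (\<Sum>v\<in>s ` {1..N}. mp_scale (u v) v)"
    unfolding mp.span_finite[OF finite_imageI[OF finite_atLeastAtMost]] by (elim imageE) simp
  then have u: "mp_var j ^ k = (\<Sum>l=1..N. mp_scale (u (s l)) (s l))"
    unfolding sum.reindex[OF inj] by (simp only: o_def)
  show thesis
  proof (rule that[of "\<lambda>l. u (s l)"])
    fix x
    have "(\<Sum>l=1..N. u (s l) * mp_eval x (s l)) = mp_eval x (mp_var j ^ k)"
      unfolding u by simp
    then show "(\<Sum>l=1..N. u (s l) * mp_eval x (s l)) = x j ^ k"
      by simp
  qed
qed

lemma basis_homog:
  assumes "is_basis_of (homog V k) N s" "l \<in> {1..N}"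
  shows "s l \<in> homog V k"
proof -
  have "s l \<in> mp.span (s ` {1..N})"
    by (intro mp.span_base imageI assms(2))
  then show ?thesis
    using assms(1) by (simp only: is_basis_of_def)
qed

text \<open>The chart has \<open>n\<close> affine coordinates, and two root values are allowed, so
  the count in \<open>few_roots\<close> needs exactly \<open>n + 2 < d\<close>.\<close>

lemma generic_roots_chart:
  assumes basis: "is_basis_of (homog {..n} k) N s" and "j \<le> n" and d: "n + 2 < d"
  shows "generically N d (\<lambda>F. \<forall>x. x j \<noteq> 0 \<longrightarrow> (\<exists>c. c \<noteq> 0 \<and> 2 < root_count d s F (\<lambda>a. c * x a)))"
proof -
  obtain \<alpha> where \<alpha>: "\<And>x. (\<Sum>l=1..N. \<alpha> l * mp_eval x (s l)) = x j ^ k"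
    by (rule basis_power_combination[OF basis \<open>j \<le> n\<close>]) (rule that)
  let ?A = "{..n} - {j}"
  let ?pt = "\<lambda>y i. if i = j then 1 else (y i :: complex)"
  define \<sigma> where "\<sigma> l y = mp_eval (?pt y) (s l)" for l y
  show ?thesis
  proof (rule generically_mono, rule few_roots[where A = ?A and \<alpha> = \<alpha> and \<sigma> = \<sigma> and q = 2])
    show "card ?A + 2 < d"
      using d \<open>j \<le> n\<close> by (simp add: card_Diff_singleton)
    show "polyfun ?A (\<sigma> l)" if "l \<in> {1..N}" for l
      unfolding \<sigma>_def[abs_def]
    proof (rule polyfun_eval[OF homog_supported[OF basis_homog[OF basis that]]])
      fix i assume "i \<in> {..n}"
      then show "polyfun ?A (\<lambda>y. ?pt y i)"
        by (cases "i = j") (auto intro: polyfun_const polyfun_var)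
    qed
    show "(\<Sum>l=1..N. \<alpha> l * \<sigma> l y) = 1" for y
      using \<alpha>[of "?pt y"] by (simp add: \<sigma>_def)
    fix F
    assume F: "\<forall>y. 2 < card {u. poly (monic_poly d (\<lambda>i. mp_eval (\<lambda>l. \<sigma> l y) (F i))) u = 0}"
    show "\<forall>x. x j \<noteq> 0 \<longrightarrow> (\<exists>c. c \<noteq> 0 \<and> 2 < root_count d s F (\<lambda>a. c * x a))"
    proof (intro allI impI)
      fix x :: "nat \<Rightarrow> complex" assume x: "x j \<noteq> 0"
      let ?y = "\<lambda>a. 1 / x j * x a"
      have pt: "?pt ?y = ?y"
        using x by (auto simp: fun_eq_iff)
      have "mp_eval (\<lambda>l. \<sigma> l ?y) (F i) = mp_eval ?y (mp_subst s (F i))" for i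
        unfolding \<sigma>_def pt mp_eval_subst ..
      then have "2 < root_count d s F ?y"
        using spec[OF F, of ?y] by (simp only: root_count_def)
      then show "\<exists>c. c \<noteq> 0 \<and> 2 < root_count d s F (\<lambda>a. c * x a)"
        using x by (intro exI[of _ "1 / x j"]) simp
    qed
  qed simp
qed

text \<open>A fixed point contributes no variables to the count, so even polynomials with three
  roots are avoided as soon as \<open>3 < d\<close>.\<close>

lemma generic_roots_point:
  assumes basis: "is_basis_of (homog {..n} k) N s" and x: "x \<in> nonzero_vecs n" and d: "3 < d"
  shows "generically N d (\<lambda>F. \<exists>c. c \<noteq> 0 \<and> 3 < root_count d s F (\<lambda>a. c * x a))"
proof -
  obtain j where j: "j \<le> n" "x j \<noteq> 0"
    using nonzero_vecs_ex[OF x] by blast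
  obtain \<alpha> where \<alpha>: "\<And>x. (\<Sum>l=1..N. \<alpha> l * mp_eval x (s l)) = x j ^ k"
    by (rule basis_power_combination[OF basis j(1)]) (rule that)
  let ?y = "\<lambda>a. 1 / x j * x a"
  define \<sigma> where "\<sigma> l y = mp_eval ?y (s l)" for l and y :: "nat \<Rightarrow> complex"
  show ?thesis
  proof (rule generically_mono, rule few_roots[where A = "{}" and \<alpha> = \<alpha> and \<sigma> = \<sigma> and q = 3])
    show "polyfun {} (\<sigma> l)" for l
      unfolding \<sigma>_def[abs_def] by (rule polyfun_const)
    show "(\<Sum>l=1..N. \<alpha> l * \<sigma> l y) = 1" for y
      using \<alpha>[of ?y] j(2) by (simp add: \<sigma>_def)
    fix F
    assume F: "\<forall>y. 3 < card {u. poly (monic_poly d (\<lambda>i. mp_eval (\<lambda>l. \<sigma> l y) (F i))) u = 0}"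
    have "mp_eval (\<lambda>l. \<sigma> l ?y) (F i) = mp_eval ?y (mp_subst s (F i))" for i
      unfolding \<sigma>_def mp_eval_subst ..
    then have "3 < root_count d s F ?y"
      using spec[OF F, of ?y] by (simp only: root_count_def)
    then show "\<exists>c. c \<noteq> 0 \<and> 3 < root_count d s F (\<lambda>a. c * x a)"
      using j(2) by (intro exI[of _ "1 / x j"]) simp
  qed (use d in simp_all)
qed

text \<open>For \<open>k \<ge> 2\<close> three distinct roots suffice, and a dimension count over all of projective space
  gives them. For \<open>k = 1\<close> four are needed, but then \<open>D\<close> is a single point of the projective line.\<close>

lemma generic_roots:
  assumes n: "n \<ge> 1" and k: "k \<ge> 1" and d: "d \<ge> n + 3"
    and sD: "sD \<in> homog {..n} k" "sD \<noteq> 0" and hyp: "brody_hyperbolic n (zero_locus n sD)"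
    and basis: "is_basis_of (homog {..n} k) N s"
  shows "generically N d (\<lambda>F. \<forall>x\<in>nonzero_vecs n. mp_eval x sD = 0 \<longrightarrow>
    (\<exists>c. c \<noteq> 0 \<and> 2 * k + 2 \<le> k * root_count d s F (\<lambda>a. c * x a)))"
proof (cases "k = 1")
  case False
  show ?thesis
  proof (rule generically_mono, rule generically_ball)
    show "generically N d (\<lambda>F. \<forall>x. x j \<noteq> 0 \<longrightarrow> (\<exists>c. c \<noteq> 0 \<and> 2 < root_count d s F (\<lambda>a. c * x a)))"
      if "j \<in> {..n}" for j
      by (rule generic_roots_chart[OF basis]) (use d that in auto)
    fix F
    assume F: "\<forall>j\<in>{..n}. \<forall>x. x j \<noteq> 0 \<longrightarrow> (\<exists>c. c \<noteq> 0 \<and> 2 < root_count d s F (\<lambda>a. c * x a))"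
    show "\<forall>x\<in>nonzero_vecs n. mp_eval x sD = 0 \<longrightarrow>
      (\<exists>c. c \<noteq> 0 \<and> 2 * k + 2 \<le> k * root_count d s F (\<lambda>a. c * x a))"
    proof (intro ballI impI)
      fix x assume "x \<in> nonzero_vecs n"
      then obtain j where "j \<le> n" "x j \<noteq> 0"
        using nonzero_vecs_ex by blast
      then obtain c where c: "c \<noteq> 0" "2 < root_count d s F (\<lambda>a. c * x a)"
        using F by auto
      have "2 * k + 2 \<le> k * 3"
        using k False by simp
      also have "\<dots> \<le> k * root_count d s F (\<lambda>a. c * x a)"
        using c(2) by (intro mult_le_mono2) simp
      finally show "\<exists>c. c \<noteq> 0 \<and> 2 * k + 2 \<le> k * root_count d s F (\<lambda>a. c * x a)"
        using c(1) by blast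
    qed
  qed simp
next
  case True
  then have n1: "n = 1"
    using hyperbolic_hyperplane_dimension[of sD n] sD(1) hyp n by simp
  have sD1: "sD \<in> homog {..1} 1"
    using sD(1) True n1 by simp
  obtain x0 where x0: "x0 \<in> nonzero_vecs n" "mp_eval x0 sD = 0"
    using ex_linear_form_zero[OF sD1] n1 by auto
  show ?thesis
  proof (rule generically_mono, rule generic_roots_point[OF basis x0(1)])
    show "3 < d"
      using d n by simp
    fix F assume "\<exists>c. c \<noteq> 0 \<and> 3 < root_count d s F (\<lambda>a. c * x0 a)"
    then obtain c where c: "c \<noteq> 0" "3 < root_count d s F (\<lambda>a. c * x0 a)"
      by blast
    show "\<forall>x\<in>nonzero_vecs n. mp_eval x sD = 0 \<longrightarrow>
      (\<exists>c. c \<noteq> 0 \<and> 2 * k + 2 \<le> k * root_count d s F (\<lambda>a. c * x a))"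
    proof (intro ballI impI)
      fix x assume x: "x \<in> nonzero_vecs n" "mp_eval x sD = 0"
      obtain e where e: "e \<noteq> 0" "x0 = (\<lambda>i. e * x i)"
        using linear_form_zeros_proportional[OF sD1 sD(2), of x x0] x x0 n1 by auto
      have "(\<lambda>a. c * x0 a) = (\<lambda>a. (c * e) * x a)"
        by (simp add: e(2) mult.assoc)
      then show "\<exists>c. c \<noteq> 0 \<and> 2 * k + 2 \<le> k * root_count d s F (\<lambda>a. c * x a)"
        using c e(1) True by (intro exI[of _ "c * e"]) simp
    qed
  qed
qed

theorem theorem4:
  fixes n k d N :: nat and sD :: "nat mpoly" and s :: "nat \<Rightarrow> nat mpoly"
  assumes "n \<ge> 1" and "k \<ge> 1" and "d \<ge> n + 3"
    and "smooth_hypersurface n k sD"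
    and "brody_hyperbolic n (zero_locus n sD)"
    and "is_basis_of (homog {..n} k) N s"
  shows "generic_small_deformation d sD N s (\<lambda>G.
     hypersurface (n + 1) (d * k) (cyclic_cover n (d * k) G) \<and>
     brody_hyperbolic (n + 1) (zero_locus (n + 1) (cyclic_cover n (d * k) G)))"
proof -
  have sD: "sD \<in> homog {..n} k" "sD \<noteq> 0"
    using assms(4) by (simp_all add: smooth_hypersurface_def hypersurface_def)
  obtain Q where Q: "Q \<noteq> 0" "mp_supported (param_index N d) Q"
    "\<forall>F\<in>deform_params N d. mp_eval (param_coords F) Q \<noteq> 0 \<longrightarrow>
      (\<forall>x\<in>nonzero_vecs n. mp_eval x sD = 0 \<longrightarrow>
        (\<exists>c. c \<noteq> 0 \<and> 2 * k + 2 \<le> k * root_count d s F (\<lambda>a. c * x a)))"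
    using generic_roots[OF assms(1-3) sD assms(5,6)] unfolding generically_def by (elim exE conjE)
  \<comment> \<open>The principal open set of the single polynomial \<open>Q\<close>, non-empty
    because \<open>Q\<close> is nonzero.\<close>
  define U where "U = {F \<in> deform_params N d. \<exists>q\<in>{Q}. mp_eval (param_coords F) q \<noteq> 0}"
  show ?thesis
    unfolding generic_small_deformation_def
  proof (intro exI[of _ U] conjI ballI)
    show "zariski_open N d U"
      unfolding zariski_open_def U_def by blast
    show "U \<noteq> {}"
      using ex_deform_params[OF Q(1,2)] by (auto simp: U_def)
    fix F assume "F \<in> U"
    then have F: "F \<in> deform_params N d" "mp_eval (param_coords F) Q \<noteq> 0"
      by (simp_all add: U_def)
    note s = basis_homog[OF assms(6)]
    have "\<exists>\<epsilon>>0. \<forall>t. t \<noteq> 0 \<and> norm t \<le> \<epsilon> \<longrightarrow>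
        brody_hyperbolic (n + 1) (zero_locus (n + 1) (cyclic_cover n (d * k) (deformation d sD s F t)))"
      by (rule cyclic_covers_brody_hyperbolic[OF assms(2) _ sD(1) assms(5) s F(1)]) (use assms(3) Q(3) F in auto)
    moreover have "hypersurface (n + 1) (d * k) (cyclic_cover n (d * k) (deformation d sD s F t))" for t
      by (rule hypersurface_cyclic_cover[OF deformation_homog[OF sD(1) s F(1)]]) (use assms(2,3) in auto)
    ultimately show "\<exists>\<epsilon>>0. \<forall>t. t \<noteq> 0 \<and> norm t \<le> \<epsilon> \<longrightarrow>
        hypersurface (n + 1) (d * k) (cyclic_cover n (d * k) (deformation d sD s F t)) \<and>
        brody_hyperbolic (n + 1) (zero_locus (n + 1) (cyclic_cover n (d * k) (deformation d sD s F t)))"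
      by blast
  qed
qed

end
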